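(* Let $(V_1,V_2,V_3)$ be a commuting triple of bounded operators on a Hilbert space $\mathcal H$. The following are equivalent: (1) $(V_1,V_2,V_3)$ is a $\mathcal P$-isometry; (2) $(V_2,V_3)$ is a $\Gamma$-isometry and $V_1^*V_1=I-\tfrac14V_2^*V_2$.
   Context: The pentablock is $\mathcal P=\{(a_{21},\operatorname{tr}A,\det A): A\in M_2(\mathbb C),\ \|A\|<1\}$; $\Gamma$ is the closure of the symmetrized bidisc $\{(\operatorname{tr}A,\det A):\|A\|<1\}$, $b\Gamma=\{(s,p)\in\Gamma: s=\bar sp,\ |p|=1\}$, and $b\mathcal P=\{(a,s,p):(s,p)\in b\Gamma,\ |a|^2=1-|s|^2/4\}$. A $\mathcal P$-unitary is a triple of commuting normal operators with Taylor joint spectrum in $b\mathcal P$; a $\Gamma$-unitary is a pair of commuting normal operators with Taylor joint spectrum in $b\Gamma$. A commuting triple on $\mathcal H$ is a $\mathcal P$-isometry if it is the restriction of a $\mathcal P$-unitary on some Hilbert space $\mathcal K\supseteq\mathcal H$ to the joint invariant subspace $\mathcal H$; a $\Gamma$-isometry is the restriction of a $\Gamma$-unitary to a joint invariant subspace (equivalently, a commuting pair $(S,P)$ with $S=S^*P$, $P^*P=I$ and $\|S\|\le2$). *)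

theory Defs
  imports "HOL-Analysis.Analysis"
begin

class complex_vector = real_vector +
  fixes cscale :: "complex \<Rightarrow> 'a \<Rightarrow> 'a"
  assumes cscale_add_right: "cscale c (x + y) = cscale c x + cscale c y"
    and cscale_add_left: "cscale (c + d) x = cscale c x + cscale d x"
    and cscale_cscale: "cscale c (cscale d x) = cscale (c * d) x"
    and cscale_one: "cscale 1 x = x"
    and scaleR_cscale: "scaleR r x = cscale (complex_of_real r) x"

class complex_inner = complex_vector + real_normed_vector +
  fixes cinner :: "'a \<Rightarrow> 'a \<Rightarrow> complex"
  assumes cinner_commute: "cinner x y = cnj (cinner y x)"
    and cinner_add_right: "cinner x (y + z) = cinner x y + cinner x z"
    and cinner_cscale_right: "cinner x (cscale c y) = c * cinner x y"
    and norm_eq_sqrt_cinner: "norm x = sqrt (Re (cinner x x))"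

class chilbert_space = complex_inner + complete_space

instantiation prod :: (complex_vector, complex_vector) complex_vector
begin
definition cscale_prod_def: "cscale c x = (cscale c (fst x), cscale c (snd x))"
instance
  by standard (auto simp: cscale_prod_def cscale_add_right cscale_add_left
      cscale_cscale scaleR_cscale prod_eq_iff complex_vector_class.cscale_one)
end

instantiation prod :: (complex_inner, complex_inner) complex_inner
begin
definition cinner_prod_def:
  "cinner x y = cinner (fst x) (fst y) + cinner (snd x) (snd y)"
instance
proof
  fix x y z :: "'a \<times> 'b" and c :: complex
  show "cinner x y = cnj (cinner y x)"
    unfolding cinner_prod_def by (subst (1 2) cinner_commute) simp
  show "cinner x (y + z) = cinner x y + cinner x z"
    unfolding cinner_prod_def by (simp add: cinner_add_right)
  show "cinner x (cscale c y) = c * cinner x y"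
    unfolding cinner_prod_def cscale_prod_def by (simp add: cinner_cscale_right algebra_simps)
  have a: "(norm (fst x))\<^sup>2 = Re (cinner (fst x) (fst x))"
    using norm_eq_sqrt_cinner[of "fst x"]
    by (metis norm_ge_zero real_sqrt_ge_0_iff real_sqrt_pow2 real_sqrt_lt_0_iff
        not_less power2_eq_square sqrt_le_D)
  have b: "(norm (snd x))\<^sup>2 = Re (cinner (snd x) (snd x))"
    using norm_eq_sqrt_cinner[of "snd x"]
    by (metis norm_ge_zero real_sqrt_ge_0_iff real_sqrt_pow2 real_sqrt_lt_0_iff
        not_less power2_eq_square sqrt_le_D)
  show "norm x = sqrt (Re (cinner x x))"
    unfolding norm_prod_def cinner_prod_def using a b by simp
qed
end

instance prod :: (chilbert_space, chilbert_space) chilbert_space ..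

definition clinear_map :: "('a::complex_vector \<Rightarrow> 'b::complex_vector) \<Rightarrow> bool" where
  "clinear_map f \<longleftrightarrow> (\<forall>x y. f (x + y) = f x + f y) \<and> (\<forall>c x. f (cscale c x) = cscale c (f x))"

definition bounded_op :: "('a::complex_inner \<Rightarrow> 'b::complex_inner) \<Rightarrow> bool" where
  "bounded_op T \<longleftrightarrow> clinear_map T \<and> (\<exists>K. \<forall>x. norm (T x) \<le> norm x * K)"

text \<open>Hilbert-space adjoint (exists for bounded operators by Riesz representation).\<close>
definition adj :: "('a::complex_inner \<Rightarrow> 'b::complex_inner) \<Rightarrow> ('b \<Rightarrow> 'a)" where
  "adj T = (SOME S. bounded_op S \<and> (\<forall>x y. cinner (T x) y = cinner x (S y)))"

definition normal_op :: "('a::complex_inner \<Rightarrow> 'a) \<Rightarrow> bool" where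
  "normal_op T \<longleftrightarrow> bounded_op T \<and> T \<circ> adj T = adj T \<circ> T"

definition commute :: "('a \<Rightarrow> 'a) \<Rightarrow> ('a \<Rightarrow> 'a) \<Rightarrow> bool" where
  "commute S T \<longleftrightarrow> S \<circ> T = T \<circ> S"

text \<open>Isometric complex-linear embedding (identifies H with a closed subspace of K).\<close>
definition isometric_embedding :: "('a::complex_inner \<Rightarrow> 'b::complex_inner) \<Rightarrow> bool" where
  "isometric_embedding J \<longleftrightarrow> clinear_map J \<and> (\<forall>x. norm (J x) = norm x)"

definition koszul_exact2 :: "('a::complex_vector \<Rightarrow> 'a) \<Rightarrow> ('a \<Rightarrow> 'a) \<Rightarrow> bool" where
  "koszul_exact2 A B \<longleftrightarrow>
     (let d1 = (\<lambda>x. (A x, B x)); d2 = (\<lambda>(x1, x2). B x1 - A x2) in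
      inj d1 \<and> range d1 = {y. d2 y = 0} \<and> surj d2)"

definition taylor_spectrum2 :: "('a::complex_vector \<Rightarrow> 'a) \<Rightarrow> ('a \<Rightarrow> 'a) \<Rightarrow> (complex \<times> complex) set" where
  "taylor_spectrum2 A B =
     {(z1, z2). \<not> koszul_exact2 (\<lambda>x. A x - cscale z1 x) (\<lambda>x. B x - cscale z2 x)}"

definition koszul_exact3 ::
  "('a::complex_vector \<Rightarrow> 'a) \<Rightarrow> ('a \<Rightarrow> 'a) \<Rightarrow> ('a \<Rightarrow> 'a) \<Rightarrow> bool" where
  "koszul_exact3 A B C \<longleftrightarrow>
     (let d1 = (\<lambda>x. (A x, B x, C x));
          d2 = (\<lambda>(x1, x2, x3). (B x1 - A x2, C x1 - A x3, C x2 - B x3));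
          d3 = (\<lambda>(y1, y2, y3). C y1 - B y2 + A y3) in
      inj d1 \<and> range d1 = {y. d2 y = 0} \<and> range d2 = {y. d3 y = 0} \<and> surj d3)"

definition taylor_spectrum3 ::
  "('a::complex_vector \<Rightarrow> 'a) \<Rightarrow> ('a \<Rightarrow> 'a) \<Rightarrow> ('a \<Rightarrow> 'a) \<Rightarrow> (complex \<times> complex \<times> complex) set" where
  "taylor_spectrum3 A B C =
     {(z1, z2, z3). \<not> koszul_exact3 (\<lambda>x. A x - cscale z1 x) (\<lambda>x. B x - cscale z2 x)
                                    (\<lambda>x. C x - cscale z3 x)}"

definition mat_norm2 :: "complex^2^2 \<Rightarrow> real" where
  "mat_norm2 A = onorm (\<lambda>x. A *v x)"

definition Gamma :: "(complex \<times> complex) set" where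
  "Gamma = closure {(A$1$1 + A$2$2, A$1$1 * A$2$2 - A$1$2 * A$2$1) | A. mat_norm2 A < 1}"

definition bGamma :: "(complex \<times> complex) set" where
  "bGamma = {(s, p). (s, p) \<in> Gamma \<and> s = cnj s * p \<and> cmod p = 1}"

definition bPenta :: "(complex \<times> complex \<times> complex) set" where
  "bPenta = {(a, s, p). (s, p) \<in> bGamma \<and> (cmod a)\<^sup>2 = 1 - (cmod s)\<^sup>2 / 4}"

definition Gamma_unitary :: "('a::complex_inner \<Rightarrow> 'a) \<Rightarrow> ('a \<Rightarrow> 'a) \<Rightarrow> bool" where
  "Gamma_unitary S P \<longleftrightarrow> normal_op S \<and> normal_op P \<and> commute S P
     \<and> taylor_spectrum2 S P \<subseteq> bGamma"

definition Penta_unitary :: "('a::complex_inner \<Rightarrow> 'a) \<Rightarrow> ('a \<Rightarrow> 'a) \<Rightarrow> ('a \<Rightarrow> 'a) \<Rightarrow> bool" where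
  "Penta_unitary N1 N2 N3 \<longleftrightarrow> normal_op N1 \<and> normal_op N2 \<and> normal_op N3
     \<and> commute N1 N2 \<and> commute N1 N3 \<and> commute N2 N3
     \<and> taylor_spectrum3 N1 N2 N3 \<subseteq> bPenta"

text \<open>Restriction of a unitary on a Hilbert space K (of type 'b) to a jointly invariant
  subspace identified with H via an isometric embedding J.\<close>
definition Gamma_isometry_in ::
  "'b::chilbert_space itself \<Rightarrow> ('a::chilbert_space \<Rightarrow> 'a) \<Rightarrow> ('a \<Rightarrow> 'a) \<Rightarrow> bool" where
  "Gamma_isometry_in TYPE('b) S P \<longleftrightarrow>
     (\<exists>(J::'a \<Rightarrow> 'b) S' P'. isometric_embedding J \<and> Gamma_unitary S' P'
        \<and> (\<forall>x. S' (J x) = J (S x)) \<and> (\<forall>x. P' (J x) = J (P x)))"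

definition Penta_isometry_in ::
  "'b::chilbert_space itself \<Rightarrow> ('a::chilbert_space \<Rightarrow> 'a) \<Rightarrow> ('a \<Rightarrow> 'a) \<Rightarrow> ('a \<Rightarrow> 'a) \<Rightarrow> bool" where
  "Penta_isometry_in TYPE('b) V1 V2 V3 \<longleftrightarrow>
     (\<exists>(J::'a \<Rightarrow> 'b) N1 N2 N3. isometric_embedding J \<and> Penta_unitary N1 N2 N3
        \<and> (\<forall>x. N1 (J x) = J (V1 x)) \<and> (\<forall>x. N2 (J x) = J (V2 x)) \<and> (\<forall>x. N3 (J x) = J (V3 x)))"

end

theory Submission
  imports Defs "HOL-Complex_Analysis.Cauchy_Integral_Formula"
begin

text \<open>
  Both conditions are equivalent to the relations \<open>V\<^sub>3\<^sup>*V\<^sub>3 = 1\<close>, \<open>V\<^sub>2 = V\<^sub>2\<^sup>*V\<^sub>3\<close> and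
  \<open>V\<^sub>1\<^sup>*V\<^sub>1 = 1 - V\<^sub>2\<^sup>*V\<^sub>2/4\<close>, the last of which forces \<open>norm V\<^sub>2 \<le> 2\<close>. For commuting
  normal operators such relations mean that the Taylor spectrum lies in \<open>bPenta\<close> resp. \<open>bGamma\<close>: an
  element of the algebra generated by them (which is commutative by Fuglede's theorem) attains its norm on
  joint approximate eigenvectors, and a joint approximate eigenvalue lies in the Taylor spectrum; conversely,
  at a point violating the equations a Bezout identity makes the Koszul complex exact. The
  relations pass to restrictions. To extend operators satisfying them, \<open>V\<^sub>3\<close> is first extended to a
  unitary \<open>U\<close>, which by the Wold decomposition is possible inside the given space, and \<open>V\<^sub>1, V\<^sub>2\<close> follow
  by strong limits. Then \<open>V\<^sub>2\<close> is normal and \<open>V\<^sub>1\<close> quasinormal, and the latter has an explicit normal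
  extension on the doubled space, given by a two-by-two matrix.
\<close>

section \<open>Complex inner product spaces\<close>

text \<open>An existential over Hilbert spaces would be one over types, so the extension has to live
  on a space named in advance, here the doubled space. This is why the unitary extension of
  \<open>V3\<close> is sought without leaving the given space: the second coordinate is reserved for
  the normal extension of \<open>V1\<close>. \<open>V3\<close> is treated before the other two
  because only for an invertible \<open>U\<close> can \<open>V2 = V2\<^sup>\<dagger> * U\<close> be
  solved for the adjoint: \<open>V2\<^sup>\<dagger> = U\<^sup>\<dagger> * V2\<close> then commutes
  with everything that commutes with \<open>V2\<close> and \<open>U\<close>, so \<open>V1\<close>
  commutes with \<open>V1\<^sup>\<dagger> * V1\<close>, which is quasinormality. On the spectral
  side no spectral measure appears. Singularity is expressed by quadratic forms, products of
  commuting positive operators are controlled by square roots, and the Koszul complex is entered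
  only at its two easy ends: failure of surjectivity of its last map puts a point into the spectrum,
  and a Bezout identity with commuting coefficients makes the complex exact.\<close>

lemma cscale_zero_right [simp]: "cscale c 0 = (0::'a::complex_vector)"
  using cscale_add_right[of c 0 "0::'a"] by simp

lemma cscale_zero_left [simp]: "cscale 0 x = (0::'a::complex_vector)"
  using cscale_add_left[of 0 0 x] by simp

lemma cscale_minus_left: "cscale (- c) x = - cscale c (x::'a::complex_vector)"
  using cscale_add_left[of c "- c" x] by (simp add: eq_neg_iff_add_eq_0 add.commute)

lemma cscale_diff_left: "cscale (c - d) x = cscale c x - cscale d (x::'a::complex_vector)"
  using cscale_add_left[of c "- d" x] by (simp add: cscale_minus_left)

lemma cinner_add_left: "cinner (x + y) z = cinner x z + cinner (y::'a::complex_inner) z"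
  by (metis cinner_add_right cinner_commute complex_cnj_add)

lemma cinner_cscale_left: "cinner (cscale c x) y = cnj c * cinner x (y::'a::complex_inner)"
  by (metis cinner_cscale_right cinner_commute complex_cnj_mult)

lemma cinner_scaleR_right: "cinner x (r *\<^sub>R y) = of_real r * cinner x (y::'a::complex_inner)"
  by (simp add: scaleR_cscale cinner_cscale_right)

lemma cinner_scaleR_left: "cinner (r *\<^sub>R x) y = of_real r * cinner x (y::'a::complex_inner)"
  by (simp add: scaleR_cscale cinner_cscale_left)

lemma cinner_zero [simp]: "cinner x 0 = 0" "cinner 0 x = 0" for x :: "'a::complex_inner"
  using cinner_scaleR_right[of x 0 x] cinner_scaleR_left[of 0 x x] by simp_all

lemma cinner_minus_right: "cinner x (- y) = - cinner x (y::'a::complex_inner)"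
  using cinner_scaleR_right[of x "-1" y] by simp

lemma cinner_minus_left: "cinner (- x) y = - cinner x (y::'a::complex_inner)"
  using cinner_scaleR_left[of "-1" x y] by simp

lemma cinner_diff_right: "cinner x (y - z) = cinner x y - cinner x (z::'a::complex_inner)"
  using cinner_add_right[of x y "- z"] by (simp add: cinner_minus_right)

lemma cinner_diff_left: "cinner (x - y) z = cinner x z - cinner y (z::'a::complex_inner)"
  using cinner_add_left[of x "- y" z] by (simp add: cinner_minus_left)

lemmas cinner_linear = cinner_add_left cinner_add_right cinner_diff_left cinner_diff_right
  cinner_minus_left cinner_minus_right cinner_cscale_left cinner_cscale_right
  cinner_scaleR_left cinner_scaleR_right

lemma Im_cinner_self [simp]: "Im (cinner x x) = 0" for x :: "'a::complex_inner"
  using cinner_commute[of x x] by (metis Reals_cnj_iff complex_is_Real_iff)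

lemma Re_cinner_self: "Re (cinner x x) = (norm x)\<^sup>2" for x :: "'a::complex_inner"
  by (metis norm_eq_sqrt_cinner norm_ge_zero real_sqrt_ge_0_iff real_sqrt_pow2)

lemma cinner_self: "cinner x x = of_real ((norm x)\<^sup>2)" for x :: "'a::complex_inner"
  by (simp add: complex_eq_iff Re_cinner_self)

lemma cinner_self_eq_0: "cinner x x = 0 \<longleftrightarrow> x = 0" for x :: "'a::complex_inner"
  by (simp add: cinner_self)

lemma norm_add_sq: "(norm (x + y))\<^sup>2 = (norm x)\<^sup>2 + (norm y)\<^sup>2 + 2 * Re (cinner x y)"
  for x y :: "'a::complex_inner"
proof -
  have "Re (cinner y x) = Re (cinner x y)"
    using cinner_commute[of y x] by simp
  then show ?thesis
    unfolding Re_cinner_self[symmetric] by (simp add: cinner_linear)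
qed

lemma norm_diff_sq: "(norm (x - y))\<^sup>2 = (norm x)\<^sup>2 + (norm y)\<^sup>2 - 2 * Re (cinner x y)"
  for x y :: "'a::complex_inner"
  using norm_add_sq[of x "- y"] by (simp add: cinner_linear)

lemma norm_cscale: "norm (cscale c x) = cmod c * norm (x::'a::complex_inner)"
proof -
  have "(norm (cscale c x))\<^sup>2 = (cmod c * norm x)\<^sup>2"
  proof -
    have "cinner (cscale c x) (cscale c x) = (c * cnj c) * cinner x x"
      by (simp add: cinner_linear)
    also have "\<dots> = of_real ((cmod c)\<^sup>2 * (norm x)\<^sup>2)"
      by (simp add: complex_norm_square cinner_self del: of_real_power)
    finally show ?thesis by (simp add: cinner_self power_mult_distrib flip: of_real_power of_real_mult)
  qed
  then show ?thesis
    by (simp add: power2_eq_iff_nonneg)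
qed

lemma Re_cinner_le: "Re (cinner x y) \<le> norm x * norm (y::'a::complex_inner)"
proof (cases "x = 0 \<or> y = 0")
  case False
  define a b where "a = norm x" and "b = norm y"
  have pos: "a > 0" "b > 0" using False by (auto simp: a_def b_def)
  have "0 \<le> (norm (b *\<^sub>R x - a *\<^sub>R y))\<^sup>2" by simp
  also have "\<dots> = 2 * (a * b) * (a * b - Re (cinner x y))"
    unfolding norm_diff_sq by (simp add: cinner_linear a_def b_def algebra_simps power2_eq_square)
  finally have "\<not> a * b - Re (cinner x y) < 0"
    using mult_pos_neg[of "2 * (a * b)" "a * b - Re (cinner x y)"] mult_pos_pos[OF pos] by linarith
  then show ?thesis by (simp add: a_def b_def)
qed auto

lemma Cauchy_Schwarz: "cmod (cinner x y) \<le> norm x * norm (y::'a::complex_inner)"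
proof (cases "cinner x y = 0")
  case False
  \<comment> \<open>The phase \<open>c\<close> rotates the inner product onto the positive real
    axis, which reduces the claim to the real part.\<close>
  define c where "c = cnj (sgn (cinner x y))"
  have c: "cmod c = 1" using False by (simp add: c_def norm_sgn)
  have "c * cinner x y = of_real (cmod (cinner x y))"
    using False by (simp add: c_def sgn_eq complex_norm_square[symmetric] field_simps power2_eq_square)
  then have "cmod (cinner x y) = Re (cinner x (cscale c y))"
    by (simp add: cinner_linear)
  also have "\<dots> \<le> norm x * norm y"
    using Re_cinner_le[of x "cscale c y"] by (simp add: norm_cscale c)
  finally show ?thesis .
qed auto

lemma bounded_bilinear_cinner: "bounded_bilinear (cinner :: 'a::complex_inner \<Rightarrow> 'a \<Rightarrow> complex)"
proof
  show "\<exists>K. \<forall>a b::'a. cmod (cinner a b) \<le> norm a * norm b * K"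
    using Cauchy_Schwarz by (intro exI[of _ 1]) auto
qed (auto simp: cinner_linear scaleR_conv_of_real)

lemmas tendsto_cinner [tendsto_intros] = bounded_bilinear.tendsto[OF bounded_bilinear_cinner]

lemma bounded_linear_cscale: "bounded_linear (cscale c :: 'a::complex_inner \<Rightarrow> 'a)"
  by (rule bounded_linear_intro[where K = "cmod c"])
     (auto simp: cscale_add_right scaleR_cscale cscale_cscale norm_cscale mult.commute)

lemmas tendsto_cscale [tendsto_intros] = bounded_linear.tendsto[OF bounded_linear_cscale]

lemma cinner_ext: "(\<And>z. cinner z x = cinner z y) \<Longrightarrow> x = (y::'a::complex_inner)"
  using cinner_self_eq_0[of "x - y"] by (simp add: cinner_diff_right)

text \<open>The functional \<open>f\<close> is represented by the minimiser of \<open>\<lambda>x. (norm x)\<^sup>2 - 2 * Re (f x)\<close>, which the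
  parallelogram law provides.\<close>
lemma Riesz_representation:
  fixes f :: "'a::chilbert_space \<Rightarrow> complex"
  assumes add: "\<And>x y. f (x + y) = f x + f y" and sc: "\<And>c x. f (cscale c x) = c * f x"
    and bd: "\<And>x. cmod (f x) \<le> K * norm x"
  shows "\<exists>v. \<forall>x. f x = cinner v x"
proof -
  define Q where "Q x = (norm x)\<^sup>2 - 2 * Re (f x)" for x
  have fR: "f (r *\<^sub>R x) = of_real r * f x" for r x by (simp add: scaleR_cscale sc)
  have f0: "f 0 = 0" using fR[of 0 0] by simp
  have Qb: "Q x \<ge> - K\<^sup>2" for x
  proof -
    have "Re (f x) \<le> K * norm x" using bd[of x] complex_Re_le_cmod[of "f x"] by linarith
    moreover have "0 \<le> (norm x - K)\<^sup>2" by simp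
    ultimately show ?thesis by (simp add: Q_def power2_eq_square algebra_simps)
  qed
  define d where "d = Inf (range Q)"
  have bb: "bdd_below (range Q)" using Qb by (intro bdd_belowI[of _ "- K\<^sup>2"]) auto
  have dQ: "d \<le> Q x" for x unfolding d_def by (rule cInf_lower[OF _ bb]) auto
  have "\<exists>x. Q x < d + 1 / (real n + 1)" for n
  proof -
    have "Inf (range Q) < d + 1 / (real n + 1)" by (simp add: d_def)
    then show ?thesis using cInf_less_iff[OF _ bb] by auto
  qed
  then obtain X where X: "\<And>n. Q (X n) < d + 1 / (real n + 1)" by metis
  \<comment> \<open>The linear terms cancel. Two points where \<open>Q\<close> is almost
    \<open>d\<close> are therefore close, because \<open>Q\<close> is at least \<open>d\<close> at
    their midpoint.\<close>
  have par: "(norm (x - y))\<^sup>2 = 2 * Q x + 2 * Q y - 4 * Q ((1/2) *\<^sub>R (x + y))" for x y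
    by (simp add: Q_def norm_diff_sq norm_add_sq power_mult_distrib fR add cinner_linear algebra_simps power_divide)
  have lim: "(\<lambda>n. 1 / (real n + 1)) \<longlonglongrightarrow> 0"
    using LIMSEQ_inverse_real_of_nat by (simp add: inverse_eq_divide add.commute)
  have "Cauchy X"
  proof (rule CauchyI)
    fix e :: real assume e: "0 < e"
    have "e\<^sup>2 / 4 > 0" using e by simp
    from order_tendstoD(2)[OF lim this] obtain M where
      M: "\<And>n. n \<ge> M \<Longrightarrow> 1 / (real n + 1) < e\<^sup>2 / 4" unfolding eventually_sequentially by auto
    show "\<exists>M. \<forall>m\<ge>M. \<forall>n\<ge>M. norm (X m - X n) < e"
    proof (intro exI[of _ M] allI impI)
      fix m n assume "M \<le> m" "M \<le> n"
      then have "Q (X m) < d + e\<^sup>2/4" "Q (X n) < d + e\<^sup>2/4"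
        using M X by (meson add_strict_left_mono less_trans)+
      then have "(norm (X m - X n))\<^sup>2 < e\<^sup>2"
        using par[of "X m" "X n"] dQ[of "(1/2) *\<^sub>R (X m + X n)"] by linarith
      then show "norm (X m - X n) < e" using e by (simp add: power2_less_imp_less)
    qed
  qed
  then obtain v where v: "X \<longlonglongrightarrow> v" using Cauchy_convergent_iff convergent_def by blast
  have "bounded_linear f"
    by (rule bounded_linear_intro[where K = K])
       (auto simp: add fR scaleR_conv_of_real bd mult.commute)
  then have "(\<lambda>n. f (X n)) \<longlonglongrightarrow> f v" using v by (rule bounded_linear.tendsto)
  then have "(\<lambda>n. Q (X n)) \<longlonglongrightarrow> Q v" unfolding Q_def by (intro tendsto_intros v)
  moreover have "(\<lambda>n. d + 1 / (real n + 1)) \<longlonglongrightarrow> d" using tendsto_add[OF tendsto_const lim] by simp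
  ultimately have "Q v \<le> d" using X by (intro LIMSEQ_le) (auto intro!: exI less_imp_le)
  then have min: "Q v \<le> Q x" for x using dQ by (meson order_trans)
  have Re_eq: "Re (f x) = Re (cinner v x)" for x
  proof -
    define b where "b = Re (cinner v x) - Re (f x)"
    have ineq: "0 \<le> t\<^sup>2 * (norm x)\<^sup>2 + 2 * t * b" for t
    proof -
      have "Q (v + t *\<^sub>R x) = Q v + t\<^sup>2 * (norm x)\<^sup>2 + 2 * t * b"
        by (simp add: Q_def norm_add_sq cinner_linear add fR b_def power_mult_distrib algebra_simps)
      then show ?thesis using min[of "v + t *\<^sub>R x"] by linarith
    qed
    have "b = 0"
    proof (cases "x = 0")
      case True then show ?thesis by (simp add: b_def f0)
    next
      case False
      then have n: "(norm x)\<^sup>2 > 0" by simp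
      \<comment> \<open>This \<open>t\<close> minimises the quadratic; the minimum is
        \<open>- b\<^sup>2 / (norm x)\<^sup>2\<close>, so \<open>b\<close> must vanish.\<close>
      have "0 \<le> (- b / (norm x)\<^sup>2)\<^sup>2 * (norm x)\<^sup>2 + 2 * (- b / (norm x)\<^sup>2) * b" by (rule ineq)
      also have "\<dots> = - b\<^sup>2 / (norm x)\<^sup>2" using n by (simp add: field_simps power2_eq_square)
      finally have "0 \<le> - (b\<^sup>2 / (norm x)\<^sup>2)" by simp
      then show ?thesis using n by (simp add: divide_le_0_iff)
    qed
    then show ?thesis by (simp add: b_def)
  qed
  have "f x = cinner v x" for x
    using Re_eq[of x] Re_eq[of "cscale \<i> x"] by (simp add: complex_eq_iff sc cinner_linear)
  then show ?thesis by blast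
qed

section \<open>Bounded operators on a Hilbert space\<close>

lemma bounded_op_bounded_linear: "bounded_op T \<Longrightarrow> bounded_linear T"
  unfolding bounded_op_def clinear_map_def
  by (auto intro!: bounded_linear_intro[of T] simp: scaleR_cscale)

lemma bounded_opI:
  assumes "\<And>x y. T (x + y) = T x + T y" "\<And>c x. T (cscale c x) = cscale c (T x)"
    "\<And>x. norm (T x) \<le> K * norm x"
  shows "bounded_op T"
  unfolding bounded_op_def clinear_map_def using assms by (auto simp: mult.commute intro!: exI[of _ K])

text \<open>\<open>adj\<close> is defined by a choice, so nothing is known about it until some
  adjoint exists. Its value at \<open>y\<close> is the Riesz vector of the functional taking
  \<open>x\<close> to \<open>cinner y (T x)\<close>.\<close>

lemma bounded_op_adj_exists:
  fixes T :: "'a::chilbert_space \<Rightarrow> 'a"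
  assumes "bounded_op T"
  shows "\<exists>S. bounded_op S \<and> (\<forall>x y. cinner (T x) y = cinner x (S y))"
proof -
  have lin: "T (x + y) = T x + T y" "T (cscale c x) = cscale c (T x)" for x y c
    using assms by (auto simp: bounded_op_def clinear_map_def)
  obtain K where K: "\<And>x. norm (T x) \<le> norm x * K" using assms by (auto simp: bounded_op_def)
  define L where "L = \<bar>K\<bar>"
  have L: "norm (T x) \<le> L * norm x" "L \<ge> 0" for x
    using K[of x] mult_left_mono[OF abs_ge_self norm_ge_zero, of x K]
    by (simp_all add: L_def mult.commute)
  have bd: "cmod (cinner y (T x)) \<le> (norm y * L) * norm x" for x y
    using Cauchy_Schwarz[of y "T x"] mult_left_mono[OF L(1)[of x], of "norm y"]
    by (simp add: mult.assoc)
  have "\<exists>v. \<forall>x. cinner y (T x) = cinner v x" for y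
    by (rule Riesz_representation[where K = "norm y * L"])
       (simp_all add: lin cinner_linear bd)
  then obtain S where S: "\<And>x y. cinner y (T x) = cinner (S y) x" by metis
  have S': "cinner (T x) y = cinner x (S y)" for x y
    using S[of y x] cinner_commute[of "T x" y] cinner_commute[of x "S y"] by simp
  have "bounded_op S"
  proof (rule bounded_opI[where K = L])
    show "S (x + y) = S x + S y" for x y
      by (rule cinner_ext) (simp add: S'[symmetric] cinner_linear)
    show "S (cscale c x) = cscale c (S x)" for c x
      by (rule cinner_ext) (simp add: S'[symmetric] cinner_linear)
    show "norm (S y) \<le> L * norm y" for y
    proof -
      have "norm (S y) * norm (S y) = cmod (cinner y (T (S y)))"
        by (simp add: S cinner_self power2_eq_square norm_mult)
      also have "\<dots> \<le> norm y * L * norm (S y)" by (rule bd)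
      finally have "norm (S y) * norm (S y) \<le> (norm y * L) * norm (S y)" .
      then show ?thesis
        by (cases "S y = 0") (auto simp: mult.commute L(2))
    qed
  qed
  then show ?thesis using S' by blast
qed

lemma adj_props:
  fixes T :: "'a::chilbert_space \<Rightarrow> 'a"
  assumes "bounded_op T"
  shows "bounded_op (adj T)" "cinner (T x) y = cinner x (adj T y)"
  using someI_ex[OF bounded_op_adj_exists[OF assms]] unfolding adj_def by blast+

text \<open>The space may be trivial, in which case zero and one coincide: the operators form a
  \<open>ring\<close> and a \<open>monoid_mult\<close>, but not a \<open>ring_1\<close>.\<close>

typedef (overloaded) 'a cop = "{f :: 'a::chilbert_space \<Rightarrow> 'a. bounded_op f}"
  morphisms app Cop
  by (rule exI[of _ "\<lambda>x. 0"]) (auto simp: bounded_op_def clinear_map_def intro!: exI[of _ 0])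

setup_lifting type_definition_cop

notation app (infixr \<open>\<cdot>\<close> 75)

lemma bounded_op_app [simp]: "bounded_op (app T)"
  using app[of T] by simp

lemma bounded_linear_app: "bounded_linear (app T)"
  by (rule bounded_op_bounded_linear) simp

lemma app_Cop: "bounded_op f \<Longrightarrow> Cop f \<cdot> x = f x"
  by (simp add: Cop_inverse)

lemma cop_eqI: "(\<And>x. S \<cdot> x = T \<cdot> x) \<Longrightarrow> S = T"
  by transfer auto

lemma app_add_right: "T \<cdot> (x + y) = T \<cdot> x + T \<cdot> y"
  and app_cscale_right: "T \<cdot> cscale c x = cscale c (T \<cdot> x)"
  by (transfer, auto simp: bounded_op_def clinear_map_def)+

lemma app_zero_right [simp]: "T \<cdot> 0 = 0"
  using app_cscale_right[of T 0 0] by simp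

lemma app_scaleR_right: "T \<cdot> (r *\<^sub>R x) = r *\<^sub>R (T \<cdot> x)"
  by (simp add: scaleR_cscale app_cscale_right)

lemma app_diff_right: "T \<cdot> (x - y) = T \<cdot> x - T \<cdot> y"
  by (rule linear_diff[OF bounded_linear.linear[OF bounded_linear_app]])

lemma app_minus_right: "T \<cdot> (- x) = - (T \<cdot> x)"
  using app_diff_right[of T 0 x] by simp

lemmas app_linear = app_add_right app_diff_right app_minus_right app_cscale_right app_scaleR_right

lemmas tendsto_app [tendsto_intros] = bounded_linear.tendsto[OF bounded_linear_app]

lemma bounded_op_add: "bounded_op f \<Longrightarrow> bounded_op g \<Longrightarrow> bounded_op (\<lambda>x. f x + g x)"
  using bounded_linear_add[OF bounded_op_bounded_linear bounded_op_bounded_linear, of f g]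
  by (auto simp: bounded_op_def clinear_map_def cscale_add_right dest: bounded_linear.bounded)

lemma bounded_op_cscale: "bounded_op f \<Longrightarrow> bounded_op (\<lambda>x. cscale c (f x))"
  using bounded_linear.bounded[OF bounded_linear_compose[OF bounded_linear_cscale bounded_op_bounded_linear, of f c]]
  unfolding bounded_op_def clinear_map_def
  by (simp add: cscale_add_right cscale_cscale mult.commute[of c])

lemma bounded_op_scaleR: "bounded_op f \<Longrightarrow> bounded_op (\<lambda>x. r *\<^sub>R f x)"
  unfolding scaleR_cscale by (rule bounded_op_cscale)

lemma bounded_op_minus: "bounded_op f \<Longrightarrow> bounded_op (\<lambda>x. - f x)"
  using bounded_op_scaleR[of f "-1"] by simp

lemma bounded_op_diff: "bounded_op f \<Longrightarrow> bounded_op g \<Longrightarrow> bounded_op (\<lambda>x. f x - g x)"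
  using bounded_op_add[OF _ bounded_op_minus, of f g] by simp

lemma bounded_op_comp: "bounded_op f \<Longrightarrow> bounded_op g \<Longrightarrow> bounded_op (\<lambda>x. f (g x))"
  using bounded_linear_compose[OF bounded_op_bounded_linear bounded_op_bounded_linear, of f g]
  by (auto simp: bounded_op_def clinear_map_def dest: bounded_linear.bounded)

lemma bounded_op_zero: "bounded_op (\<lambda>x. 0)"
  by (rule bounded_opI[where K = 0]) auto

lemma bounded_op_id: "bounded_op (\<lambda>x. x)"
  by (rule bounded_opI[where K = 1]) auto

instantiation cop :: (chilbert_space) real_normed_algebra
begin

lift_definition norm_cop :: "'a cop \<Rightarrow> real" is onorm .
lift_definition minus_cop :: "'a cop \<Rightarrow> 'a cop \<Rightarrow> 'a cop" is "\<lambda>f g x. f x - g x"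
  by (rule bounded_op_diff)
lift_definition uminus_cop :: "'a cop \<Rightarrow> 'a cop" is "\<lambda>f x. - f x"
  by (rule bounded_op_minus)
lift_definition zero_cop :: "'a cop" is "\<lambda>x. 0"
  by (rule bounded_op_zero)
lift_definition plus_cop :: "'a cop \<Rightarrow> 'a cop \<Rightarrow> 'a cop" is "\<lambda>f g x. f x + g x"
  by (rule bounded_op_add)
lift_definition times_cop :: "'a cop \<Rightarrow> 'a cop \<Rightarrow> 'a cop" is "\<lambda>f g x. f (g x)"
  by (rule bounded_op_comp)
lift_definition scaleR_cop :: "real \<Rightarrow> 'a cop \<Rightarrow> 'a cop" is "\<lambda>r f x. r *\<^sub>R f x"
  by (rule bounded_op_scaleR)

definition dist_cop :: "'a cop \<Rightarrow> 'a cop \<Rightarrow> real"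
  where "dist_cop a b = norm (a - b)"
definition [code del]:
  "(uniformity :: ('a cop \<times> 'a cop) filter) = (INF e\<in>{0 <..}. principal {(x, y). dist x y < e})"
definition open_cop :: "'a cop set \<Rightarrow> bool"
  where [code del]: "open_cop S = (\<forall>x\<in>S. \<forall>\<^sub>F (x', y) in uniformity. x' = x \<longrightarrow> y \<in> S)"
definition sgn_cop :: "'a cop \<Rightarrow> 'a cop"
  where "sgn_cop x = scaleR (inverse (norm x)) x"

instance
proof
  fix a b c :: "'a cop" and r s :: real and U :: "'a cop set"
  have lin: "T \<cdot> (x + y) = T \<cdot> x + T \<cdot> y" "T \<cdot> (r *\<^sub>R x) = r *\<^sub>R (T \<cdot> x)" for T :: "'a cop" and x y r
    by (simp_all add: app_linear)
  show "a + b + c = a + (b + c)" "a + b = b + a" "0 + a = a" "- a + a = 0" "a - b = a + - b"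
    "a * b * c = a * (b * c)"
    by (transfer; simp add: algebra_simps)+
  show "(a + b) * c = a * c + b * c"
    by transfer simp
  show "a * (b + c) = a * b + a * c"
    by (transfer, drule bounded_op_bounded_linear) (simp add: bounded_linear.linear linear_add)
  show "r *\<^sub>R a * b = r *\<^sub>R (a * b)" by transfer simp
  show "a * r *\<^sub>R b = r *\<^sub>R (a * b)"
    by (transfer, drule bounded_op_bounded_linear) (simp add: bounded_linear.linear linear_scale)
  show "r *\<^sub>R (a + b) = r *\<^sub>R a + r *\<^sub>R b" "(r + s) *\<^sub>R a = r *\<^sub>R a + s *\<^sub>R a"
    "r *\<^sub>R s *\<^sub>R a = (r * s) *\<^sub>R a" "1 *\<^sub>R a = a"
    by (transfer; simp add: algebra_simps)+
  show "dist a b = norm (a - b)" by (rule dist_cop_def)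
  show "sgn a = inverse (norm a) *\<^sub>R a" by (rule sgn_cop_def)
  show "uniformity = (INF e\<in>{0 <..}. principal {(x, y :: 'a cop). dist x y < e})"
    by (rule uniformity_cop_def)
  show "open U = (\<forall>x\<in>U. \<forall>\<^sub>F (x', y) in uniformity. x' = x \<longrightarrow> y \<in> U)" by (rule open_cop_def)
  show "norm a = 0 \<longleftrightarrow> a = 0"
    by transfer (auto simp: onorm_eq_0 bounded_op_bounded_linear fun_eq_iff)
  show "norm (a + b) \<le> norm a + norm b"
    by transfer (simp add: onorm_triangle bounded_op_bounded_linear)
  show "norm (r *\<^sub>R a) = \<bar>r\<bar> * norm a"
    by transfer (simp add: onorm_scaleR bounded_op_bounded_linear)
  show "norm (a * b) \<le> norm a * norm b"
    by transfer (use onorm_compose in \<open>force simp: bounded_op_bounded_linear o_def\<close>)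
qed

end

instantiation cop :: (chilbert_space) monoid_mult
begin
lift_definition one_cop :: "'a cop" is "\<lambda>x. x"
  by (rule bounded_op_id)
instance by (standard; transfer; simp)
end

text \<open>The operators form only a real algebra; complex scalars are represented in it by central
  elements, the multiples of the identity.\<close>

lift_definition cs :: "complex \<Rightarrow> 'a::chilbert_space cop" is "\<lambda>c x. cscale c x"
  using bounded_op_cscale[OF bounded_op_id] .

lift_definition star :: "'a::chilbert_space cop \<Rightarrow> 'a cop" (\<open>(_\<^sup>\<dagger>)\<close> [1000] 1000) is adj
  by (rule adj_props)

lemma app_ops [simp]: "(S + T) \<cdot> x = S \<cdot> x + T \<cdot> x" "(S - T) \<cdot> x = S \<cdot> x - T \<cdot> x"
  "(- T) \<cdot> x = - (T \<cdot> x)" "0 \<cdot> x = 0" "(S * T) \<cdot> x = S \<cdot> T \<cdot> x" "1 \<cdot> x = x"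
  "(r *\<^sub>R T) \<cdot> x = r *\<^sub>R (T \<cdot> x)" "cs c \<cdot> x = cscale c x"
  by (transfer; simp)+

lemma cinner_app_left: "cinner (T \<cdot> x) y = cinner x (T\<^sup>\<dagger> \<cdot> y)"
  by transfer (rule adj_props)

lemma cinner_app_right: "cinner x (T \<cdot> y) = cinner (T\<^sup>\<dagger> \<cdot> x) y"
  using cinner_app_left[of T y x] cinner_commute[of x "T \<cdot> y"] cinner_commute[of "T\<^sup>\<dagger> \<cdot> x" y] by simp

lemma star_unique: "(\<And>x y. cinner (T \<cdot> x) y = cinner x (S \<cdot> y)) \<Longrightarrow> T\<^sup>\<dagger> = S"
  by (rule cop_eqI, rule cinner_ext) (simp add: cinner_app_left)

lemma star_star [simp]: "T\<^sup>\<dagger>\<^sup>\<dagger> = T"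
  by (rule star_unique) (simp add: cinner_app_right)

lemma star_add [simp]: "(S + T)\<^sup>\<dagger> = S\<^sup>\<dagger> + T\<^sup>\<dagger>"
  and star_diff [simp]: "(S - T)\<^sup>\<dagger> = S\<^sup>\<dagger> - T\<^sup>\<dagger>"
  and star_minus [simp]: "(- T)\<^sup>\<dagger> = - (T\<^sup>\<dagger>)"
  and star_mult [simp]: "(S * T)\<^sup>\<dagger> = T\<^sup>\<dagger> * S\<^sup>\<dagger>"
  and star_scaleR [simp]: "(r *\<^sub>R T)\<^sup>\<dagger> = r *\<^sub>R (T\<^sup>\<dagger>)"
  and star_zero [simp]: "0\<^sup>\<dagger> = 0"
  and star_one [simp]: "1\<^sup>\<dagger> = 1"
  and star_cs [simp]: "(cs c)\<^sup>\<dagger> = cs (cnj c)"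
  by (rule star_unique, simp add: cinner_linear cinner_app_left)+

lemma cs_add: "cs (a + b) = cs a + cs b"
  and cs_diff: "cs (a - b) = cs a - cs b"
  and cs_minus: "cs (- a) = - cs a"
  and cs_mult: "cs (a * b) = cs a * cs b"
  and cs_one [simp]: "cs 1 = 1"
  and cs_zero [simp]: "cs 0 = 0"
  and cs_comm: "T * cs a = cs a * T"
  and cs_of_real: "cs (of_real r) = r *\<^sub>R 1"
  by (rule cop_eqI, simp add: cscale_add_left cscale_diff_left cscale_minus_left cscale_cscale
      cscale_one app_linear scaleR_cscale mult.commute)+

lemma norm_app_le: "norm (T \<cdot> x) \<le> norm T * norm x"
  by transfer (simp add: onorm bounded_op_bounded_linear)

lemma norm_cop_bound: "0 \<le> b \<Longrightarrow> (\<And>x. norm (T \<cdot> x) \<le> b * norm x) \<Longrightarrow> norm T \<le> b"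
  by transfer (rule onorm_bound)

lemma norm_one_cop_le: "norm (1::'a::chilbert_space cop) \<le> 1"
  by (rule norm_cop_bound) auto

lemma norm_cs_le: "norm (cs c) \<le> cmod c"
  by (rule norm_cop_bound) (auto simp: norm_cscale)

lemma norm_app_sq: "(norm (T \<cdot> x))\<^sup>2 = Re (cinner x ((T\<^sup>\<dagger> * T) \<cdot> x))"
  by (simp add: Re_cinner_self[symmetric] cinner_app_left)

text \<open>The C*-identity. One inequality is Cauchy-Schwarz applied to \<open>norm_app_sq\<close>;
  dividing it by \<open>norm T\<close> and exchanging \<open>T\<close> with its adjoint gives the
  rest.\<close>

lemma norm_star_mult: "norm (T\<^sup>\<dagger> * T) = (norm T)\<^sup>2"
  and norm_star [simp]: "norm (T\<^sup>\<dagger>) = norm T"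
proof -
  have ge: "(norm T)\<^sup>2 \<le> norm (T\<^sup>\<dagger> * T)" for T :: "'a cop"
  proof -
    have "norm T \<le> sqrt (norm (T\<^sup>\<dagger> * T))"
    proof (rule norm_cop_bound)
      fix x
      have "(norm (T \<cdot> x))\<^sup>2 \<le> norm x * norm ((T\<^sup>\<dagger> * T) \<cdot> x)"
        unfolding norm_app_sq by (rule Re_cinner_le)
      also have "\<dots> \<le> norm x * (norm (T\<^sup>\<dagger> * T) * norm x)"
        by (intro mult_left_mono norm_app_le) auto
      also have "\<dots> = (sqrt (norm (T\<^sup>\<dagger> * T)) * norm x)\<^sup>2"
        by (simp add: power_mult_distrib power2_eq_square)
      finally show "norm (T \<cdot> x) \<le> sqrt (norm (T\<^sup>\<dagger> * T)) * norm x"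
        by (rule power2_le_imp_le) simp
    qed simp
    then show ?thesis by (metis norm_ge_zero power_mono real_sqrt_pow2)
  qed
  have le: "norm T \<le> norm (T\<^sup>\<dagger>)" for T :: "'a cop"
  proof (cases "norm T = 0")
    case False
    have "norm T * norm T \<le> norm (T\<^sup>\<dagger>) * norm T"
      using ge[of T] norm_mult_ineq[of "T\<^sup>\<dagger>" T] by (simp add: power2_eq_square)
    then show ?thesis using False by auto
  qed simp
  show s: "norm (T\<^sup>\<dagger>) = norm T" using le[of T] le[of "T\<^sup>\<dagger>"] by simp
  show "norm (T\<^sup>\<dagger> * T) = (norm T)\<^sup>2"
    using ge[of T] norm_mult_ineq[of "T\<^sup>\<dagger>" T] by (simp add: s power2_eq_square)
qed

section \<open>Strong limits and completeness of the operator ring\<close>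

lemma strong_limit_exists:
  fixes X :: "nat \<Rightarrow> 'a::chilbert_space cop"
  assumes conv: "\<And>x. convergent (\<lambda>n. X n \<cdot> x)" and bd: "\<And>n. norm (X n) \<le> K"
  shows "\<exists>T. (\<forall>x. (\<lambda>n. X n \<cdot> x) \<longlonglongrightarrow> T \<cdot> x) \<and> norm T \<le> K"
proof -
  obtain v where v: "\<And>x. (\<lambda>n. X n \<cdot> x) \<longlonglongrightarrow> v x"
    using conv unfolding convergent_def by metis
  have K: "0 \<le> K" using bd[of 0] norm_ge_zero[of "X 0"] by linarith
  have vb: "norm (v x) \<le> K * norm x" for x
  proof (rule LIMSEQ_le_const2[OF tendsto_norm[OF v]])
    show "\<exists>N. \<forall>n\<ge>N. norm (X n \<cdot> x) \<le> K * norm x"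
      by (meson bd mult_right_mono norm_app_le norm_ge_zero order_trans)
  qed
  have b: "bounded_op v"
  proof (rule bounded_opI[OF _ _ vb])
    show "v (x + y) = v x + v y" for x y
      by (rule LIMSEQ_unique[OF v]) (simp add: app_linear, intro tendsto_intros v)
    show "v (cscale c x) = cscale c (v x)" for c x
      by (rule LIMSEQ_unique[OF v]) (simp add: app_linear, intro tendsto_intros v)
  qed
  show ?thesis
    by (rule exI[of _ "Cop v"]) (auto simp: app_Cop b v K vb intro!: norm_cop_bound)
qed

instance cop :: (chilbert_space) banach
proof
  fix X :: "nat \<Rightarrow> 'a cop"
  assume C: "Cauchy X"
  have diff: "norm (X m \<cdot> x - X n \<cdot> x) \<le> norm (X m - X n) * norm x" for m n x
    using norm_app_le[of "X m - X n" x] by simp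
  have conv: "convergent (\<lambda>n. X n \<cdot> x)" for x
  proof -
    have "Cauchy (\<lambda>n. X n \<cdot> x)"
    proof (rule CauchyI)
      fix e :: real assume e: "0 < e"
      then have "0 < e / (norm x + 1)" by (simp add: add_nonneg_pos)
      from CauchyD[OF C this] obtain M where
        M: "\<And>m n. m \<ge> M \<Longrightarrow> n \<ge> M \<Longrightarrow> norm (X m - X n) < e / (norm x + 1)" by auto
      have "norm (X m \<cdot> x - X n \<cdot> x) < e" if "m \<ge> M" "n \<ge> M" for m n
      proof -
        have "norm (X m - X n) * norm x \<le> e / (norm x + 1) * norm x"
          using M[OF that] by (intro mult_right_mono) auto
        also have "\<dots> < e"
          using e mult_strict_left_mono[of "norm x" "norm x + 1" e]
          by (simp add: pos_divide_less_eq add_nonneg_pos)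
        finally show ?thesis using diff[of m x n] by linarith
      qed
      then show "\<exists>M. \<forall>m\<ge>M. \<forall>n\<ge>M. norm (X m \<cdot> x - X n \<cdot> x) < e" by blast
    qed
    then show ?thesis by (rule Cauchy_convergent)
  qed
  obtain K where K: "\<And>n. norm (X n) \<le> K"
    using Cauchy_Bseq[OF C] by (auto simp: Bseq_def)
  obtain T where T: "\<And>x. (\<lambda>n. X n \<cdot> x) \<longlonglongrightarrow> T \<cdot> x"
    using strong_limit_exists[OF conv K] by blast
  have "X \<longlonglongrightarrow> T"
  proof (rule LIMSEQ_I)
    fix e :: real assume e: "0 < e"
    then have "0 < e / 2" by simp
    from CauchyD[OF C this] obtain M where
      M: "\<And>m n. m \<ge> M \<Longrightarrow> n \<ge> M \<Longrightarrow> norm (X m - X n) < e / 2" by auto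
    have "norm (X n - T) \<le> e / 2" if n: "n \<ge> M" for n
    proof (rule norm_cop_bound)
      fix x
      have "(\<lambda>m. norm (X n \<cdot> x - X m \<cdot> x)) \<longlonglongrightarrow> norm (X n \<cdot> x - T \<cdot> x)"
        by (intro tendsto_intros T)
      moreover have bnd: "norm (X n \<cdot> x - X m \<cdot> x) \<le> e / 2 * norm x" if "m \<ge> M" for m
        using diff[of n x m] mult_right_mono[of "norm (X n - X m)" "e / 2" "norm x"] M[OF n that]
        by simp
      ultimately show "norm ((X n - T) \<cdot> x) \<le> e / 2 * norm x"
        unfolding app_ops by (elim LIMSEQ_le_const2) (use bnd in blast)
    qed (use e in simp)
    then show "\<exists>no. \<forall>n\<ge>no. norm (X n - T) < e" using e by fastforce
  qed
  then show "convergent X" by (rule convergentI)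
qed

lemma strong_limit_unique:
  assumes "\<And>x. (\<lambda>n. X n \<cdot> x) \<longlonglongrightarrow> S \<cdot> x" "\<And>x. (\<lambda>n. X n \<cdot> x) \<longlonglongrightarrow> T \<cdot> x"
  shows "S = T"
  using LIMSEQ_unique[OF assms] by (rule cop_eqI)

section \<open>Positive operators\<close>

text \<open>Only the real part of the form is tested, hence the explicit self-adjointness.\<close>

definition pos :: "'a::chilbert_space cop \<Rightarrow> bool"
  where "pos T \<longleftrightarrow> T\<^sup>\<dagger> = T \<and> (\<forall>x. 0 \<le> Re (cinner x (T \<cdot> x)))"

lemma posD: "pos T \<Longrightarrow> T\<^sup>\<dagger> = T" "pos T \<Longrightarrow> 0 \<le> Re (cinner x (T \<cdot> x))"
  by (auto simp: pos_def)

lemma pos_star_mult: "pos (T\<^sup>\<dagger> * T)"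
  unfolding pos_def norm_app_sq[symmetric] by simp

lemma pos_mult_self: "T\<^sup>\<dagger> = T \<Longrightarrow> pos (T * T)"
  using pos_star_mult[of T] by simp

lemma pos_add: "pos S \<Longrightarrow> pos T \<Longrightarrow> pos (S + T)"
  by (simp add: pos_def cinner_linear)

lemma pos_scaleR: "0 \<le> r \<Longrightarrow> pos T \<Longrightarrow> pos (r *\<^sub>R T)"
  by (simp add: pos_def cinner_linear)

lemma pos_one: "pos 1"
  by (simp add: pos_def Re_cinner_self)

lemma Re_cinner_app_le: "Re (cinner x (T \<cdot> x)) \<le> norm T * (norm x)\<^sup>2"
proof -
  have "norm x * norm (T \<cdot> x) \<le> norm x * (norm T * norm x)"
    by (intro mult_left_mono norm_app_le) auto
  then show ?thesis
    using Re_cinner_le[of x "T \<cdot> x"] by (simp add: power2_eq_square algebra_simps)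
qed

text \<open>The operator inequality \<open>C\<^sup>2 \<le> c C\<close>, read off from the form of
  \<open>C\<close> at \<open>c x - C x\<close>. An argument through the square root of
  \<open>C\<close> would be circular, since that root is built from this estimate.\<close>

lemma pos_app_sq_le:
  assumes "pos C" "norm C \<le> c" "0 < c"
  shows "(norm (C \<cdot> x))\<^sup>2 \<le> c * Re (cinner x (C \<cdot> x))"
proof -
  define y where "y = C \<cdot> x"
  have sa: "cinner (C \<cdot> u) v = cinner u (C \<cdot> v)" for u v
    using cinner_app_left[of C u v] posD(1)[OF assms(1)] by simp
  have yy: "Re (cinner x (C \<cdot> y)) = (norm y)\<^sup>2"
    using sa[of x y] by (simp add: y_def[symmetric] Re_cinner_self[symmetric])
  have le: "Re (cinner y (C \<cdot> y)) \<le> c * (norm y)\<^sup>2"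
    using Re_cinner_app_le[of y C] mult_right_mono[OF assms(2), of "(norm y)\<^sup>2"] by simp
  have "0 \<le> Re (cinner (c *\<^sub>R x - y) (C \<cdot> (c *\<^sub>R x - y)))"
    using assms(1) by (rule posD)
  also have "\<dots> = c\<^sup>2 * Re (cinner x y) - 2 * c * (norm y)\<^sup>2 + Re (cinner y (C \<cdot> y))"
    using yy by (simp add: app_linear cinner_linear y_def[symmetric] Re_cinner_self power2_eq_square algebra_simps)
  finally have "0 \<le> c * (c * Re (cinner x y) - (norm y)\<^sup>2)"
    using le by (simp add: power2_eq_square algebra_simps)
  then show ?thesis
    using assms(3) by (simp add: zero_le_mult_iff y_def)
qed

text \<open>Used in two ways: with \<open>e = 0\<close> it makes \<open>1 - C / c\<close> a
  contraction, as the square root iteration requires; with \<open>e > 0\<close> the bound is below 1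
  and the Neumann series converges.\<close>

lemma norm_one_minus_le:
  assumes "pos C" and c: "norm C \<le> c" "0 < c" and e: "\<And>x. e * (norm x)\<^sup>2 \<le> Re (cinner x (C \<cdot> x))"
    and "e \<le> c"
  shows "norm (1 - (1 / c) *\<^sub>R C) \<le> sqrt (1 - e / c)"
proof (rule norm_cop_bound)
  fix x
  define q where "q = Re (cinner x (C \<cdot> x))"
  have "(norm ((1 - (1 / c) *\<^sub>R C) \<cdot> x))\<^sup>2 = (norm x)\<^sup>2 + (norm (C \<cdot> x))\<^sup>2 / c\<^sup>2 - 2 * q / c"
    using c by (simp add: norm_diff_sq cinner_linear power_mult_distrib power_divide q_def)
  also have "\<dots> \<le> (norm x)\<^sup>2 + c * q / c\<^sup>2 - 2 * q / c"
    using pos_app_sq_le[OF assms(1) c, of x] by (simp add: divide_right_mono q_def)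
  also have "\<dots> = (norm x)\<^sup>2 - q / c"
    using c by (simp add: power2_eq_square field_simps)
  also have "\<dots> \<le> (norm x)\<^sup>2 - e * (norm x)\<^sup>2 / c"
    using e[of x] c by (simp add: divide_right_mono q_def)
  also have "\<dots> = (sqrt (1 - e / c) * norm x)\<^sup>2"
    using assms(5) c by (simp add: power_mult_distrib algebra_simps)
  finally show "norm ((1 - (1 / c) *\<^sub>R C) \<cdot> x) \<le> sqrt (1 - e / c) * norm x"
    by (rule power2_le_imp_le) (use assms(5) c in simp)
qed (use assms(5) c in simp)

lemma bounded_linear_star: "bounded_linear (star :: 'a::chilbert_space cop \<Rightarrow> _)"
  by (rule bounded_linear_intro[where K = 1]) auto

lemmas tendsto_star = bounded_linear.tendsto[OF bounded_linear_star]

text \<open>For \<open>A = 1 - C / c\<close> the iteration \<open>X \<mapsto> (A + X * X) / 2\<close> converges to \<open>1 - sqrt (C / c)\<close>; its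
  increments are dominated by those of the scalar iteration with \<open>A = 1\<close>.\<close>
lemma pos_sqrt_exists:
  assumes "pos C"
  shows "\<exists>R. R\<^sup>\<dagger> = R \<and> R * R = C \<and> (\<forall>S. S * C = C * S \<longrightarrow> S * R = R * S)"
proof -
  \<comment> \<open>The added 1 keeps \<open>c\<close> positive when \<open>C = 0\<close>.\<close>
  define c where "c = norm C + 1"
  have c: "0 < c" "norm C \<le> c" by (simp_all add: c_def add_nonneg_pos)
  define A where "A = 1 - (1 / c) *\<^sub>R C"
  have A1: "norm A \<le> 1"
    using norm_one_minus_le[OF assms c(2,1), of 0] posD(2)[OF assms] c by (simp add: A_def)
  have Asa: "A\<^sup>\<dagger> = A" by (simp add: A_def posD(1)[OF assms])
  define X where "X = rec_nat 0 (\<lambda>n X. (1/2) *\<^sub>R (A + X * X))"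
  have X: "X 0 = 0" "X (Suc n) = (1/2) *\<^sub>R (A + X n * X n)" for n by (simp_all add: X_def)
  define a where "a = rec_nat (0::real) (\<lambda>n x. (1 + x * x) / 2)"
  have a: "a 0 = 0" "a (Suc n) = (1 + a n * a n) / 2" for n by (simp_all add: a_def)
  have comm: "S * X n = X n * S" if "S * A = A * S" for S n
  proof (induction n)
    case (Suc n)
    have "S * (X n * X n) = X n * X n * S" by (metis Suc mult.assoc)
    then show ?case using that by (simp add: X algebra_simps)
  qed (simp add: X)
  have Xc: "X m * X n = X n * X m" for m n using comm[of "X m" n] comm[of A m] by simp
  have Xsa: "(X n)\<^sup>\<dagger> = X n" for n by (induction n) (simp_all add: X Asa)
  have a01: "0 \<le> a n" "a n \<le> 1" for n
  proof (induction n)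
    case (Suc n)
    { case 1 show ?case by (simp add: a) }
    { case 2 show ?case using Suc mult_mono[of "a n" 1 "a n" 1] by (simp add: a) }
  qed (simp_all add: a)
  have Xa: "norm (X n) \<le> a n" for n
  proof (induction n)
    case (Suc n)
    have "norm (X n * X n) \<le> a n * a n"
      using norm_mult_ineq[of "X n" "X n"] mult_mono[OF Suc Suc] a01 by fastforce
    then show ?case
      using norm_triangle_ineq[of A "X n * X n"] A1 by (simp add: X a)
  qed (simp add: X a)
  have step: "norm (X (Suc n) - X n) \<le> a (Suc n) - a n" for n
  proof (induction n)
    case 0 then show ?case using A1 by (simp add: X a)
  next
    case (Suc n)
    have mono: "a n \<le> a (Suc n)" using Suc norm_ge_zero[of "X (Suc n) - X n"] by linarith
    \<comment> \<open>Since the iterates commute, the difference of squares factors, and each factor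
      is dominated by its counterpart in the scalar iteration.\<close>
    have "X (Suc (Suc n)) - X (Suc n) = (1/2) *\<^sub>R (X (Suc n) * X (Suc n) - X n * X n)"
      unfolding X(2)[of "Suc n"] X(2)[of n] by (simp add: algebra_simps)
    also have "X (Suc n) * X (Suc n) - X n * X n = (X (Suc n) - X n) * (X (Suc n) + X n)"
      using Xc[of n "Suc n"] by (simp add: algebra_simps)
    finally have "norm (X (Suc (Suc n)) - X (Suc n))
        \<le> (norm (X (Suc n) - X n) * norm (X (Suc n) + X n)) / 2"
      using norm_mult_ineq[of "X (Suc n) - X n" "X (Suc n) + X n"] by simp
    also have "\<dots> \<le> ((a (Suc n) - a n) * (a (Suc n) + a n)) / 2"
      using Suc norm_triangle_le[of "X (Suc n)" "X n" "a (Suc n) + a n"] Xa[of n] Xa[of "Suc n"]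
      by (intro divide_right_mono mult_mono) (use mono in auto)
    also have "\<dots> = (1 + a (Suc n) * a (Suc n)) / 2 - (1 + a n * a n) / 2"
      by (simp add: field_simps)
    also have "\<dots> = a (Suc (Suc n)) - a (Suc n)"
      by (simp only: a(2)[symmetric])
    finally show ?case .
  qed
  have dist: "norm (X (n + k) - X n) \<le> a (n + k) - a n" for n k
  proof (induction k)
    case (Suc k)
    then show ?case
      using norm_triangle_ineq[of "X (Suc (n + k)) - X (n + k)" "X (n + k) - X n"] step[of "n + k"]
      by simp
  qed simp
  have "a n \<le> a (Suc n)" for n
    using order_trans[OF norm_ge_zero step[of n]] by simp
  then have "incseq a" by (rule incseq_SucI)
  then have "Cauchy a"
    using incseq_convergent[of a 1] a01 by (metis convergent_def LIMSEQ_imp_Cauchy)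
  have "Cauchy X"
  proof (rule CauchyI')
    fix e :: real assume "0 < e"
    then obtain M where M: "\<And>m n. m \<ge> M \<Longrightarrow> n \<ge> M \<Longrightarrow> norm (a m - a n) < e"
      using CauchyD[OF \<open>Cauchy a\<close>] by blast
    show "\<exists>M. \<forall>m\<ge>M. \<forall>n>m. dist (X m) (X n) < e"
    proof (intro exI[of _ M] allI impI)
      fix m n assume "M \<le> m" "m < n"
      then show "dist (X m) (X n) < e"
        using dist[of m "n - m"] M[of n m] by (simp add: dist_norm norm_minus_commute)
    qed
  qed
  then obtain L where L: "X \<longlonglongrightarrow> L" using Cauchy_convergent_iff convergent_def by blast
  have "(\<lambda>n. X (Suc n)) \<longlonglongrightarrow> (1/2) *\<^sub>R (A + L * L)" unfolding X by (intro tendsto_intros L)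
  then have LL: "L = (1/2) *\<^sub>R (A + L * L)" using LIMSEQ_Suc[OF L] LIMSEQ_unique by blast
  \<comment> \<open>This is the fixed point equation in the form
    \<open>(1 - L) * (1 - L) = 1 - A\<close>, whose right side is \<open>C / c\<close>.\<close>
  have L2: "L + L = A + L * L"
    by (subst (1 2) LL) (simp add: scaleR_add_left[symmetric])
  have Lsa: "L\<^sup>\<dagger> = L" using tendsto_star[OF L] L LIMSEQ_unique by (auto simp: Xsa)
  have Lc: "S * L = L * S" if "S * A = A * S" for S
  proof -
    have "(\<lambda>n. S * X n) \<longlonglongrightarrow> S * L" "(\<lambda>n. X n * S) \<longlonglongrightarrow> L * S"
      by (intro tendsto_intros L)+
    then show ?thesis unfolding comm[OF that] by (rule LIMSEQ_unique)
  qed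
  show ?thesis
  proof (intro exI[of _ "sqrt c *\<^sub>R (1 - L)"] conjI allI impI)
    have "(1 - L) * (1 - L) = 1 - (L + L) + L * L" by (simp add: algebra_simps)
    also have "\<dots> = (1 / c) *\<^sub>R C" unfolding L2 A_def by simp
    finally show "sqrt c *\<^sub>R (1 - L) * sqrt c *\<^sub>R (1 - L) = C" using c by simp
    show "(sqrt c *\<^sub>R (1 - L))\<^sup>\<dagger> = sqrt c *\<^sub>R (1 - L)" by (simp add: Lsa)
    fix S assume "S * C = C * S"
    then have "S * L = L * S" by (intro Lc) (simp add: A_def algebra_simps)
    then show "S * sqrt c *\<^sub>R (1 - L) = sqrt c *\<^sub>R (1 - L) * S" by (simp add: algebra_simps)
  qed
qed

lemma pos_conj: "pos T \<Longrightarrow> pos (S\<^sup>\<dagger> * T * S)"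
  by (simp add: pos_def mult.assoc cinner_app_left[symmetric] flip: cinner_app_left)

text \<open>The square root \<open>R\<close> of \<open>B\<close> commutes with \<open>A\<close>, so
  the product equals \<open>R * A * R\<close>, whose form at \<open>x\<close> is that of
  \<open>A\<close> at \<open>R x\<close>.\<close>

lemma pos_mult:
  assumes "pos A" "pos B" "A * B = B * A"
  shows "pos (A * B)"
proof -
  obtain R where R: "R\<^sup>\<dagger> = R" "R * R = B" "A * R = R * A"
    using pos_sqrt_exists[OF assms(2)] assms(3) by blast
  have "A * B = R\<^sup>\<dagger> * A * R" by (metis R mult.assoc)
  then show ?thesis using pos_conj[OF assms(1)] by simp
qed

text \<open>Neumann series in \<open>1 - E / c\<close>, whose norm is at most
  \<open>sqrt (1 - e / c)\<close>. Whatever commutes with \<open>E\<close> commutes with its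
  two-sided inverse.\<close>

lemma pos_bounded_below_inverse:
  fixes E :: "'a::chilbert_space cop"
  assumes "pos E" and e: "0 < e" "\<And>x. e * (norm x)\<^sup>2 \<le> Re (cinner x (E \<cdot> x))"
  shows "\<exists>F. F * E = 1 \<and> E * F = 1 \<and> pos F \<and> (\<forall>S. S * E = E * S \<longrightarrow> S * F = F * S)"
proof -
  define c where "c = norm E + e"
  have c: "0 < c" "norm E \<le> c" "e \<le> c" using e by (simp_all add: c_def add_nonneg_pos)
  define A where "A = 1 - (1 / c) *\<^sub>R E"
  define r where "r = sqrt (1 - e / c)"
  have r: "0 \<le> r" "r < 1" using e c by (simp_all add: r_def)
  have A: "norm A \<le> r"
    unfolding A_def r_def by (rule norm_one_minus_le[OF assms(1) c(2,1) e(2) c(3)])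
  have An: "norm (A ^ n) \<le> r ^ n" for n
  proof (induction n)
    case (Suc n)
    then show ?case using norm_mult_ineq[of A "A ^ n"] mult_mono[OF A Suc] r by simp
  qed (simp add: norm_one_cop_le)
  have sm: "summable (\<lambda>n. A ^ n)"
    by (rule summable_comparison_test'[OF summable_geometric[of r]]) (use r An in auto)
  define G where "G = (\<Sum>n. A ^ n)"
  have head: "(\<Sum>n. A ^ Suc n) = G - 1" unfolding G_def using suminf_split_head[OF sm] by simp
  have AG: "A * G = G - 1" using suminf_mult[OF sm, of A] head by (simp add: G_def)
  have GA: "G * A = G - 1"
    using suminf_mult2[OF sm, of A] head by (simp add: G_def power_commutes)
  have EA: "E = c *\<^sub>R (1 - A)" using c by (simp add: A_def)
  define F where "F = (1 / c) *\<^sub>R G"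
  have EF: "E * F = 1" and FE: "F * E = 1"
    using AG GA c by (simp_all add: EA F_def algebra_simps)
  have Fsa: "F\<^sup>\<dagger> = F"
  proof -
    have "F\<^sup>\<dagger> * E = 1" using arg_cong[OF EF, of star] posD(1)[OF assms(1)] by simp
    then show ?thesis by (metis EF mult.assoc mult_1_left mult_1_right)
  qed
  have "0 \<le> Re (cinner x (F \<cdot> x))" for x
  proof -
    have "E \<cdot> F \<cdot> x = x" using EF by (metis app_ops(5,6))
    moreover have "cinner x (F \<cdot> x) = cinner (F \<cdot> x) x" by (simp add: cinner_app_left Fsa)
    ultimately show ?thesis using posD(2)[OF assms(1), of "F \<cdot> x"] by simp
  qed
  then have "pos F" using Fsa by (simp add: pos_def)
  moreover have "S * F = F * S" if "S * E = E * S" for S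
    by (metis EF FE mult.assoc mult_1_left mult_1_right that)
  ultimately show ?thesis using EF FE by blast
qed

section \<open>Fuglede's theorem\<close>

lemma power_mult_commuting:
  fixes x y :: "'a::monoid_mult"
  assumes "x * y = y * x"
  shows "(x * y) ^ n = x ^ n * y ^ n"
proof (induction n)
  case (Suc n)
  have "y * x ^ n = x ^ n * y" using power_commuting_commutes[of x y n] assms by simp
  then have "x * (y * (x ^ n * y ^ n)) = x * (x ^ n * (y * y ^ n))" by (metis mult.assoc)
  then show ?case by (simp add: Suc mult.assoc)
qed simp

lemma norm_cop_power: "norm (T ^ n :: 'a::chilbert_space cop) \<le> norm T ^ n"
proof (induction n)
  case (Suc n)
  then show ?case using norm_mult_ineq[of T "T ^ n"] mult_left_mono[OF Suc norm_ge_zero[of T]] by simp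
qed (simp add: norm_one_cop_le)

text \<open>All terms of the binomial expansion beyond the constant one are dominated by their
  scalar counterparts; the induction avoids writing the expansion.\<close>

lemma norm_power_minus_one_le:
  fixes x :: "'a::chilbert_space cop"
  assumes "norm x \<le> r"
  shows "norm ((1 + x) ^ n - 1) \<le> (1 + r) ^ n - 1"
proof (induction n)
  case (Suc n)
  have "0 \<le> r" using assms norm_ge_zero order_trans by blast
  have "norm (1 + x) \<le> 1 + r"
    using norm_triangle_ineq[of 1 x] norm_one_cop_le[where 'a = 'a] assms by simp
  then have "norm ((1 + x) * ((1 + x) ^ n - 1)) \<le> (1 + r) * ((1 + r) ^ n - 1)"
    using norm_mult_ineq[of "1 + x" "(1 + x) ^ n - 1"] Suc \<open>0 \<le> r\<close>
      mult_mono[of "norm (1 + x)" "1 + r" "norm ((1 + x) ^ n - 1)" "(1 + r) ^ n - 1"] by simp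
  moreover have "(1 + x) ^ Suc n - 1 = (1 + x) * ((1 + x) ^ n - 1) + x"
    by (simp add: algebra_simps)
  ultimately show ?case
    using norm_triangle_ineq[of "(1 + x) * ((1 + x) ^ n - 1)" x] assms by (simp add: algebra_simps)
qed simp

lemma cs_left_comm: "T * (cs c * S) = cs c * (T * S)"
  by (simp add: cs_comm flip: mult.assoc)

lemma cs_mult_cs: "(cs a * S) * (cs b * T) = cs (a * b) * (S * T)"
  by (rule cop_eqI) (simp add: app_linear cscale_cscale mult.commute)

lemma bounded_linear_cs: "bounded_linear (cs :: complex \<Rightarrow> 'a::chilbert_space cop)"
proof (rule bounded_linear_intro[where K = 1])
  show "cs (r *\<^sub>R z) = r *\<^sub>R (cs z :: 'a cop)" for r z
    by (rule cop_eqI) (simp add: scaleR_cscale cscale_cscale scaleR_conv_of_real)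
qed (auto simp: cs_add norm_cs_le)

text \<open>Complex differentiability in a real algebra: the derivative has the complex-linear form
  \<open>cs h * D l\<close>. For \<open>T = (1 / n) N\<^sup>\<dagger>\<close> the value
  \<open>D 0\<close> is \<open>N\<^sup>\<dagger>\<close>, as it would be for the
  exponential.\<close>

lemma has_derivative_one_plus_cs_power:
  "\<exists>D. (\<forall>l. ((\<lambda>l. (1 + cs l * T) ^ n) has_derivative (\<lambda>h. cs h * D l)) (at l))
     \<and> D 0 = real n *\<^sub>R (T :: 'a::chilbert_space cop)"
proof (induction n)
  case 0
  then show ?case by (intro exI[of _ "\<lambda>_. 0"]) auto
next
  case (Suc n)
  then obtain D where D: "\<And>l. ((\<lambda>l. (1 + cs l * T) ^ n) has_derivative (\<lambda>h. cs h * D l)) (at l)"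
    and D0: "D 0 = real n *\<^sub>R T" by blast
  have lin: "((\<lambda>l. 1 + cs l * T) has_derivative (\<lambda>h. cs h * T)) (at l)" for l
    by (rule derivative_eq_intros bounded_linear_imp_has_derivative[OF bounded_linear_cs] refl)+ simp
  show ?case
  proof (intro exI[of _ "\<lambda>l. (1 + cs l * T) * D l + T * (1 + cs l * T) ^ n"] conjI allI)
    fix l
    have "((\<lambda>l. (1 + cs l * T) * (1 + cs l * T) ^ n) has_derivative
        (\<lambda>h. (1 + cs l * T) * (cs h * D l) + cs h * T * (1 + cs l * T) ^ n)) (at l)"
      by (rule has_derivative_mult[OF lin D])
    moreover have "(1 + cs l * T) * (cs h * D l) = cs h * ((1 + cs l * T) * D l)" for h
      by (rule cs_left_comm)
    ultimately show "((\<lambda>l. (1 + cs l * T) ^ Suc n) has_derivative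
        (\<lambda>h. cs h * ((1 + cs l * T) * D l + T * (1 + cs l * T) ^ n))) (at l)"
      by (simp add: mult.assoc distrib_left)
  qed (simp add: D0 scaleR_add_left)
qed

text \<open>Rosenblum's proof with \<open>(1 + a)\<^sup>n\<close> for \<open>exp (l N\<^sup>\<dagger>)\<close>, where \<open>a = (l / n) N\<^sup>\<dagger>\<close>: in
  the product \<open>(1 + a) (1 - a\<^sup>\<dagger>)\<close> the terms of first order are skew-adjoint, so that its norm is
  at most \<open>1 + (norm a)\<^sup>2\<close>.\<close>
lemma Fuglede_bound:
  fixes N M :: "'a::chilbert_space cop"
  assumes normal: "N * N\<^sup>\<dagger> = N\<^sup>\<dagger> * N" and comm: "M * N = N * M"
    and small: "exp ((cmod l * norm N)\<^sup>2 / real n) \<le> 3 / 2" and n: "n > 0"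
  shows "norm ((1 + cs l * ((1 / real n) *\<^sub>R N\<^sup>\<dagger>)) ^ n * M * (1 + cs l * (- ((1 / real n) *\<^sub>R N\<^sup>\<dagger>))) ^ n)
    \<le> 5 * norm M"
proof -
  define a where "a = cs l * ((1 / real n) *\<^sub>R N\<^sup>\<dagger>)"
  define b where "b = a\<^sup>\<dagger>"
  have b: "b = cs (cnj l) * ((1 / real n) *\<^sub>R N)" by (simp add: a_def b_def cs_comm)
  have ab: "a * b = b * a"
  proof -
    show ?thesis unfolding a_def b cs_mult_cs by (simp add: normal mult.commute)
  qed
  have bM: "b * M = M * b"
    unfolding b cs_left_comm by (simp add: comm mult.assoc)
  define \<alpha> where "\<alpha> = (norm a)\<^sup>2"
  have "norm (cs l * ((1 / real n) *\<^sub>R N\<^sup>\<dagger>)) \<le> cmod l * (norm N / real n)"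
    using norm_mult_ineq[of "cs l" "(1 / real n) *\<^sub>R N\<^sup>\<dagger>"] mult_right_mono[OF norm_cs_le[where 'a = 'a, of l], of "norm N / real n"]
    by simp
  then have "\<alpha> \<le> (cmod l * (norm N / real n))\<^sup>2"
    unfolding \<alpha>_def a_def[symmetric] by (rule power_mono) simp
  then have "real n * \<alpha> \<le> real n * (cmod l * (norm N / real n))\<^sup>2" by (rule mult_left_mono) simp
  then have n\<alpha>: "real n * \<alpha> \<le> (cmod l * norm N)\<^sup>2 / real n"
    using n by (simp add: power2_eq_square)
  have \<alpha>0: "0 \<le> \<alpha>" by (simp add: \<alpha>_def)
  \<comment> \<open>As \<open>norm a\<close> is of order \<open>1 / n\<close>, the second-order
    errors accumulated over \<open>n\<close> factors are still only of order
    \<open>1 / n\<close>.\<close>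
  have "(1 + \<alpha>) ^ n \<le> exp \<alpha> ^ n" using \<alpha>0 by (intro power_mono) auto
  also have "\<dots> = exp (real n * \<alpha>)" by (simp add: exp_of_nat_mult)
  also have "\<dots> \<le> exp ((cmod l * norm N)\<^sup>2 / real n)" using n\<alpha> by simp
  finally have E: "(1 + \<alpha>) ^ n \<le> 3 / 2" using small by linarith
  define V where "V = (1 + a) * (1 - b)"
  have Vs: "V\<^sup>\<dagger> = (1 - a) * (1 + b)" by (simp add: V_def b_def)
  have sq: "norm (1 - x * x) \<le> 1 + \<alpha>" if "norm x = norm a" for x :: "'a cop"
    using norm_triangle_ineq4[of 1 "x * x"] norm_one_cop_le[where 'a = 'a] norm_mult_ineq[of x x] that
    by (simp add: \<alpha>_def power2_eq_square)
  have c1: "(1 + b) * (1 + a) = (1 + a) * (1 + b)" using ab by (simp add: algebra_simps)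
  have "V\<^sup>\<dagger> * V = (1 - a) * ((1 + b) * (1 + a)) * (1 - b)"
    unfolding Vs by (simp add: V_def mult.assoc)
  also have "\<dots> = (1 - a * a) * (1 - b * b)" unfolding c1 by (simp add: algebra_simps)
  finally have "(norm V)\<^sup>2 \<le> norm (1 - a * a) * norm (1 - b * b)"
    using norm_mult_ineq[of "1 - a * a" "1 - b * b"] norm_star_mult[of V] by simp
  also have "\<dots> \<le> (1 + \<alpha>) * (1 + \<alpha>)"
    by (intro mult_mono sq) (use \<alpha>0 in \<open>simp_all add: b_def\<close>)
  finally have "(norm V)\<^sup>2 \<le> (1 + \<alpha>)\<^sup>2" by (simp only: power2_eq_square)
  then have "norm V \<le> 1 + \<alpha>"
    by (rule power2_le_imp_le) (use \<alpha>0 in simp)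
  then have Vn: "norm V ^ n \<le> 3 / 2" using E power_mono[of "norm V" "1 + \<alpha>" n] by simp
  define G where "G = (1 + a) ^ n * M * (1 - a) ^ n"
  \<comment> \<open>With exponentials the two factors inserted on the right of \<open>G\<close>
    would cancel; here their product \<open>(1 - b) ^ n * (1 + b) ^ n = W\<close> is only close to
    1. The factor \<open>(1 - b) ^ n\<close> is moved to the left across \<open>M\<close>, with
    which \<open>b\<close> commutes, to complete \<open>V ^ n\<close>.\<close>
  define W where "W = (1 + (- (b * b))) ^ n"
  have GW: "G * W = V ^ n * M * (V\<^sup>\<dagger>) ^ n"
  proof -
    have v: "V ^ n = (1 + a) ^ n * (1 - b) ^ n"
      unfolding V_def by (rule power_mult_commuting) (use ab in \<open>simp add: algebra_simps\<close>)
    have vs: "(V\<^sup>\<dagger>) ^ n = (1 - a) ^ n * (1 + b) ^ n"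
      unfolding Vs by (rule power_mult_commuting) (use ab in \<open>simp add: algebra_simps\<close>)
    have w: "W = (1 - b) ^ n * (1 + b) ^ n"
      unfolding W_def by (subst power_mult_commuting[symmetric]) (simp_all add: algebra_simps)
    have 1: "(1 - b) ^ n * M = M * (1 - b) ^ n"
      by (rule power_commuting_commutes) (use bM in \<open>simp add: algebra_simps\<close>)
    have 2: "(1 - b) ^ n * (1 - a) ^ n = (1 - a) ^ n * (1 - b) ^ n"
    proof -
      have "(1 - b) * (1 - a) = (1 - a) * (1 - b)" using ab by (simp add: algebra_simps)
      from power_commuting_commutes[OF power_commuting_commutes[OF this, symmetric], of n n]
      show ?thesis by simp
    qed
    have "V ^ n * M * (V\<^sup>\<dagger>) ^ n = (1 + a) ^ n * ((1 - b) ^ n * M) * ((1 - a) ^ n * (1 + b) ^ n)"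
      by (simp add: v vs mult.assoc)
    also have "\<dots> = (1 + a) ^ n * M * ((1 - b) ^ n * (1 - a) ^ n) * (1 + b) ^ n"
      unfolding 1 by (simp add: mult.assoc)
    also have "\<dots> = G * W" unfolding 2 by (simp add: G_def w mult.assoc)
    finally show ?thesis by simp
  qed
  have "norm (G * W) \<le> norm V ^ n * norm M * norm V ^ n"
    unfolding GW using norm_cop_power[of V n] norm_cop_power[of "V\<^sup>\<dagger>" n]
    by (intro order_trans[OF norm_mult_ineq] mult_mono) auto
  also have "\<dots> \<le> 3 / 2 * norm M * (3 / 2)"
    by (intro mult_mono Vn) auto
  finally have g1: "norm (G * W) \<le> 9 / 4 * norm M" by simp
  have "norm (W - 1) \<le> (1 + \<alpha>) ^ n - 1"
    unfolding W_def by (rule norm_power_minus_one_le)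
      (use norm_mult_ineq[of b b] in \<open>simp add: b_def \<alpha>_def power2_eq_square\<close>)
  then have "norm (W - 1) \<le> 1 / 2" using E by linarith
  then have "norm (G * (W - 1)) \<le> norm G * (1 / 2)"
    using norm_mult_ineq[of G "W - 1"] mult_left_mono[of "norm (W - 1)" "1 / 2" "norm G"] by simp
  moreover have "G = G * W - G * (W - 1)" by (simp add: algebra_simps)
  ultimately have "norm G \<le> 9 / 4 * norm M + norm G * (1 / 2)"
    using norm_triangle_ineq4[of "G * W" "G * (W - 1)"] g1 by simp
  \<comment> \<open>Absorbing half of \<open>norm G\<close> doubles
    \<open>9 / 4 = (3 / 2)\<^sup>2\<close> to \<open>9 / 2\<close>, which is rounded up to
    5.\<close>
  then have "norm G \<le> 5 * norm M" using norm_ge_zero[of M] by linarith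
  moreover have "1 + cs l * (- ((1 / real n) *\<^sub>R N\<^sup>\<dagger>)) = 1 - a" by (simp add: a_def)
  ultimately show ?thesis unfolding G_def a_def[symmetric] by simp
qed

text \<open>The function \<open>f\<close> of the proof has as derivative at 0 a matrix element of
  the commutator. Its exponent \<open>n\<close> depends on the radius \<open>r\<close>, so there is
  no single entire function to which Liouville's theorem applies; Cauchy's inequality on the circle
  of radius \<open>r\<close>, with the bound \<open>B\<close> independent of \<open>r\<close>,
  replaces it.\<close>

theorem Fuglede:
  fixes N M :: "'a::chilbert_space cop"
  assumes normal: "N * N\<^sup>\<dagger> = N\<^sup>\<dagger> * N" and comm: "M * N = N * M"
  shows "M * N\<^sup>\<dagger> = N\<^sup>\<dagger> * M"
proof -
  have "cinner y ((N\<^sup>\<dagger> * M - M * N\<^sup>\<dagger>) \<cdot> x) = 0" for x y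
  proof -
    define B where "B = norm y * (5 * norm M * norm x)"
    have bound: "cmod (cinner y ((N\<^sup>\<dagger> * M - M * N\<^sup>\<dagger>) \<cdot> x)) \<le> B / r" if r: "0 < r" for r
    proof -
      have "(\<lambda>n. exp ((r * norm N)\<^sup>2 / real n)) \<longlonglongrightarrow> exp 0"
        by (intro tendsto_intros lim_const_over_n)
      then have "eventually (\<lambda>n. exp ((r * norm N)\<^sup>2 / real n) < 3 / 2) sequentially"
        by (rule order_tendstoD) simp
      then have "eventually (\<lambda>n. exp ((r * norm N)\<^sup>2 / real n) < 3 / 2 \<and> n > 0) sequentially"
        using eventually_gt_at_top[of 0] by eventually_elim auto
      then obtain n where n: "exp ((r * norm N)\<^sup>2 / real n) < 3 / 2" "n > 0"
        unfolding eventually_sequentially by blast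
      define S where "S = (1 / real n) *\<^sub>R N\<^sup>\<dagger>"
      obtain D where D: "\<And>l. ((\<lambda>l. (1 + cs l * S) ^ n) has_derivative (\<lambda>h. cs h * D l)) (at l)"
        and D0: "D 0 = N\<^sup>\<dagger>"
        using has_derivative_one_plus_cs_power[of S n] n by (auto simp: S_def)
      obtain D' where D': "\<And>l. ((\<lambda>l. (1 + cs l * (- S)) ^ n) has_derivative (\<lambda>h. cs h * D' l)) (at l)"
        and D'0: "D' 0 = - N\<^sup>\<dagger>"
        using has_derivative_one_plus_cs_power[of "- S" n] n by (auto simp: S_def)
      define G where "G l = (1 + cs l * S) ^ n * M * (1 + cs l * (- S)) ^ n" for l
      define E where "E l = (1 + cs l * S) ^ n * M * D' l + D l * M * (1 + cs l * (- S)) ^ n" for l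
      define f where "f l = cinner y (G l \<cdot> x)" for l
      have "(G has_derivative (\<lambda>h. cs h * E l)) (at l)" for l
      proof -
        have "((\<lambda>l. (1 + cs l * S) ^ n * M) has_derivative (\<lambda>h. cs h * D l * M)) (at l)"
          by (rule has_derivative_mult_left[OF D])
        from has_derivative_mult[OF this D']
        have "(G has_derivative (\<lambda>h. (1 + cs l * S) ^ n * M * (cs h * D' l)
            + cs h * D l * M * (1 + cs l * (- S)) ^ n)) (at l)"
          unfolding G_def .
        moreover have "(1 + cs l * S) ^ n * M * (cs h * D' l) = cs h * ((1 + cs l * S) ^ n * M * D' l)" for h
          by (rule cs_left_comm)
        ultimately show ?thesis by (simp add: E_def mult.assoc distrib_left)
      qed
      moreover have "bounded_linear (\<lambda>T. cinner y (T \<cdot> x))"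
      proof (rule bounded_linear_intro[where K = "norm y * norm x"])
        show "norm (cinner y (T \<cdot> x)) \<le> norm T * (norm y * norm x)" for T :: "'a cop"
          using Cauchy_Schwarz[of y "T \<cdot> x"] mult_left_mono[OF norm_app_le[of T x], of "norm y"]
          by (simp add: algebra_simps)
      qed (simp_all add: cinner_linear scaleR_conv_of_real)
      ultimately have "(f has_derivative (\<lambda>h. cinner y ((cs h * E l) \<cdot> x))) (at l)" for l
        unfolding f_def using bounded_linear.has_derivative by blast
      then have der: "(f has_field_derivative cinner y (E l \<cdot> x)) (at l)" for l
        unfolding has_field_derivative_def
        by (rule has_derivative_eq_rhs) (simp add: fun_eq_iff cinner_linear mult.commute)
      then have hol: "f holomorphic_on A" for A
        by (meson holomorphic_on_open[of UNIV] holomorphic_on_subset open_UNIV subset_UNIV)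
      have le: "cmod (f l) \<le> B" if "cmod (0 - l) = r" for l
      proof -
        have "norm (G l) \<le> 5 * norm M"
          unfolding G_def S_def by (rule Fuglede_bound[OF normal comm]) (use n that in auto)
        then have "norm (G l \<cdot> x) \<le> 5 * norm M * norm x"
          using norm_app_le[of "G l" x] mult_right_mono[of "norm (G l)" "5 * norm M" "norm x"] by simp
        then show ?thesis
          unfolding f_def B_def using Cauchy_Schwarz[of y "G l \<cdot> x"]
          by (meson mult_left_mono norm_ge_zero order_trans)
      qed
      have "cmod ((deriv ^^ 1) f 0) \<le> fact 1 * B / r ^ 1"
        by (rule Cauchy_inequality[OF hol holomorphic_on_imp_continuous_on[OF hol] r le])
      moreover have "deriv f 0 = cinner y (E 0 \<cdot> x)" by (rule DERIV_imp_deriv[OF der])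
      ultimately show ?thesis by (simp add: E_def D0 D'0 cinner_linear)
    qed
    have "cmod (cinner y ((N\<^sup>\<dagger> * M - M * N\<^sup>\<dagger>) \<cdot> x)) \<le> 0"
    proof (rule tendsto_lowerbound[where F = at_top and f = "\<lambda>r. B / r"])
      show "((\<lambda>r. B / r) \<longlongrightarrow> 0) at_top"        by (rule tendsto_divide_0[OF tendsto_const filterlim_at_top_imp_at_infinity[OF filterlim_ident]])
      show "\<forall>\<^sub>F r in at_top. cmod (cinner y ((N\<^sup>\<dagger> * M - M * N\<^sup>\<dagger>) \<cdot> x)) \<le> B / r"
        using eventually_gt_at_top[of "0::real"] by eventually_elim (rule bound)
    qed simp
    then show ?thesis by simp
  qed
  then have "(N\<^sup>\<dagger> * M - M * N\<^sup>\<dagger>) \<cdot> x = 0 \<cdot> x" for x by (intro cinner_ext) simp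
  then have "N\<^sup>\<dagger> * M - M * N\<^sup>\<dagger> = 0" by (rule cop_eqI)
  then show ?thesis by simp
qed

section \<open>Joint approximate eigenvalues\<close>

text \<open>For positive \<open>C\<close> this says that \<open>C\<close> is not bounded below, that
  is, that 0 is in its spectrum. For a sum of operators \<open>T\<^sup>\<dagger> * T\<close> it
  expresses the existence of common approximate null vectors. On the zero space nothing is
  singular.\<close>

definition sing :: "'a::chilbert_space cop \<Rightarrow> bool"
  where "sing C \<longleftrightarrow> (\<forall>e>0. \<exists>x. norm x = 1 \<and> Re (cinner x (C \<cdot> x)) < e)"

lemma quadratic_form_ge:
  assumes "\<And>x. norm x = 1 \<Longrightarrow> c \<le> Re (cinner x (T \<cdot> x))"
  shows "c * (norm x)\<^sup>2 \<le> Re (cinner x (T \<cdot> x))"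
proof (cases "x = 0")
  case False
  define u where "u = (1 / norm x) *\<^sub>R x"
  have "norm u = 1" using False by (simp add: u_def)
  then have "c \<le> Re (cinner u (T \<cdot> u))" by (rule assms)
  also have "\<dots> = Re (cinner x (T \<cdot> x)) / (norm x)\<^sup>2"
    by (simp add: u_def app_linear cinner_linear power2_eq_square)
  finally show ?thesis using False by (simp add: field_simps)
qed auto

lemma sing_pos_nonneg: "pos C \<Longrightarrow> \<not> sing C \<Longrightarrow> \<exists>e>0. \<forall>x. e * (norm x)\<^sup>2 \<le> Re (cinner x (C \<cdot> x))"
  unfolding sing_def by (meson not_less quadratic_form_ge)

text \<open>In the joint spectrum of \<open>(C, A)\<close>, \<open>t\<close> is the largest \<open>a\<close> with \<open>(0, a)\<close> in the spectrum: for
  large \<open>m\<close> the supremum of \<open>A - m C\<close> is close to it.\<close>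
lemma sing_extend:
  fixes C A :: "'a::chilbert_space cop"
  assumes C: "pos C" "sing C" and A: "A\<^sup>\<dagger> = A" "A * C = C * A"
  shows "\<exists>t. sing (C + (A - t *\<^sub>R 1) * (A - t *\<^sub>R 1))"
proof -
  define q where "q T x = Re (cinner x (T \<cdot> x))" for T :: "'a cop" and x
  have q_lin: "q (S + T) x = q S x + q T x" "q (S - T) x = q S x - q T x"
    "q (r *\<^sub>R T) x = r * q T x" "q 1 x = (norm x)\<^sup>2" for S T :: "'a cop" and r x
    by (simp_all add: q_def cinner_linear Re_cinner_self)
  have q_le: "q T x \<le> norm T" if "norm x = 1" for T :: "'a cop" and x
    using Re_cinner_app_le[of x T] that by (simp add: q_def)
  have q_ge: "- norm T \<le> q T x" if "norm x = 1" for T :: "'a cop" and x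
    using q_le[OF that, of "-1 *\<^sub>R T"] by (simp only: q_lin) simp
  obtain x1 :: 'a where x1: "norm x1 = 1" using C(2) unfolding sing_def by (metis zero_less_one)
  define s where "s m = Sup {q (A - real m *\<^sub>R C) x | x. norm x = 1}" for m :: nat
  have bdd: "bdd_above {q (A - real m *\<^sub>R C) x | x. norm x = 1}" for m
    using q_le by (intro bdd_aboveI[of _ "norm (A - real m *\<^sub>R C)"]) auto
  have s_ge: "q (A - real m *\<^sub>R C) x \<le> s m" if "norm x = 1" for m x
    unfolding s_def using bdd that by (intro cSup_upper) auto
  have s_le: "s m \<le> b" if "\<And>x. norm x = 1 \<Longrightarrow> q (A - real m *\<^sub>R C) x \<le> b" for m b
    unfolding s_def using that x1 by (intro cSup_least) auto
  have s_lb: "- norm A - 1 \<le> s m" for m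
  proof -
    have "0 < 1 / (real m + 1)" by simp
    then obtain x where x: "norm x = 1" "q C x < 1 / (real m + 1)"
      using C(2) unfolding sing_def q_def by blast
    have "real m * q C x \<le> real m * (1 / (real m + 1))" using x by (intro mult_left_mono) auto
    also have "\<dots> \<le> 1" by simp
    finally have "- norm A - 1 \<le> q (A - real m *\<^sub>R C) x"
      using q_ge[OF x(1), of A] by (simp add: q_lin)
    then show ?thesis using s_ge[OF x(1), of m] by linarith
  qed
  define t where "t = Inf (range s)"
  have bb: "bdd_below (range s)" using s_lb by (auto intro!: bdd_belowI)
  have t_le: "t \<le> s m" for m unfolding t_def using bb by (intro cInf_lower) auto
  define B where "B = A - t *\<^sub>R 1"
  have Bsa: "B\<^sup>\<dagger> = B" by (simp add: B_def A)
  have BC: "B * C = C * B" by (simp add: B_def A algebra_simps)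
  have "sing (C + B * B)"
  proof (rule ccontr)
    assume "\<not> sing (C + B * B)"
    then obtain e where e: "e > 0" "\<And>x. norm x = 1 \<Longrightarrow> e \<le> q (C + B * B) x"
      unfolding sing_def q_def by (meson not_less)
    \<comment> \<open>\<open>K\<close> makes \<open>K - B\<close> and \<open>K + B\<close> positive;
      the summand \<open>1 + e\<close> yields \<open>d \<le> 1 / 2\<close> and \<open>d < K\<close>.
      The product \<open>d * K\<close> is half of the lower bound \<open>e\<close>.\<close>
    define K where "K = norm B + 1 + e"
    have K: "K > 0" "norm B \<le> K" using e by (auto simp: K_def add_nonneg_pos)
    define d where "d = e / (2 * K)"
    have d: "d > 0" "d * K = e / 2" using K e by (auto simp: d_def)
    have "d \<le> 1 / 2" using K e by (simp add: d_def K_def field_simps)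
    then have dK: "d < K" using e(1) norm_ge_zero[of B] unfolding K_def by linarith
    have "Inf (range s) < t + d" using d by (simp add: t_def)
    then obtain m where m: "s m < t + d" using cInf_less_iff[OF _ bb] by auto
    have posX: "pos (d *\<^sub>R 1 - B + real m *\<^sub>R C)"
    proof -
      have "0 \<le> Re (cinner x ((d *\<^sub>R 1 - B + real m *\<^sub>R C) \<cdot> x))" for x
      proof -
        have "0 \<le> q (d *\<^sub>R 1 - B + real m *\<^sub>R C) x" if "norm x = 1" for x
          using s_ge[OF that, of m] m that by (simp add: q_lin B_def)
        then show ?thesis using quadratic_form_ge[of 0 "d *\<^sub>R 1 - B + real m *\<^sub>R C" x] unfolding q_def by simp
      qed
      then show ?thesis by (simp add: pos_def Bsa posD(1)[OF C(1)])
    qed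
    have quadB: "\<bar>q B x\<bar> \<le> K * (norm x)\<^sup>2" for x
      using Re_cinner_app_le[of x B] Re_cinner_app_le[of x "- B"] mult_right_mono[OF K(2), of "(norm x)\<^sup>2"]
      by (simp add: q_def cinner_linear)
    have posY: "pos (K *\<^sub>R 1 + B)"
    proof -
      have "0 \<le> q (K *\<^sub>R 1 + B) x" for x using quadB[of x] by (simp add: q_lin)
      then show ?thesis using Bsa by (simp add: pos_def q_def)
    qed
    have posZ: "pos (K *\<^sub>R 1 - B)"
    proof -
      have "0 \<le> q (K *\<^sub>R 1 - B) x" for x using quadB[of x] by (simp add: q_lin)
      then show ?thesis using Bsa by (simp add: pos_def q_def)
    qed
    \<comment> \<open>The two positive products and \<open>C + B\<^sup>2 \<ge> e\<close> combine to
      \<open>(K - d) B \<le> (1 + 2 m K) C - e / 2\<close>. Modulo a multiple of \<open>C\<close>,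
      the upper bound \<open>d\<close> of \<open>B\<close> has improved to \<open>- h\<close>, so
      some \<open>s M\<close> falls below the infimum \<open>t\<close>.\<close>
    have XY: "pos ((d *\<^sub>R 1 - B + real m *\<^sub>R C) * (K *\<^sub>R 1 + B))"
      by (rule pos_mult[OF posX posY]) (simp add: algebra_simps BC)
    have CZ: "pos (C * (K *\<^sub>R 1 - B))"
      by (rule pos_mult[OF C(1) posZ]) (simp add: algebra_simps BC)
    obtain M :: nat where M: "(1 + 2 * real m * K) / (K - d) \<le> real M" using real_arch_simple by blast
    define h where "h = (e / 2) / (K - d)"
    have h: "h > 0" using e dK by (simp add: h_def)
    have "s M \<le> t - h"
    proof (rule s_le)
      fix x :: 'a assume x: "norm x = 1"
      have qC: "0 \<le> q C x" using posD(2)[OF C(1)] by (simp add: q_def)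
      have "(d *\<^sub>R 1 - B + real m *\<^sub>R C) * (K *\<^sub>R 1 + B)
          = (d * K) *\<^sub>R 1 + (d - K) *\<^sub>R B - B * B + (real m * K) *\<^sub>R C + real m *\<^sub>R (C * B)"
        by (simp add: algebra_simps)
      then have 1: "0 \<le> d * K + (d - K) * q B x - q (B * B) x + real m * K * q C x + real m * q (C * B) x"
        using posD(2)[OF XY, of x] x unfolding q_def[symmetric] by (simp add: q_lin)
      have "C * (K *\<^sub>R 1 - B) = K *\<^sub>R C - C * B" by (simp add: algebra_simps)
      then have "q (C * B) x \<le> K * q C x"
        using posD(2)[OF CZ, of x] x unfolding q_def[symmetric] by (simp add: q_lin)
      then have 2: "real m * q (C * B) x \<le> real m * (K * q C x)" by (rule mult_left_mono) simp
      have 3: "e \<le> q C x + q (B * B) x" using e(2)[OF x] by (simp add: q_lin)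
      have "(K - d) * q B x \<le> (1 + 2 * real m * K) * q C x - e / 2"
        using 1 2 3 d(2) by (simp add: algebra_simps)
      then have "q B x \<le> ((1 + 2 * real m * K) * q C x - e / 2) / (K - d)"
        using dK by (simp add: pos_le_divide_eq mult.commute)
      also have "\<dots> = (1 + 2 * real m * K) / (K - d) * q C x - h"
        by (simp add: h_def diff_divide_distrib)
      also have "\<dots> \<le> real M * q C x - h" using mult_right_mono[OF M qC] by simp
      finally show "q (A - real M *\<^sub>R C) x \<le> t - h" using x by (simp add: B_def q_lin)
    qed
    then show False using t_le[of M] h by linarith
  qed
  then show ?thesis by (auto simp: B_def)
qed

definition normal :: "'a::chilbert_space cop \<Rightarrow> bool"
  where "normal N \<longleftrightarrow> N * N\<^sup>\<dagger> = N\<^sup>\<dagger> * N"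

lemma normal_minus_cs: "normal N \<Longrightarrow> normal (N - cs z)"
  by (simp add: normal_def left_diff_distrib right_diff_distrib cs_comm[of N] cs_comm[of "N\<^sup>\<dagger>"] mult.commute
      flip: cs_mult)

lemma norm_star_app_normal: "normal N \<Longrightarrow> norm (N\<^sup>\<dagger> \<cdot> x) = norm (N \<cdot> x)"
  by (rule power2_eq_imp_eq) (simp_all add: norm_app_sq normal_def)

text \<open>With \<open>N = A + \<i> B\<close> for commuting self-adjoint \<open>A\<close> and
  \<open>B\<close>, the extension is made twice, because
  \<open>(N - z)\<^sup>\<dagger> * (N - z)\<close> is the sum of \<open>(A - t)\<^sup>2\<close> and
  \<open>(B - u)\<^sup>2\<close> for \<open>z = t + \<i> u\<close>. Since \<open>C\<close> is
  self-adjoint, it commutes with \<open>N\<^sup>\<dagger>\<close> too and hence with both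
  parts.\<close>

lemma sing_extend_normal:
  fixes C N :: "'a::chilbert_space cop"
  assumes C: "pos C" "sing C" and N: "normal N" "N * C = C * N"
  shows "\<exists>z. pos (C + (N - cs z)\<^sup>\<dagger> * (N - cs z)) \<and> sing (C + (N - cs z)\<^sup>\<dagger> * (N - cs z))"
proof -
  define A where "A = (1/2) *\<^sub>R (N + N\<^sup>\<dagger>)"
  define B where "B = cs (- \<i> / 2) * (N - N\<^sup>\<dagger>)"
  have NsC: "N\<^sup>\<dagger> * C = C * N\<^sup>\<dagger>"
    using arg_cong[OF N(2), of star] posD(1)[OF C(1)] by simp
  have A: "A\<^sup>\<dagger> = A" "A * C = C * A" using NsC N by (simp_all add: A_def algebra_simps)
  have B: "B\<^sup>\<dagger> = B"
    by (simp add: B_def cs_minus cs_comm[symmetric] left_diff_distrib)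
  have BC: "B * C = C * B"
    using NsC N by (simp add: B_def cs_left_comm mult.assoc left_diff_distrib right_diff_distrib)
  have Nn: "N * N\<^sup>\<dagger> = N\<^sup>\<dagger> * N" using N(1) by (simp add: normal_def)
  have AB: "A * B = B * A"
  proof -
    have "(N + N\<^sup>\<dagger>) * (N - N\<^sup>\<dagger>) = (N - N\<^sup>\<dagger>) * (N + N\<^sup>\<dagger>)"
      by (simp add: algebra_simps Nn)
    then show ?thesis by (simp add: A_def B_def cs_left_comm mult.assoc)
  qed
  have "cs \<i> * B = cs (of_real (1/2)) * (N - N\<^sup>\<dagger>)"
    by (simp add: B_def flip: mult.assoc cs_mult)
  then have "cs \<i> * B = (1/2) *\<^sub>R (N - N\<^sup>\<dagger>)" unfolding cs_of_real by simp
  then have "A + cs \<i> * B = (1/2) *\<^sub>R ((N + N\<^sup>\<dagger>) + (N - N\<^sup>\<dagger>))"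
    by (simp only: A_def scaleR_right_distrib)
  also have "(N + N\<^sup>\<dagger>) + (N - N\<^sup>\<dagger>) = 2 *\<^sub>R N" by (simp add: scaleR_2)
  finally have N_eq: "N = A + cs \<i> * B" by simp
  obtain t where t: "sing (C + (A - t *\<^sub>R 1) * (A - t *\<^sub>R 1))" using sing_extend[OF C A] by blast
  define C' where "C' = C + (A - t *\<^sub>R 1) * (A - t *\<^sub>R 1)"
  have C': "pos C'" unfolding C'_def using C(1) A(1) by (intro pos_add pos_mult_self) auto
  have B1: "B * (A - t *\<^sub>R 1) = (A - t *\<^sub>R 1) * B" using AB by (simp add: algebra_simps)
  have "B * ((A - t *\<^sub>R 1) * (A - t *\<^sub>R 1)) = (A - t *\<^sub>R 1) * (A - t *\<^sub>R 1) * B"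
    by (metis B1 mult.assoc)
  then have "B * C' = C' * B"
    using BC by (simp add: C'_def distrib_left distrib_right)
  then obtain u where u: "sing (C' + (B - u *\<^sub>R 1) * (B - u *\<^sub>R 1))"
    using sing_extend[OF C' t[folded C'_def] B] by blast
  define a b where "a = A - t *\<^sub>R 1" and "b = B - u *\<^sub>R 1"
  have sa: "a\<^sup>\<dagger> = a" "b\<^sup>\<dagger> = b" "a * b = b * a"
    using A B AB by (simp_all add: a_def b_def algebra_simps)
  have "Complex t u = of_real t + \<i> * of_real u" by (simp add: complex_eq_iff)
  then have "cs (Complex t u) = t *\<^sub>R (1::'a cop) + cs \<i> * (u *\<^sub>R 1)"
    by (simp only: cs_add cs_mult cs_of_real)
  then have "N - cs (Complex t u) = a + cs \<i> * b"
    unfolding a_def b_def N_eq by (simp add: right_diff_distrib)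
  then have "(N - cs (Complex t u))\<^sup>\<dagger> * (N - cs (Complex t u)) = (a - cs \<i> * b) * (a + cs \<i> * b)"
    by (simp add: sa cs_minus cs_comm[of b])
  also have "\<dots> = a * a + b * b"
  proof -
    have "a * (cs \<i> * b) = (cs \<i> * b) * a" by (simp add: cs_left_comm sa(3) mult.assoc)
    moreover have "(cs \<i> * b) * (cs \<i> * b) = - (b * b)" by (simp add: cs_mult_cs cs_minus)
    ultimately show ?thesis by (simp add: left_diff_distrib distrib_left)
  qed
  finally have "C' + b * b = C + (N - cs (Complex t u))\<^sup>\<dagger> * (N - cs (Complex t u))"
    by (simp add: C'_def a_def add.assoc)
  moreover have "pos (C' + b * b)" using C' sa by (intro pos_add pos_mult_self)
  ultimately show ?thesis using u by (auto simp: b_def[symmetric])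
qed

section \<open>Relations between normal operators from the Taylor spectrum\<close>

text \<open>The choice of signs in \<open>y\<close> (as in Sokal's proof of the uniform boundedness principle) keeps
  \<open>cinner (x k) y\<close> above \<open>3\<^sup>-\<^sup>k / 2\<close>, whereas surjectivity would make it of order \<open>9\<^sup>-\<^sup>k\<close>.\<close>
lemma joint_approx_eigenvalue_not_surj:
  fixes N1 N2 N3 :: "'a::chilbert_space cop"
  assumes nor: "normal N1" "normal N2" "normal N3"
    and S: "sing (N1\<^sup>\<dagger> * N1 + N2\<^sup>\<dagger> * N2 + N3\<^sup>\<dagger> * N3)"
  shows "\<exists>y. \<forall>y1 y2 y3. N1 \<cdot> y1 + N2 \<cdot> y2 + N3 \<cdot> y3 \<noteq> y"
proof (rule ccontr)
  assume "\<not> ?thesis"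
  then have surj: "\<And>y. \<exists>y1 y2 y3. N1 \<cdot> y1 + N2 \<cdot> y2 + N3 \<cdot> y3 = y" by blast
  define c :: "nat \<Rightarrow> real" where "c k = (1/3) ^ k" for k
  have c: "0 < c k" "c (Suc k) = c k / 3" for k by (simp_all add: c_def)
  have "\<exists>x. norm x = 1 \<and> (norm (N1 \<cdot> x))\<^sup>2 + (norm (N2 \<cdot> x))\<^sup>2 + (norm (N3 \<cdot> x))\<^sup>2 < (c k * c k)\<^sup>2" for k
  proof -
    have "0 < (c k * c k)\<^sup>2" using c(1)[of k] by simp
    then show ?thesis
      using S unfolding sing_def by (simp add: cinner_linear norm_app_sq)
  qed
  then obtain X where X: "\<And>k. norm (X k) = 1"
    "\<And>k. (norm (N1 \<cdot> X k))\<^sup>2 + (norm (N2 \<cdot> X k))\<^sup>2 + (norm (N3 \<cdot> X k))\<^sup>2 < (c k * c k)\<^sup>2" by metis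
  have small: "norm (N \<cdot> X k) \<le> c k * c k" if "N = N1 \<or> N = N2 \<or> N = N3" for N k
  proof -
    have "(norm (N1 \<cdot> X k))\<^sup>2 \<le> (c k * c k)\<^sup>2" "(norm (N2 \<cdot> X k))\<^sup>2 \<le> (c k * c k)\<^sup>2"
      "(norm (N3 \<cdot> X k))\<^sup>2 \<le> (c k * c k)\<^sup>2"
      using X(2)[of k] zero_le_power2[of "norm (N1 \<cdot> X k)"] zero_le_power2[of "norm (N2 \<cdot> X k)"]
        zero_le_power2[of "norm (N3 \<cdot> X k)"] by linarith+
    then have "(norm (N \<cdot> X k))\<^sup>2 \<le> (c k * c k)\<^sup>2" using that by blast
    then show ?thesis by (rule power2_le_imp_le) (use c(1)[of k] in simp)
  qed
  define Y where "Y = rec_nat 0 (\<lambda>k y. if c k \<le> cmod (cinner (X k) (y + c k *\<^sub>R X k))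
    then y + c k *\<^sub>R X k else y - c k *\<^sub>R X k)"
  have Y: "Y (Suc k) = (if c k \<le> cmod (cinner (X k) (Y k + c k *\<^sub>R X k))
    then Y k + c k *\<^sub>R X k else Y k - c k *\<^sub>R X k)" for k by (simp add: Y_def)
  \<comment> \<open>One of the two signs always works: the inner products of \<open>X k\<close> with
    the two candidates differ by \<open>2 * c k\<close>, so they cannot both have modulus below
    \<open>c k\<close>.\<close>
  have big: "c k \<le> cmod (cinner (X k) (Y (Suc k)))" for k
  proof (cases "c k \<le> cmod (cinner (X k) (Y k + c k *\<^sub>R X k))")
    case False
    define p where "p = cinner (X k) (Y k)"
    have "cmod (p + of_real (c k)) < c k"
      using False by (simp add: cinner_linear cinner_self X p_def)
    moreover have "cmod (of_real (2 * c k)) \<le> cmod (p + of_real (c k)) + cmod (p - of_real (c k))"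
      using norm_triangle_ineq4[of "p + of_real (c k)" "p - of_real (c k)"] by simp
    ultimately have "c k \<le> cmod (p - of_real (c k))" using c(1)[of k] by (simp del: of_real_mult)
    then show ?thesis using False by (simp add: Y cinner_linear cinner_self X p_def)
  qed (simp add: Y)
  have step: "norm (Y (Suc k) - Y k) = c k" for k
    using c(1)[of k] by (simp add: Y X)
  have dist: "norm (Y (n + k) - Y n) \<le> 3 / 2 * (c n - c (n + k))" for n k
  proof (induction k)
    case (Suc k)
    then show ?case
      using norm_triangle_ineq[of "Y (Suc (n + k)) - Y (n + k)" "Y (n + k) - Y n"] step[of "n + k"]
        c(2)[of "n + k"] by simp
  qed simp
  have dist': "norm (Y m - Y n) \<le> 3 / 2 * c n" if "n \<le> m" for m n
    using dist[of n "m - n"] c(1)[of m] that by simp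
  have c0: "c \<longlonglongrightarrow> 0" unfolding c_def by (rule LIMSEQ_realpow_zero) auto
  have "Cauchy Y"
  proof (rule CauchyI')
    fix e :: real assume "0 < e"
    then have "0 < e / 2" by simp
    from order_tendstoD(2)[OF c0 this] obtain M where M: "\<And>n. n \<ge> M \<Longrightarrow> c n < e / 2"
      unfolding eventually_sequentially by auto
    have "dist (Y m) (Y n) < e" if "M \<le> m" "m < n" for m n
      using dist'[of m n] that M[of m] \<open>0 < e\<close> by (simp add: dist_norm norm_minus_commute)
    then show "\<exists>M. \<forall>m\<ge>M. \<forall>n>m. dist (Y m) (Y n) < e" by blast
  qed
  then obtain y where y: "Y \<longlonglongrightarrow> y" using Cauchy_convergent_iff convergent_def by blast
  \<comment> \<open>All later corrections together have norm at most
    \<open>3 / 2 * c (Suc k) = c k / 2\<close>, half of what step \<open>k\<close> has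
    secured.\<close>
  have lower: "c k / 2 \<le> cmod (cinner (X k) y)" for k
  proof -
    have "(\<lambda>m. norm (Y m - Y (Suc k))) \<longlonglongrightarrow> norm (y - Y (Suc k))" by (intro tendsto_intros y)
    then have "norm (y - Y (Suc k)) \<le> 3 / 2 * c (Suc k)"
      by (rule LIMSEQ_le_const2) (use dist' in blast)
    then have "cmod (cinner (X k) (Y (Suc k) - y)) \<le> c k / 2"
      using Cauchy_Schwarz[of "X k" "Y (Suc k) - y"] by (simp add: X c norm_minus_commute)
    then show ?thesis
      using big[of k] norm_triangle_ineq[of "cinner (X k) (Y (Suc k) - y)" "cinner (X k) y"]
      by (simp add: cinner_linear)
  qed
  obtain y1 y2 y3 where y123: "N1 \<cdot> y1 + N2 \<cdot> y2 + N3 \<cdot> y3 = y" using surj by blast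
  define L where "L = norm y1 + norm y2 + norm y3"
  \<comment> \<open>Normality transfers the smallness from \<open>N \<cdot> X k\<close> to
    \<open>N\<^sup>\<dagger> \<cdot> X k\<close>, the vector that arises when \<open>N\<close> is
    moved to the left entry.\<close>
  have part: "cmod (cinner (X k) (N \<cdot> v)) \<le> c k * c k * norm v"
    if "N = N1 \<or> N = N2 \<or> N = N3" for N v k
  proof -
    have "normal N" using that nor by auto
    then have "cmod (cinner (X k) (N \<cdot> v)) \<le> norm (N \<cdot> X k) * norm v"
      using Cauchy_Schwarz[of "N\<^sup>\<dagger> \<cdot> X k" v] by (simp add: cinner_app_right norm_star_app_normal)
    also have "\<dots> \<le> c k * c k * norm v" using small[OF that] by (rule mult_right_mono) simp
    finally show ?thesis .
  qed
  have upper: "cmod (cinner (X k) y) \<le> c k * c k * L" for k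
  proof -
    have "cmod (cinner (X k) y) \<le> cmod (cinner (X k) (N1 \<cdot> y1)) + cmod (cinner (X k) (N2 \<cdot> y2))
        + cmod (cinner (X k) (N3 \<cdot> y3))"
      unfolding y123[symmetric] cinner_add_right by (intro norm_triangle_le add_right_mono norm_triangle_ineq)
    also have "\<dots> \<le> c k * c k * L"
      using part[of N1 k y1] part[of N2 k y2] part[of N3 k y3] by (simp add: L_def algebra_simps)
    finally show ?thesis .
  qed
  have "1 / 2 \<le> c k * L" for k
  proof -
    have "c k * (1 / 2) \<le> c k * (c k * L)" using order_trans[OF lower upper, of k] by (simp add: mult.assoc)
    then show ?thesis using c(1)[of k] by (simp add: mult_le_cancel_left_pos)
  qed
  moreover have "(\<lambda>k. c k * L) \<longlonglongrightarrow> 0 * L" by (intro tendsto_intros c0)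
  ultimately have "1 / 2 \<le> 0 * L" by (intro LIMSEQ_le_const) auto
  then show False by simp
qed

lemma commute_mult_right:
  fixes x :: "'a::semigroup_mult"
  shows "x * a = a * x \<Longrightarrow> x * b = b * x \<Longrightarrow> x * (a * b) = a * b * x"
  by (metis mult.assoc)

text \<open>An element \<open>G\<close> of the algebra generated by the \<open>N\<^sub>i\<close> attains its norm approximately on joint
  approximate eigenvectors of the \<open>N\<^sub>i\<close>.\<close>
lemma zero_if_zero_on_joint_spectrum:
  fixes N1 N2 N3 G :: "'a::chilbert_space cop"
  assumes nor: "normal N1" "normal N2" "normal N3"
    and com: "N1 * N2 = N2 * N1" "N1 * N3 = N3 * N1" "N2 * N3 = N3 * N2"
    and G: "G * N1 = N1 * G" "G * N2 = N2 * G" "G * N3 = N3 * G"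
    and H: "\<And>z1 z2 z3. \<exists>y. \<forall>y1 y2 y3. (N1 - cs z1) \<cdot> y1 + (N2 - cs z2) \<cdot> y2 + (N3 - cs z3) \<cdot> y3 \<noteq> y \<Longrightarrow>
      \<exists>K. \<forall>x. norm (G \<cdot> x) \<le> K * (norm ((N1 - cs z1) \<cdot> x) + norm ((N2 - cs z2) \<cdot> x) + norm ((N3 - cs z3) \<cdot> x))"
  shows "G = 0"
proof (rule ccontr)
  assume "G \<noteq> 0"
  define g where "g = (norm G)\<^sup>2"
  have g: "g > 0" using \<open>G \<noteq> 0\<close> by (simp add: g_def)
  \<comment> \<open>\<open>C\<close> is positive, and singular because the norm of \<open>G\<close>
    is a supremum: its approximate null vectors are the unit vectors at which \<open>G\<close>
    almost attains its norm.\<close>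
  define C where "C = g *\<^sub>R 1 - G\<^sup>\<dagger> * G"
  have quadC: "Re (cinner x (C \<cdot> x)) = g * (norm x)\<^sup>2 - (norm (G \<cdot> x))\<^sup>2" for x
    by (simp add: C_def cinner_linear norm_app_sq Re_cinner_self)
  have posC: "pos C"
  proof -
    have "(norm (G \<cdot> x))\<^sup>2 \<le> g * (norm x)\<^sup>2" for x
      using power_mono[OF norm_app_le[of G x], of 2] by (simp add: g_def power_mult_distrib)
    then show ?thesis by (simp add: pos_def quadC) (simp add: C_def)
  qed
  have singC: "sing C"
  proof (rule ccontr)
    assume "\<not> sing C"
    then obtain e where e: "e > 0" "\<And>x. e * (norm x)\<^sup>2 \<le> g * (norm x)\<^sup>2 - (norm (G \<cdot> x))\<^sup>2"
      using sing_pos_nonneg[OF posC] unfolding quadC by blast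
    define b where "b = sqrt (max 0 (g - e))"
    have "norm G \<le> b"
    proof (rule norm_cop_bound)
      fix x
      have "(norm (G \<cdot> x))\<^sup>2 \<le> (g - e) * (norm x)\<^sup>2" using e(2)[of x] by (simp add: algebra_simps)
      also have "\<dots> \<le> max 0 (g - e) * (norm x)\<^sup>2" by (rule mult_right_mono) auto
      also have "\<dots> = (b * norm x)\<^sup>2" by (simp add: b_def power_mult_distrib)
      finally show "norm (G \<cdot> x) \<le> b * norm x" by (rule power2_le_imp_le) (simp add: b_def)
    qed (simp add: b_def)
    then have "g \<le> b\<^sup>2" unfolding g_def by (rule power_mono) simp
    then show False using g e(1) by (simp add: b_def)
  qed
  \<comment> \<open>\<open>C\<close> and its extensions \<open>C1\<close>, \<open>C2\<close> contain
    adjoints, and the next \<open>N\<close> has to commute with them.\<close>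
  have fug: "N1 * N2\<^sup>\<dagger> = N2\<^sup>\<dagger> * N1" "N1 * N3\<^sup>\<dagger> = N3\<^sup>\<dagger> * N1" "N2 * N1\<^sup>\<dagger> = N1\<^sup>\<dagger> * N2" "N2 * N3\<^sup>\<dagger> = N3\<^sup>\<dagger> * N2"
    "N3 * N1\<^sup>\<dagger> = N1\<^sup>\<dagger> * N3" "N3 * N2\<^sup>\<dagger> = N2\<^sup>\<dagger> * N3"
    "G * N1\<^sup>\<dagger> = N1\<^sup>\<dagger> * G" "G * N2\<^sup>\<dagger> = N2\<^sup>\<dagger> * G" "G * N3\<^sup>\<dagger> = N3\<^sup>\<dagger> * G"
    by (rule Fuglede; use nor com G in \<open>simp add: normal_def\<close>)+
  have Gs: "N * C = C * N" if "G * N = N * G" "G * N\<^sup>\<dagger> = N\<^sup>\<dagger> * G" for N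
  proof -
    have "N * G\<^sup>\<dagger> = G\<^sup>\<dagger> * N" using arg_cong[OF that(2), of star] by simp
    then have "N * (G\<^sup>\<dagger> * G) = G\<^sup>\<dagger> * G * N" using that(1) by (intro commute_mult_right) auto
    then show ?thesis by (simp add: C_def right_diff_distrib left_diff_distrib)
  qed
  have shift: "M * ((N - cs z)\<^sup>\<dagger> * (N - cs z)) = (N - cs z)\<^sup>\<dagger> * (N - cs z) * M"
    if "M * N = N * M" "M * N\<^sup>\<dagger> = N\<^sup>\<dagger> * M" for M N :: "'a cop" and z
    using that by (intro commute_mult_right) (simp_all add: right_diff_distrib left_diff_distrib cs_comm)
  obtain z1 where z1: "pos (C + (N1 - cs z1)\<^sup>\<dagger> * (N1 - cs z1))" "sing (C + (N1 - cs z1)\<^sup>\<dagger> * (N1 - cs z1))"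
    using sing_extend_normal[OF posC singC nor(1) Gs] G fug by blast
  define C1 where "C1 = C + (N1 - cs z1)\<^sup>\<dagger> * (N1 - cs z1)"
  have C1: "N * C1 = C1 * N" if "N * N1 = N1 * N" "N * N1\<^sup>\<dagger> = N1\<^sup>\<dagger> * N" "G * N = N * G" "G * N\<^sup>\<dagger> = N\<^sup>\<dagger> * G" for N
    using shift[OF that(1,2)] Gs[OF that(3,4)] by (simp add: C1_def distrib_left distrib_right)
  obtain z2 where z2: "pos (C1 + (N2 - cs z2)\<^sup>\<dagger> * (N2 - cs z2))" "sing (C1 + (N2 - cs z2)\<^sup>\<dagger> * (N2 - cs z2))"
    using sing_extend_normal[OF z1[folded C1_def] nor(2) C1] G fug com by metis
  define C2 where "C2 = C1 + (N2 - cs z2)\<^sup>\<dagger> * (N2 - cs z2)"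
  have "N3 * C2 = C2 * N3"
    using shift[of N3 N2 z2] C1[of N3] G fug com by (simp add: C2_def distrib_left distrib_right)
  then obtain z3 where z3: "sing (C2 + (N3 - cs z3)\<^sup>\<dagger> * (N3 - cs z3))"
    using sing_extend_normal[OF z2[folded C2_def] nor(3)] by blast
  define n1 n2 n3 where "n1 = N1 - cs z1" and "n2 = N2 - cs z2" and "n3 = N3 - cs z3"
  have nn: "normal n1" "normal n2" "normal n3" unfolding n1_def n2_def n3_def using nor by (simp_all add: normal_minus_cs)
  have S: "\<exists>x. norm x = 1 \<and> g - (norm (G \<cdot> x))\<^sup>2 + (norm (n1 \<cdot> x))\<^sup>2 + (norm (n2 \<cdot> x))\<^sup>2 + (norm (n3 \<cdot> x))\<^sup>2 < e"
    if e: "e > 0" for e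
  proof -
    obtain x where x: "norm x = 1" "Re (cinner x ((C2 + n3\<^sup>\<dagger> * n3) \<cdot> x)) < e"
      using z3 e unfolding sing_def n3_def[symmetric] by blast
    have "Re (cinner x ((C2 + n3\<^sup>\<dagger> * n3) \<cdot> x)) = Re (cinner x (C \<cdot> x))
        + Re (cinner x ((n1\<^sup>\<dagger> * n1) \<cdot> x)) + Re (cinner x ((n2\<^sup>\<dagger> * n2) \<cdot> x)) + Re (cinner x ((n3\<^sup>\<dagger> * n3) \<cdot> x))"
      unfolding C2_def C1_def n1_def[symmetric] n2_def[symmetric] by (simp add: cinner_linear)
    then show ?thesis using x by (intro exI[of _ x]) (simp add: quadC norm_app_sq)
  qed
  have Gle: "(norm (G \<cdot> x))\<^sup>2 \<le> g" if "norm x = 1" for x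
    using posD(2)[OF posC, of x] that by (simp add: quadC)
  have "sing (n1\<^sup>\<dagger> * n1 + n2\<^sup>\<dagger> * n2 + n3\<^sup>\<dagger> * n3)"
    unfolding sing_def
  proof (intro allI impI)
    fix e :: real assume "e > 0"
    then obtain x where x: "norm x = 1"
      "g - (norm (G \<cdot> x))\<^sup>2 + (norm (n1 \<cdot> x))\<^sup>2 + (norm (n2 \<cdot> x))\<^sup>2 + (norm (n3 \<cdot> x))\<^sup>2 < e" using S by blast
    have "Re (cinner x ((n1\<^sup>\<dagger> * n1 + n2\<^sup>\<dagger> * n2 + n3\<^sup>\<dagger> * n3) \<cdot> x))
        = (norm (n1 \<cdot> x))\<^sup>2 + (norm (n2 \<cdot> x))\<^sup>2 + (norm (n3 \<cdot> x))\<^sup>2"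
      by (simp add: cinner_linear norm_app_sq)
    then show "\<exists>x. norm x = 1 \<and> Re (cinner x ((n1\<^sup>\<dagger> * n1 + n2\<^sup>\<dagger> * n2 + n3\<^sup>\<dagger> * n3) \<cdot> x)) < e"
      using x Gle[OF x(1)] by (intro exI[of _ x]) linarith
  qed
  from joint_approx_eigenvalue_not_surj[OF nn this]
  obtain K where K: "\<And>x. norm (G \<cdot> x) \<le> K * (norm (n1 \<cdot> x) + norm (n2 \<cdot> x) + norm (n3 \<cdot> x))"
    using H unfolding n1_def n2_def n3_def by blast
  define L where "L = \<bar>K\<bar> + 1"
  have GL: "norm (G \<cdot> x) \<le> L * (norm (n1 \<cdot> x) + norm (n2 \<cdot> x) + norm (n3 \<cdot> x))" for x
    by (rule order_trans[OF K mult_right_mono]) (auto simp: L_def)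
  \<comment> \<open>With all three residuals at most \<open>r\<close>, the squared norm of
    \<open>G \<cdot> x\<close> is at most \<open>9 * L\<^sup>2 * r\<^sup>2\<close>, so
    \<open>g\<close> exceeds it by at least \<open>2 * r\<^sup>2\<close>, whereas \<open>S\<close>
    provides an \<open>x\<close> for which the excess is below \<open>r\<^sup>2\<close>.\<close>
  define r where "r = sqrt (g / (2 + 9 * L\<^sup>2))"
  have "2 + 9 * L\<^sup>2 > 0" by (simp add: add_pos_nonneg)
  then have r: "r > 0" "r\<^sup>2 * (2 + 9 * L\<^sup>2) = g" using g by (simp_all add: r_def)
  have "r\<^sup>2 > 0" using r by simp
  then obtain x where x: "norm x = 1"
    "g - (norm (G \<cdot> x))\<^sup>2 + (norm (n1 \<cdot> x))\<^sup>2 + (norm (n2 \<cdot> x))\<^sup>2 + (norm (n3 \<cdot> x))\<^sup>2 < r\<^sup>2" using S by blast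
  have "(norm (n1 \<cdot> x))\<^sup>2 \<le> r\<^sup>2" "(norm (n2 \<cdot> x))\<^sup>2 \<le> r\<^sup>2" "(norm (n3 \<cdot> x))\<^sup>2 \<le> r\<^sup>2"
    using x Gle[OF x(1)] zero_le_power2[of "norm (n1 \<cdot> x)"] zero_le_power2[of "norm (n2 \<cdot> x)"]
      zero_le_power2[of "norm (n3 \<cdot> x)"] by linarith+
  then have "norm (n1 \<cdot> x) \<le> r" "norm (n2 \<cdot> x) \<le> r" "norm (n3 \<cdot> x) \<le> r"
    using r(1) by (meson less_imp_le power2_le_imp_le)+
  then have "L * (norm (n1 \<cdot> x) + norm (n2 \<cdot> x) + norm (n3 \<cdot> x)) \<le> L * (3 * r)"
    by (intro mult_left_mono) (auto simp: L_def)
  then have "norm (G \<cdot> x) \<le> L * (3 * r)" using GL[of x] by linarith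
  then have "(norm (G \<cdot> x))\<^sup>2 \<le> (L * (3 * r))\<^sup>2" by (rule power_mono) simp
  also have "\<dots> = r\<^sup>2 * (9 * L\<^sup>2)" by (simp add: power_mult_distrib)
  finally have "(norm (G \<cdot> x))\<^sup>2 + r\<^sup>2 < g" using r(2) \<open>r\<^sup>2 > 0\<close> unfolding distrib_left by linarith
  then show False
    using x(2) zero_le_power2[of "norm (n1 \<cdot> x)"] zero_le_power2[of "norm (n2 \<cdot> x)"]
      zero_le_power2[of "norm (n3 \<cdot> x)"] by linarith
qed

text \<open>The operator on the left is
  \<open>N\<^sup>\<dagger> * (N - z) + z * (N - z)\<^sup>\<dagger>\<close>, and for normal
  \<open>N\<close> the factor \<open>(N - z)\<^sup>\<dagger>\<close> has the same norm at
  \<open>x\<close> as \<open>N - z\<close>. The estimate serves both directions: where the scalar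
  equation holds it bounds the operator defect, and where the operator equation holds it bounds a
  multiple of \<open>norm x\<close>.\<close>

lemma norm_star_mult_minus_le:
  assumes "normal N"
  shows "norm ((N\<^sup>\<dagger> * N - cs (z * cnj z)) \<cdot> x) \<le> (norm N + cmod z) * norm ((N - cs z) \<cdot> x)"
proof -
  have "N\<^sup>\<dagger> * N - cs (z * cnj z) = N\<^sup>\<dagger> * (N - cs z) + cs z * (N - cs z)\<^sup>\<dagger>"
    by (simp add: right_diff_distrib cs_comm[of "N\<^sup>\<dagger>" z] cs_mult)
  then have "norm ((N\<^sup>\<dagger> * N - cs (z * cnj z)) \<cdot> x)
      \<le> norm (N\<^sup>\<dagger> \<cdot> (N - cs z) \<cdot> x) + cmod z * norm ((N - cs z)\<^sup>\<dagger> \<cdot> x)"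
    using norm_triangle_ineq[of "N\<^sup>\<dagger> \<cdot> (N - cs z) \<cdot> x" "cscale z ((N - cs z)\<^sup>\<dagger> \<cdot> x)"]
    by (simp only: app_ops norm_cscale)
  also have "\<dots> \<le> norm N * norm ((N - cs z) \<cdot> x) + cmod z * norm ((N - cs z) \<cdot> x)"
    using norm_app_le[of "N\<^sup>\<dagger>" "(N - cs z) \<cdot> x"] norm_star_app_normal[OF normal_minus_cs[OF assms]]
    by (simp only: norm_star)
  finally show ?thesis by (simp only: distrib_right)
qed

text \<open>With \<open>n2 = N2 - z2\<close> and \<open>n3 = N3 - z3\<close> the operator on the
  left is \<open>n2 - N2\<^sup>\<dagger> * n3 - z3 * n2\<^sup>\<dagger>\<close>. This is the
  counterpart of the previous estimate for the relation
  \<open>N2 = N2\<^sup>\<dagger> * N3\<close>.\<close>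

lemma norm_minus_star_mult_le:
  assumes "normal N2"
  shows "norm ((N2 - N2\<^sup>\<dagger> * N3 - cs (z2 - cnj z2 * z3)) \<cdot> x)
    \<le> (1 + norm N2 + cmod z3) * (norm ((N2 - cs z2) \<cdot> x) + norm ((N3 - cs z3) \<cdot> x))"
proof -
  define n2 n3 where "n2 = N2 - cs z2" and "n3 = N3 - cs z3"
  have N: "N2 = n2 + cs z2" "N3 = n3 + cs z3" "N2\<^sup>\<dagger> = n2\<^sup>\<dagger> + cs (cnj z2)" by (simp_all add: n2_def n3_def)
  have eq: "N2 - N2\<^sup>\<dagger> * N3 - cs (z2 - cnj z2 * z3) = n2 - N2\<^sup>\<dagger> * n3 - cs z3 * n2\<^sup>\<dagger>"
    unfolding N by (simp add: algebra_simps cs_comm[of "n2\<^sup>\<dagger>" z3] cs_mult cs_diff cs_comm[of "cs (cnj z2)" z3])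
  have "norm (n2\<^sup>\<dagger> \<cdot> x) = norm (n2 \<cdot> x)"
    unfolding n2_def by (rule norm_star_app_normal[OF normal_minus_cs[OF assms]])
  moreover have "norm (N2\<^sup>\<dagger> \<cdot> n3 \<cdot> x) \<le> norm N2 * norm (n3 \<cdot> x)"
    using norm_app_le[of "N2\<^sup>\<dagger>"] by (simp only: norm_star)
  moreover have "norm ((N2 - N2\<^sup>\<dagger> * N3 - cs (z2 - cnj z2 * z3)) \<cdot> x)
      \<le> norm (n2 \<cdot> x) + norm (N2\<^sup>\<dagger> \<cdot> n3 \<cdot> x) + cmod z3 * norm (n2\<^sup>\<dagger> \<cdot> x)"
    unfolding eq app_ops norm_cscale[symmetric]
    by (intro norm_triangle_le_diff add_right_mono norm_triangle_ineq4)
  moreover have "norm (n2 \<cdot> x) + norm N2 * norm (n3 \<cdot> x) + cmod z3 * norm (n2 \<cdot> x) \<le>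
      (1 + norm N2 + cmod z3) * (norm (n2 \<cdot> x) + norm (n3 \<cdot> x))"
    by (simp add: algebra_simps add_nonneg_nonneg)
  ultimately show ?thesis unfolding n2_def n3_def by simp
qed

text \<open>Stated for a triple so as to apply to a P-unitary and, with \<open>N1 = 0\<close>, to
  the pair of a Gamma-unitary. Each defect commutes with the triple, and at a point of
  \<open>bGamma\<close> its scalar counterpart vanishes, so the two estimates bound it by the
  residuals.\<close>

lemma Gamma_relations_from_spectrum:
  fixes N1 N2 N3 :: "'a::chilbert_space cop"
  assumes nor: "normal N1" "normal N2" "normal N3"
    and com: "N1 * N2 = N2 * N1" "N1 * N3 = N3 * N1" "N2 * N3 = N3 * N2"
    and H: "\<And>z1 z2 z3. \<exists>y. \<forall>y1 y2 y3. (N1 - cs z1) \<cdot> y1 + (N2 - cs z2) \<cdot> y2 + (N3 - cs z3) \<cdot> y3 \<noteq> y \<Longrightarrow>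
      (z2, z3) \<in> bGamma"
  shows "N3\<^sup>\<dagger> * N3 = 1" "N2 = N2\<^sup>\<dagger> * N3"
proof -
  have fug: "N1 * N2\<^sup>\<dagger> = N2\<^sup>\<dagger> * N1" "N1 * N3\<^sup>\<dagger> = N3\<^sup>\<dagger> * N1" "N2 * N3\<^sup>\<dagger> = N3\<^sup>\<dagger> * N2"
    "N3 * N2\<^sup>\<dagger> = N2\<^sup>\<dagger> * N3" "N3 * N3\<^sup>\<dagger> = N3\<^sup>\<dagger> * N3" "N2 * N2\<^sup>\<dagger> = N2\<^sup>\<dagger> * N2"
    by (rule Fuglede; use nor com in \<open>simp add: normal_def\<close>)+
  have G: "(N3\<^sup>\<dagger> * N3 - 1) * N = N * (N3\<^sup>\<dagger> * N3 - 1)" if "N * N3 = N3 * N" "N * N3\<^sup>\<dagger> = N3\<^sup>\<dagger> * N" for N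
    using commute_mult_right[OF that(2,1)] by (simp add: right_diff_distrib left_diff_distrib)
  have "N3\<^sup>\<dagger> * N3 - 1 = 0"
  proof (rule zero_if_zero_on_joint_spectrum[OF nor com])
    fix z1 z2 z3
    assume "\<exists>y. \<forall>y1 y2 y3. (N1 - cs z1) \<cdot> y1 + (N2 - cs z2) \<cdot> y2 + (N3 - cs z3) \<cdot> y3 \<noteq> y"
    then have "(z2, z3) \<in> bGamma" by (rule H)
    then have "z3 * cnj z3 = 1" by (simp add: bGamma_def complex_norm_square[symmetric])
    then have 1: "norm ((N3\<^sup>\<dagger> * N3 - 1) \<cdot> x) \<le> (norm N3 + cmod z3) * norm ((N3 - cs z3) \<cdot> x)" for x
      using norm_star_mult_minus_le[OF nor(3), of z3 x] by (simp only: cs_one)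
    have "(norm N3 + cmod z3) * norm ((N3 - cs z3) \<cdot> x) \<le> (norm N3 + cmod z3) *
      (norm ((N1 - cs z1) \<cdot> x) + norm ((N2 - cs z2) \<cdot> x) + norm ((N3 - cs z3) \<cdot> x))" for x
      by (intro mult_left_mono) auto
    with 1 have "norm ((N3\<^sup>\<dagger> * N3 - 1) \<cdot> x) \<le> (norm N3 + cmod z3) *
      (norm ((N1 - cs z1) \<cdot> x) + norm ((N2 - cs z2) \<cdot> x) + norm ((N3 - cs z3) \<cdot> x))" for x
      by (rule order_trans)
    then show "\<exists>K. \<forall>x. norm ((N3\<^sup>\<dagger> * N3 - 1) \<cdot> x) \<le> K *
      (norm ((N1 - cs z1) \<cdot> x) + norm ((N2 - cs z2) \<cdot> x) + norm ((N3 - cs z3) \<cdot> x))" by blast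
  qed (intro G; use com fug in simp)+
  then show "N3\<^sup>\<dagger> * N3 = 1" by simp
  have G: "(N2 - N2\<^sup>\<dagger> * N3) * N = N * (N2 - N2\<^sup>\<dagger> * N3)"
    if "N * N3 = N3 * N" "N * N2 = N2 * N" "N * N2\<^sup>\<dagger> = N2\<^sup>\<dagger> * N" for N
    using commute_mult_right[OF that(3,1)] that(2) by (simp add: right_diff_distrib left_diff_distrib)
  have "N2 - N2\<^sup>\<dagger> * N3 = 0"
  proof (rule zero_if_zero_on_joint_spectrum[OF nor com])
    fix z1 z2 z3
    assume "\<exists>y. \<forall>y1 y2 y3. (N1 - cs z1) \<cdot> y1 + (N2 - cs z2) \<cdot> y2 + (N3 - cs z3) \<cdot> y3 \<noteq> y"
    then have "(z2, z3) \<in> bGamma" by (rule H)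
    then have "z2 = cnj z2 * z3" by (simp add: bGamma_def)
    then have 1: "norm ((N2 - N2\<^sup>\<dagger> * N3) \<cdot> x)
        \<le> (1 + norm N2 + cmod z3) * (norm ((N2 - cs z2) \<cdot> x) + norm ((N3 - cs z3) \<cdot> x))" for x
      using norm_minus_star_mult_le[OF nor(2), of N3 z2 z3 x] by (simp only: diff_self diff_zero cs_zero)
    have "(1 + norm N2 + cmod z3) * (norm ((N2 - cs z2) \<cdot> x) + norm ((N3 - cs z3) \<cdot> x)) \<le> (1 + norm N2 + cmod z3) *
      (norm ((N1 - cs z1) \<cdot> x) + norm ((N2 - cs z2) \<cdot> x) + norm ((N3 - cs z3) \<cdot> x))" for x
      by (intro mult_left_mono add_nonneg_nonneg) auto
    with 1 have "norm ((N2 - N2\<^sup>\<dagger> * N3) \<cdot> x) \<le> (1 + norm N2 + cmod z3) *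
      (norm ((N1 - cs z1) \<cdot> x) + norm ((N2 - cs z2) \<cdot> x) + norm ((N3 - cs z3) \<cdot> x))" for x
      by (rule order_trans)
    then show "\<exists>K. \<forall>x. norm ((N2 - N2\<^sup>\<dagger> * N3) \<cdot> x) \<le> K *
      (norm ((N1 - cs z1) \<cdot> x) + norm ((N2 - cs z2) \<cdot> x) + norm ((N3 - cs z3) \<cdot> x))" by blast
  qed (intro G; use com fug in simp)+
  then show "N2 = N2\<^sup>\<dagger> * N3" by simp
qed

lemma Penta_relation_from_spectrum:
  fixes N1 N2 N3 :: "'a::chilbert_space cop"
  assumes nor: "normal N1" "normal N2" "normal N3"
    and com: "N1 * N2 = N2 * N1" "N1 * N3 = N3 * N1" "N2 * N3 = N3 * N2"
    and H: "\<And>z1 z2 z3. \<exists>y. \<forall>y1 y2 y3. (N1 - cs z1) \<cdot> y1 + (N2 - cs z2) \<cdot> y2 + (N3 - cs z3) \<cdot> y3 \<noteq> y \<Longrightarrow>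
      (z1, z2, z3) \<in> bPenta"
  shows "N1\<^sup>\<dagger> * N1 = 1 - (1/4) *\<^sub>R (N2\<^sup>\<dagger> * N2)"
proof -
  have fug: "N1 * N2\<^sup>\<dagger> = N2\<^sup>\<dagger> * N1" "N1 * N1\<^sup>\<dagger> = N1\<^sup>\<dagger> * N1" "N3 * N1\<^sup>\<dagger> = N1\<^sup>\<dagger> * N3"
    "N3 * N2\<^sup>\<dagger> = N2\<^sup>\<dagger> * N3" "N2 * N1\<^sup>\<dagger> = N1\<^sup>\<dagger> * N2" "N2 * N2\<^sup>\<dagger> = N2\<^sup>\<dagger> * N2"
    by (rule Fuglede; use nor com in \<open>simp add: normal_def\<close>)+
  define G where "G = N1\<^sup>\<dagger> * N1 - 1 + (1/4) *\<^sub>R (N2\<^sup>\<dagger> * N2)"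
  have Gc: "G * N = N * G"
    if "N * N1 = N1 * N" "N * N2 = N2 * N" "N * N1\<^sup>\<dagger> = N1\<^sup>\<dagger> * N" "N * N2\<^sup>\<dagger> = N2\<^sup>\<dagger> * N" for N
    using commute_mult_right[OF that(3,1)] commute_mult_right[OF that(4,2)]
    by (simp add: G_def right_diff_distrib left_diff_distrib distrib_left distrib_right)
  have "G = 0"
  proof (rule zero_if_zero_on_joint_spectrum[OF nor com])
    fix z1 z2 z3
    assume "\<exists>y. \<forall>y1 y2 y3. (N1 - cs z1) \<cdot> y1 + (N2 - cs z2) \<cdot> y2 + (N3 - cs z3) \<cdot> y3 \<noteq> y"
    then have "(z1, z2, z3) \<in> bPenta" by (rule H)
    then have "(cmod z1)\<^sup>2 = 1 - (cmod z2)\<^sup>2 / 4" by (simp add: bPenta_def)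
    then have "cs (z1 * cnj z1) + (1/4) *\<^sub>R cs (z2 * cnj z2) = (1 :: 'a cop)"
      unfolding complex_norm_square[symmetric] cs_of_real by (simp flip: scaleR_add_left)
    \<comment> \<open>On \<open>bPenta\<close> the scalar terms cancel, which leaves two defects of
      the kind already estimated.\<close>
    then have "G = (N1\<^sup>\<dagger> * N1 - cs (z1 * cnj z1)) + (1/4) *\<^sub>R (N2\<^sup>\<dagger> * N2 - cs (z2 * cnj z2))"
      unfolding G_def by (simp add: algebra_simps)
    then have G_app: "G \<cdot> x = (N1\<^sup>\<dagger> * N1 - cs (z1 * cnj z1)) \<cdot> x + (1/4) *\<^sub>R ((N2\<^sup>\<dagger> * N2 - cs (z2 * cnj z2)) \<cdot> x)" for x
      by (simp only: app_ops(1,7))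
    have "norm (G \<cdot> x) \<le> (norm N1 + cmod z1 + norm N2 + cmod z2) *
      (norm ((N1 - cs z1) \<cdot> x) + norm ((N2 - cs z2) \<cdot> x) + norm ((N3 - cs z3) \<cdot> x))" for x
    proof -
      define u v where "u = (N1\<^sup>\<dagger> * N1 - cs (z1 * cnj z1)) \<cdot> x" and "v = (N2\<^sup>\<dagger> * N2 - cs (z2 * cnj z2)) \<cdot> x"
      have "norm (G \<cdot> x) \<le> norm u + norm v"
        using norm_triangle_ineq[of u "(1/4) *\<^sub>R v"] norm_ge_zero[of v]
        unfolding G_app u_def[symmetric] v_def[symmetric] norm_scaleR by linarith
      also have "\<dots> \<le> (norm N1 + cmod z1) * norm ((N1 - cs z1) \<cdot> x) + (norm N2 + cmod z2) * norm ((N2 - cs z2) \<cdot> x)"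
        unfolding u_def v_def by (intro add_mono norm_star_mult_minus_le nor)
      also have "\<dots> \<le> (norm N1 + cmod z1 + norm N2 + cmod z2) *
        (norm ((N1 - cs z1) \<cdot> x) + norm ((N2 - cs z2) \<cdot> x) + norm ((N3 - cs z3) \<cdot> x))"
        unfolding distrib_left distrib_right by simp
      finally show ?thesis .
    qed
    then show "\<exists>K. \<forall>x. norm (G \<cdot> x) \<le> K *
      (norm ((N1 - cs z1) \<cdot> x) + norm ((N2 - cs z2) \<cdot> x) + norm ((N3 - cs z3) \<cdot> x))" by blast
  qed (intro Gc; use com fug in simp)+
  then show ?thesis by (simp add: G_def algebra_simps)
qed

section \<open>The Taylor spectrum from relations between normal operators\<close>

text \<open>The sum \<open>E\<close> of the \<open>N\<^sub>i\<^sup>\<dagger> * N\<^sub>i\<close> is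
  bounded below, and with its inverse \<open>F\<close> the coefficients are
  \<open>F * N\<^sub>i\<^sup>\<dagger>\<close>. By Fuglede's theorem they commute with everything
  that commutes with the triple; exactness of the Koszul complex is derived from this together with
  the identity.\<close>

lemma Bezout_of_bounded_below:
  fixes N1 N2 N3 :: "'a::chilbert_space cop"
  assumes nor: "normal N1" "normal N2" "normal N3"
    and com: "N1 * N2 = N2 * N1" "N1 * N3 = N3 * N1" "N2 * N3 = N3 * N2"
    and K: "\<And>x. norm x \<le> K * (norm (N1 \<cdot> x) + norm (N2 \<cdot> x) + norm (N3 \<cdot> x))"
  shows "\<exists>B1 B2 B3. B1 * N1 + B2 * N2 + B3 * N3 = 1 \<and>
    (\<forall>M. M * N1 = N1 * M \<longrightarrow> M * N2 = N2 * M \<longrightarrow> M * N3 = N3 * M \<longrightarrow>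
      M * B1 = B1 * M \<and> M * B2 = B2 * M \<and> M * B3 = B3 * M)"
proof -
  define E where "E = N1\<^sup>\<dagger> * N1 + N2\<^sup>\<dagger> * N2 + N3\<^sup>\<dagger> * N3"
  have "pos E" unfolding E_def by (intro pos_add pos_star_mult)
  \<comment> \<open>The 3 comes from \<open>(a + b + c)\<^sup>2 \<le> 3 * (a\<^sup>2 + b\<^sup>2 +
    c\<^sup>2)\<close>; the 1 keeps the denominator positive when \<open>K = 0\<close>.\<close>
  define e where "e = 1 / (3 * K\<^sup>2 + 1)"
  have K3: "3 * K\<^sup>2 + 1 > 0" by (simp add: add_nonneg_pos)
  have "e > 0" using K3 by (simp add: e_def)
  moreover have "e * (norm x)\<^sup>2 \<le> Re (cinner x (E \<cdot> x))" for x
  proof -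
    define a b c where "a = norm (N1 \<cdot> x)" and "b = norm (N2 \<cdot> x)" and "c = norm (N3 \<cdot> x)"
    define P where "P = a\<^sup>2 + b\<^sup>2 + c\<^sup>2"
    have E: "Re (cinner x (E \<cdot> x)) = P"
      by (simp add: E_def P_def a_def b_def c_def cinner_linear norm_app_sq)
    have "(a + b + c)\<^sup>2 \<le> 3 * P"
      using zero_le_power2[of "a - b"] zero_le_power2[of "a - c"] zero_le_power2[of "b - c"]
      by (simp add: P_def power2_eq_square algebra_simps)
    then have "K\<^sup>2 * (a + b + c)\<^sup>2 \<le> K\<^sup>2 * (3 * P)" by (rule mult_left_mono) simp
    moreover have "(norm x)\<^sup>2 \<le> (K * (a + b + c))\<^sup>2"
      using K[of x] unfolding a_def b_def c_def by (intro power_mono) auto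
    moreover have "0 \<le> P" by (simp add: P_def)
    ultimately have "(norm x)\<^sup>2 \<le> (3 * K\<^sup>2 + 1) * P"
      unfolding power_mult_distrib distrib_right by simp
    then show ?thesis using K3 by (simp add: E e_def field_simps)
  qed
  ultimately obtain F where F: "F * E = 1" "\<And>S. S * E = E * S \<Longrightarrow> S * F = F * S"
    using pos_bounded_below_inverse[OF \<open>pos E\<close>] by blast
  have "M * (F * N1\<^sup>\<dagger>) = F * N1\<^sup>\<dagger> * M \<and> M * (F * N2\<^sup>\<dagger>) = F * N2\<^sup>\<dagger> * M \<and> M * (F * N3\<^sup>\<dagger>) = F * N3\<^sup>\<dagger> * M"
    if M: "M * N1 = N1 * M" "M * N2 = N2 * M" "M * N3 = N3 * M" for M
  proof -
    have Ms: "M * N1\<^sup>\<dagger> = N1\<^sup>\<dagger> * M" "M * N2\<^sup>\<dagger> = N2\<^sup>\<dagger> * M" "M * N3\<^sup>\<dagger> = N3\<^sup>\<dagger> * M"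
      by (rule Fuglede; use nor M in \<open>simp add: normal_def\<close>)+
    have "M * E = E * M"
      using commute_mult_right[OF Ms(1) M(1)] commute_mult_right[OF Ms(2) M(2)]
        commute_mult_right[OF Ms(3) M(3)] by (simp add: E_def distrib_left distrib_right)
    then have "M * F = F * M" by (rule F(2))
    with Ms show ?thesis by (intro conjI commute_mult_right)
  qed
  moreover have "F * N1\<^sup>\<dagger> * N1 + F * N2\<^sup>\<dagger> * N2 + F * N3\<^sup>\<dagger> * N3 = 1"
    using F(1) by (simp add: E_def distrib_left mult.assoc)
  ultimately show ?thesis by blast
qed

lemma app_commute: "S * T = T * S \<Longrightarrow> S \<cdot> T \<cdot> x = T \<cdot> S \<cdot> x"
  by (metis app_ops(5))

text \<open>The coefficients \<open>a\<close>, \<open>b\<close>, \<open>c\<close> define a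
  contracting homotopy of the Koszul complex; the preimages given in the proof are its
  components.\<close>

lemma koszul_exact3_of_Bezout:
  fixes A B C a b c :: "'a::chilbert_space cop"
  assumes com: "A * B = B * A" "A * C = C * A" "B * C = C * B"
    and coA: "A * a = a * A" "A * b = b * A" "A * c = c * A"
    and coB: "B * a = a * B" "B * b = b * B" "B * c = c * B"
    and coC: "C * a = a * C" "C * b = b * C" "C * c = c * C"
    and one: "a * A + b * B + c * C = 1"
  shows "koszul_exact3 (app A) (app B) (app C)"
proof -
  note sw = com[THEN app_commute] coA[THEN app_commute] coB[THEN app_commute] coC[THEN app_commute]
  have 1: "a \<cdot> A \<cdot> x + b \<cdot> B \<cdot> x + c \<cdot> C \<cdot> x = x" for x
    using arg_cong[OF one, of "\<lambda>T. T \<cdot> x"] by simp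
  define d1 where "d1 = (\<lambda>x. (A \<cdot> x, B \<cdot> x, C \<cdot> x))"
  define d2 where "d2 = (\<lambda>(x1, x2, x3). (B \<cdot> x1 - A \<cdot> x2, C \<cdot> x1 - A \<cdot> x3, C \<cdot> x2 - B \<cdot> x3))"
  define d3 where "d3 = (\<lambda>(y1, y2, y3). C \<cdot> y1 - B \<cdot> y2 + A \<cdot> y3)"
  have "inj d1"
    by (rule injI) (metis 1 d1_def prod.inject)
  moreover have "range d1 = {y. d2 y = 0}"
  proof (intro set_eqI iffI)
    fix y assume "y \<in> {y. d2 y = 0}"
    then obtain x1 x2 x3 where y: "y = (x1, x2, x3)" and
      eq: "B \<cdot> x1 = A \<cdot> x2" "C \<cdot> x1 = A \<cdot> x3" "C \<cdot> x2 = B \<cdot> x3"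
      by (cases y) (auto simp: d2_def zero_prod_def)
    have "d1 (a \<cdot> x1 + b \<cdot> x2 + c \<cdot> x3) = y"
      using 1[of x1] 1[of x2] 1[of x3] by (simp add: d1_def y app_linear sw eq)
    then show "y \<in> range d1" by blast
  qed (auto simp: d1_def d2_def sw zero_prod_def)
  moreover have "range d2 = {y. d3 y = 0}"
  proof (intro set_eqI iffI)
    fix y assume "y \<in> {y. d3 y = 0}"
    then obtain y1 y2 y3 where y: "y = (y1, y2, y3)" and eq: "C \<cdot> y1 - B \<cdot> y2 + A \<cdot> y3 = 0"
      by (cases y) (auto simp: d3_def)
    have eqs: "f \<cdot> B \<cdot> y2 = f \<cdot> C \<cdot> y1 + f \<cdot> A \<cdot> y3" for f :: "'a cop"
    proof -
      have "B \<cdot> y2 = C \<cdot> y1 + A \<cdot> y3" using eq by (simp add: algebra_simps)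
      then show ?thesis by (simp add: app_linear)
    qed
    have "d2 (b \<cdot> y1 + c \<cdot> y2, c \<cdot> y3 - a \<cdot> y1, - (a \<cdot> y2) - b \<cdot> y3) = y"
      using 1[of y1] 1[of y2] 1[of y3] eqs[of a] eqs[of b] eqs[of c]
      by (simp add: d2_def y app_linear sw algebra_simps)
    then show "y \<in> range d2" by blast
  qed (auto simp: d2_def d3_def app_linear sw)
  moreover have "surj d3"
  proof (rule surjI)
    show "d3 (c \<cdot> y, - (b \<cdot> y), a \<cdot> y) = y" for y
      using 1[of y] by (simp add: d3_def app_linear sw algebra_simps)
  qed
  ultimately show ?thesis
    unfolding koszul_exact3_def Let_def d1_def d2_def d3_def by blast
qed

lemma koszul_exact2_of_Bezout:
  fixes A B a b :: "'a::chilbert_space cop"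
  assumes com: "A * B = B * A"
    and coA: "A * a = a * A" "A * b = b * A" and coB: "B * a = a * B" "B * b = b * B"
    and one: "a * A + b * B = 1"
  shows "koszul_exact2 (app A) (app B)"
proof -
  note sw = com[THEN app_commute] coA[THEN app_commute] coB[THEN app_commute]
  have 1: "a \<cdot> A \<cdot> x + b \<cdot> B \<cdot> x = x" for x
    using arg_cong[OF one, of "\<lambda>T. T \<cdot> x"] by simp
  define d1 where "d1 = (\<lambda>x. (A \<cdot> x, B \<cdot> x))"
  define d2 where "d2 = (\<lambda>(x1, x2). B \<cdot> x1 - A \<cdot> x2)"
  have "inj d1"
    by (rule injI) (metis 1 d1_def prod.inject)
  moreover have "range d1 = {y. d2 y = 0}"
  proof (intro set_eqI iffI)
    fix y assume "y \<in> {y. d2 y = 0}"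
    then obtain x1 x2 where y: "y = (x1, x2)" and eq: "B \<cdot> x1 = A \<cdot> x2"
      by (cases y) (auto simp: d2_def)
    have "d1 (a \<cdot> x1 + b \<cdot> x2) = y"
      using 1[of x1] 1[of x2] by (simp add: d1_def y app_linear sw eq)
    then show "y \<in> range d1" by blast
  qed (auto simp: d1_def d2_def sw)
  moreover have "surj d2"
  proof (rule surjI)
    show "d2 (b \<cdot> y, - (a \<cdot> y)) = y" for y
      using 1[of y] by (simp add: d2_def app_linear sw algebra_simps)
  qed
  ultimately show ?thesis
    unfolding koszul_exact2_def Let_def d1_def d2_def by blast
qed

text \<open>The diagonal matrix with entries \<open>a\<close> and \<open>b\<close> has norm 1, not
  less, so the point is only reached in the closure, through the multiples of this matrix by
  \<open>n / (n + 1)\<close>.\<close>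

lemma diagonal_in_Gamma:
  assumes "cmod a = 1" "cmod b = 1"
  shows "(a + b, a * b) \<in> Gamma"
proof -
  define S where "S = {(A$1$1 + A$2$2, A$1$1 * A$2$2 - A$1$2 * A$2$1) | A :: complex^2^2. mat_norm2 A < 1}"
  define r where "r n = real n / real (Suc n)" for n
  have r: "0 \<le> r n" "r n < 1" for n by (simp_all add: r_def)
  have "(of_real (r n) * (a + b), (of_real (r n))\<^sup>2 * (a * b)) \<in> S" for n
  proof -
    define v :: "complex^2" where "v = (\<chi> i. of_real (r n) * (if i = 1 then a else b))"
    define A :: "complex^2^2" where "A = (\<chi> i j. if i = j then v $ i else 0)"
    have "A *v x = (\<chi> i. v $ i * x $ i)" for x
      by (simp add: vec_eq_iff A_def matrix_vector_mult_def if_distrib[of "\<lambda>c. c * _"] cong: if_cong)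
    moreover have "cmod (v $ i) = r n" for i
      using assms r by (simp add: v_def norm_mult)
    ultimately have "norm (A *v x) = r n * norm x" for x
      unfolding norm_vec_def using r by (simp add: norm_mult L2_set_right_distrib)
    then have "mat_norm2 A \<le> r n"
      unfolding mat_norm2_def using r by (intro onorm_bound) auto
    then have "mat_norm2 A < 1" using r[of n] by linarith
    then have "(A$1$1 + A$2$2, A$1$1 * A$2$2 - A$1$2 * A$2$1) \<in> S" unfolding S_def by blast
    moreover have "A$1$1 = of_real (r n) * a" "A$2$2 = of_real (r n) * b" "A$1$2 = 0" "A$2$1 = 0"
      by (simp_all add: A_def v_def)
    ultimately show ?thesis by (simp add: power2_eq_square algebra_simps)
  qed
  moreover have "(\<lambda>n. (of_real (r n) * (a + b), (of_real (r n))\<^sup>2 * (a * b))) \<longlonglongrightarrow> (of_real 1 * (a + b), (of_real 1)\<^sup>2 * (a * b))"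
    unfolding r_def by (intro tendsto_intros LIMSEQ_n_over_Suc_n)
  ultimately show ?thesis
    unfolding Gamma_def S_def[symmetric] closure_sequential by (auto intro!: exI)
qed

text \<open>The inequality \<open>cmod s \<le> 2\<close> replaces membership in
  \<open>Gamma\<close>. If \<open>w\<^sup>2 = p\<close>, the first equation makes
  \<open>k = s * cnj w\<close> real; then \<open>s\<close> and \<open>p\<close> are the sum and the
  product of the unimodular numbers \<open>w * l\<close> and \<open>w * cnj l\<close>, where
  \<open>2 * Re l = k\<close>.\<close>

lemma mem_bGamma:
  assumes s: "s = cnj s * p" and p: "cmod p = 1" and le: "cmod s \<le> 2"
  shows "(s, p) \<in> bGamma"
proof -
  define w where "w = csqrt p"
  have w: "w * w = p" "cmod w = 1" using p by (simp_all add: w_def flip: power2_eq_square)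
  have ww: "w * cnj w = 1" using w by (simp add: complex_norm_square[symmetric])
  define k where "k = Re (s * cnj w)"
  have "s * cnj w = cnj s * w * (w * cnj w)" using s w by (metis mult.assoc)
  then have "cnj (s * cnj w) = s * cnj w" by (simp add: ww)
  then have k: "s * cnj w = of_real k" unfolding k_def by (simp only: Reals_cnj_iff[symmetric] of_real_Re)
  have "\<bar>k\<bar> = cmod s" using arg_cong[OF k, of cmod] w by (simp add: norm_mult)
  then have "k\<^sup>2 \<le> 2\<^sup>2" using le by (intro abs_le_square_iff[THEN iffD1]) simp
  then have h: "(sqrt (1 - k\<^sup>2 / 4))\<^sup>2 = 1 - k\<^sup>2 / 4" by simp
  define l where "l = Complex (k / 2) (sqrt (1 - k\<^sup>2 / 4))"
  have l1: "cmod l = 1" by (simp add: l_def cmod_def h power_divide)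
  have ll: "l + cnj l = of_real k" by (simp add: l_def complex_eq_iff)
  have "w * l * (w * cnj l) = w * w * (l * cnj l)" by (simp add: ac_simps)
  also have "\<dots> = p" using l1 by (simp add: w complex_norm_square[symmetric])
  finally have "w * l * (w * cnj l) = p" .
  moreover have "w * l + w * cnj l = s"
  proof -
    have "w * l + w * cnj l = w * (s * cnj w)" unfolding k ll[symmetric] by (rule distrib_left[symmetric])
    also have "\<dots> = s * (w * cnj w)" by (simp add: ac_simps)
    finally have "w * l + w * cnj l = s * (w * cnj w)" .
    then show ?thesis by (simp add: ww)
  qed
  ultimately have "(s, p) \<in> Gamma"
    using diagonal_in_Gamma[of "w * l" "w * cnj l"] l1 w by (simp add: norm_mult)
  then show ?thesis using s p by (simp add: bGamma_def)
qed

text \<open>A point outside violates one of three conditions. For the two equations, the operator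
  relation turns the left side of the matching estimate into a nonzero scalar multiple of
  \<open>x\<close>; for \<open>cmod z2 > 2\<close> the triangle inequality and
  \<open>norm N2 \<le> 2\<close> suffice.\<close>

lemma bounded_below_outside_bGamma:
  fixes N2 N3 :: "'a::chilbert_space cop"
  assumes nor: "normal N2" "normal N3"
    and rel: "N3\<^sup>\<dagger> * N3 = 1" "N2 = N2\<^sup>\<dagger> * N3" "norm N2 \<le> 2"
    and z: "(z2, z3) \<notin> bGamma"
  shows "\<exists>K. \<forall>x. norm x \<le> K * (norm ((N2 - cs z2) \<cdot> x) + norm ((N3 - cs z3) \<cdot> x))"
proof -
  have divide: "\<exists>K. \<forall>x. norm x \<le> K * f x"
    if "\<And>x. d * norm x \<le> L * f x" "d > 0" for f :: "'a \<Rightarrow> real" and d L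
    using that by (intro exI[of _ "L / d"]) (simp add: pos_le_divide_eq mult.commute)
  consider "cmod z3 \<noteq> 1" | "z2 \<noteq> cnj z2 * z3" | "cmod z2 > 2"
    using mem_bGamma[of z2 z3] z by fastforce
  then show ?thesis
  proof cases
    case 1
    have "cmod (1 - z3 * cnj z3) * norm x \<le> (norm N3 + cmod z3) * (norm ((N2 - cs z2) \<cdot> x) + norm ((N3 - cs z3) \<cdot> x))" for x
    proof -
      have "(N3\<^sup>\<dagger> * N3 - cs (z3 * cnj z3)) \<cdot> x = cscale (1 - z3 * cnj z3) x"
        unfolding rel by (simp add: cscale_diff_left cscale_one)
      then have "cmod (1 - z3 * cnj z3) * norm x \<le> (norm N3 + cmod z3) * norm ((N3 - cs z3) \<cdot> x)"
        using norm_star_mult_minus_le[OF nor(2), of z3 x] by (simp only: norm_cscale)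
      also have "\<dots> \<le> (norm N3 + cmod z3) * (norm ((N2 - cs z2) \<cdot> x) + norm ((N3 - cs z3) \<cdot> x))"
        by (intro mult_left_mono) auto
      finally show ?thesis .
    qed
    moreover have "1 - z3 * cnj z3 \<noteq> 0"
    proof
      assume "1 - z3 * cnj z3 = 0"
      then have "complex_of_real ((cmod z3)\<^sup>2) = of_real 1" by (simp add: complex_norm_square del: of_real_power)
      then show False using 1 norm_ge_zero[of z3] unfolding of_real_eq_iff power2_eq_1_iff by linarith
    qed
    ultimately show ?thesis by (intro divide) auto
  next
    case 2
    have "cmod (z2 - cnj z2 * z3) * norm x \<le>
      (1 + norm N2 + cmod z3) * (norm ((N2 - cs z2) \<cdot> x) + norm ((N3 - cs z3) \<cdot> x))" for x
    proof -
      have "(N2 - N2\<^sup>\<dagger> * N3 - cs (z2 - cnj z2 * z3)) \<cdot> x = - cscale (z2 - cnj z2 * z3) x"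
        using rel(2) by simp
      then show ?thesis
        using norm_minus_star_mult_le[OF nor(1), of N3 z2 z3 x] by (simp only: norm_minus_cancel norm_cscale)
    qed
    then show ?thesis using 2 by (intro divide) auto
  next
    case 3
    have le: "(cmod z2 - 2) * norm x \<le> 1 * (norm ((N2 - cs z2) \<cdot> x) + norm ((N3 - cs z3) \<cdot> x))" for x
    proof -
      have "norm (N2 \<cdot> x) \<le> 2 * norm x"
        using norm_app_le[of N2 x] mult_right_mono[OF rel(3), of "norm x"] by simp
      moreover have "cmod z2 * norm x \<le> norm ((N2 - cs z2) \<cdot> x) + norm (N2 \<cdot> x)"
        using norm_triangle_sub[of "cscale z2 x" "N2 \<cdot> x"] by (simp add: norm_cscale norm_minus_commute)
      ultimately show ?thesis
        using norm_ge_zero[of "(N3 - cs z3) \<cdot> x"] unfolding left_diff_distrib mult_1 by linarith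
    qed
    show ?thesis by (rule divide[OF le]) (use 3 in simp)
  qed
qed

lemma bounded_below_outside_bPenta:
  fixes N1 N2 N3 :: "'a::chilbert_space cop"
  assumes nor: "normal N1" "normal N2" "normal N3"
    and rel: "N3\<^sup>\<dagger> * N3 = 1" "N2 = N2\<^sup>\<dagger> * N3" "norm N2 \<le> 2" "N1\<^sup>\<dagger> * N1 = 1 - (1/4) *\<^sub>R (N2\<^sup>\<dagger> * N2)"
    and z: "(z1, z2, z3) \<notin> bPenta"
  shows "\<exists>K. \<forall>x. norm x \<le> K * (norm ((N1 - cs z1) \<cdot> x) + norm ((N2 - cs z2) \<cdot> x) + norm ((N3 - cs z3) \<cdot> x))"
proof (cases "(z2, z3) \<in> bGamma")
  case False
  obtain K where K: "\<And>x. norm x \<le> K * (norm ((N2 - cs z2) \<cdot> x) + norm ((N3 - cs z3) \<cdot> x))"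
    using bounded_below_outside_bGamma[OF nor(2,3) rel(1-3) False] by blast
  have "norm x \<le> \<bar>K\<bar> * (norm ((N1 - cs z1) \<cdot> x) + norm ((N2 - cs z2) \<cdot> x) + norm ((N3 - cs z3) \<cdot> x))" for x
    by (rule order_trans[OF K mult_mono]) auto
  then show ?thesis by blast
next
  case True
  define d where "d = 1 - (cmod z2)\<^sup>2 / 4 - (cmod z1)\<^sup>2"
  have d: "d \<noteq> 0" using True z by (auto simp: bPenta_def d_def)
  define L where "L = norm N1 + cmod z1 + norm N2 + cmod z2"
  have "\<bar>d\<bar> * norm x \<le> L * (norm ((N1 - cs z1) \<cdot> x) + norm ((N2 - cs z2) \<cdot> x) + norm ((N3 - cs z3) \<cdot> x))" for x
  proof -
    define u v where "u = (N1\<^sup>\<dagger> * N1 - cs (z1 * cnj z1)) \<cdot> x" and "v = (N2\<^sup>\<dagger> * N2 - cs (z2 * cnj z2)) \<cdot> x"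
    have "u = x - (1/4) *\<^sub>R ((N2\<^sup>\<dagger> * N2) \<cdot> x) - (cmod z1)\<^sup>2 *\<^sub>R x"
      unfolding u_def rel(4) complex_norm_square[symmetric] cs_of_real by simp
    moreover have "v = (N2\<^sup>\<dagger> * N2) \<cdot> x - (cmod z2)\<^sup>2 *\<^sub>R x"
      unfolding v_def complex_norm_square[symmetric] cs_of_real by simp
    \<comment> \<open>Inserting the operator relation cancels
      \<open>N2\<^sup>\<dagger> * N2\<close>, so only the scalar defect \<open>d\<close> is
      left.\<close>
    ultimately have "d *\<^sub>R x = u + (1/4) *\<^sub>R v"
      by (simp add: d_def scaleR_diff_left scaleR_diff_right)
    then have "\<bar>d\<bar> * norm x = norm (u + (1/4) *\<^sub>R v)" by (metis norm_scaleR)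
    also have "\<dots> \<le> norm u + norm v"
      using norm_triangle_ineq[of u "(1/4) *\<^sub>R v"] norm_ge_zero[of v] unfolding norm_scaleR by linarith
    also have "\<dots> \<le> (norm N1 + cmod z1) * norm ((N1 - cs z1) \<cdot> x) + (norm N2 + cmod z2) * norm ((N2 - cs z2) \<cdot> x)"
      unfolding u_def v_def by (intro add_mono norm_star_mult_minus_le nor)
    also have "\<dots> \<le> L * (norm ((N1 - cs z1) \<cdot> x) + norm ((N2 - cs z2) \<cdot> x) + norm ((N3 - cs z3) \<cdot> x))"
      unfolding L_def distrib_left distrib_right by simp
    finally show ?thesis .
  qed
  then show ?thesis using d by (intro exI[of _ "L / \<bar>d\<bar>"]) (simp add: pos_le_divide_eq mult.commute)
qed

section \<open>Unitary pairs and triples in terms of relations\<close>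

lemma bounded_opE:
  assumes "bounded_op f"
  obtains T where "f = app T"
  using assms app_Cop by (metis ext)

lemma normal_op_app: "normal_op (app T) \<longleftrightarrow> normal T"
proof -
  have "normal_op (app T) \<longleftrightarrow> app (T * T\<^sup>\<dagger>) = app (T\<^sup>\<dagger> * T)"
    by (simp add: normal_op_def fun_eq_iff star.rep_eq)
  then show ?thesis by (simp add: normal_def app_inject)
qed

lemma commute_app: "commute (app S) (app T) \<longleftrightarrow> S * T = T * S"
proof -
  have "commute (app S) (app T) \<longleftrightarrow> app (S * T) = app (T * S)"
    by (simp add: commute_def fun_eq_iff)
  then show ?thesis by (simp add: app_inject)
qed

lemma taylor_spectrum3_app:
  "(z1, z2, z3) \<in> taylor_spectrum3 (app N1) (app N2) (app N3) \<longleftrightarrow>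
    \<not> koszul_exact3 (app (N1 - cs z1)) (app (N2 - cs z2)) (app (N3 - cs z3))"
  and taylor_spectrum2_app:
  "(z1, z2) \<in> taylor_spectrum2 (app N1) (app N2) \<longleftrightarrow>
    \<not> koszul_exact2 (app (N1 - cs z1)) (app (N2 - cs z2))"
proof -
  have eq: "(\<lambda>x. N \<cdot> x - cscale z x) = app (N - cs z)" for N :: "'a cop" and z
    by (simp add: fun_eq_iff)
  show "(z1, z2, z3) \<in> taylor_spectrum3 (app N1) (app N2) (app N3) \<longleftrightarrow>
    \<not> koszul_exact3 (app (N1 - cs z1)) (app (N2 - cs z2)) (app (N3 - cs z3))"
    "(z1, z2) \<in> taylor_spectrum2 (app N1) (app N2) \<longleftrightarrow>
    \<not> koszul_exact2 (app (N1 - cs z1)) (app (N2 - cs z2))"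
    by (simp_all add: taylor_spectrum3_def taylor_spectrum2_def eq)
qed

lemma Penta_unitaryI:
  assumes nor: "normal N1" "normal N2" "normal N3"
    and com: "N1 * N2 = N2 * N1" "N1 * N3 = N3 * N1" "N2 * N3 = N3 * N2"
    and rel: "N3\<^sup>\<dagger> * N3 = 1" "N2 = N2\<^sup>\<dagger> * N3" "norm N2 \<le> 2" "N1\<^sup>\<dagger> * N1 = 1 - (1/4) *\<^sub>R (N2\<^sup>\<dagger> * N2)"
  shows "Penta_unitary (app N1) (app N2) (app N3)"
proof -
  have "koszul_exact3 (app (N1 - cs z1)) (app (N2 - cs z2)) (app (N3 - cs z3))"
    if z: "(z1, z2, z3) \<notin> bPenta" for z1 z2 z3
  proof -
    define A B C where "A = N1 - cs z1" and "B = N2 - cs z2" and "C = N3 - cs z3"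
    have co: "A * B = B * A" "A * C = C * A" "B * C = C * B"
      using com by (simp_all add: A_def B_def C_def right_diff_distrib left_diff_distrib
          cs_comm[of N1] cs_comm[of N2] cs_comm[of N3] mult.commute flip: cs_mult)
    have no: "normal A" "normal B" "normal C"
      using nor by (simp_all add: A_def B_def C_def normal_minus_cs)
    obtain K where "\<And>x. norm x \<le> K * (norm (A \<cdot> x) + norm (B \<cdot> x) + norm (C \<cdot> x))"
      using bounded_below_outside_bPenta[OF nor rel z] unfolding A_def B_def C_def by blast
    from Bezout_of_bounded_below[OF no co this] obtain a b c where
      one: "a * A + b * B + c * C = 1" and
      cc: "\<And>M. M * A = A * M \<Longrightarrow> M * B = B * M \<Longrightarrow> M * C = C * M \<Longrightarrow> M * a = a * M \<and> M * b = b * M \<and> M * c = c * M"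
      by blast
    have "koszul_exact3 (app A) (app B) (app C)"
      by (rule koszul_exact3_of_Bezout[OF co]; use cc[of A] cc[of B] cc[of C] co one in simp)
    then show ?thesis by (simp add: A_def B_def C_def)
  qed
  then have "taylor_spectrum3 (app N1) (app N2) (app N3) \<subseteq> bPenta"
    using taylor_spectrum3_app by (metis prod_cases3 subsetI)
  then show ?thesis using nor com by (simp add: Penta_unitary_def normal_op_app commute_app)
qed

lemma Gamma_unitaryI:
  fixes N2 N3 :: "'a::chilbert_space cop"
  assumes nor: "normal N2" "normal N3" and com: "N2 * N3 = N3 * N2"
    and rel: "N3\<^sup>\<dagger> * N3 = 1" "N2 = N2\<^sup>\<dagger> * N3" "norm N2 \<le> 2"
  shows "Gamma_unitary (app N2) (app N3)"
proof -
  have "koszul_exact2 (app (N2 - cs z2)) (app (N3 - cs z3))" if z: "(z2, z3) \<notin> bGamma" for z2 z3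
  proof -
    define B C where "B = N2 - cs z2" and "C = N3 - cs z3"
    have co: "B * C = C * B"
      using com by (simp add: B_def C_def right_diff_distrib left_diff_distrib
          cs_comm[of N2] cs_comm[of N3] mult.commute flip: cs_mult)
    have no: "normal B" "normal C" "normal (0 :: 'a cop)"
      using nor by (simp_all add: B_def C_def normal_minus_cs) (simp add: normal_def)
    obtain K where "\<And>x. norm x \<le> K * (norm (0 \<cdot> x) + norm (B \<cdot> x) + norm (C \<cdot> x))"
      using bounded_below_outside_bGamma[OF nor rel z] unfolding B_def C_def by auto
    \<comment> \<open>The pair is padded with the zero operator, whose coefficient drops out of the
      identity.\<close>
    from Bezout_of_bounded_below[OF no(3,1,2) _ _ co this] obtain a b c where
      one: "a * 0 + b * B + c * C = 1" and
      cc: "\<And>M. M * B = B * M \<Longrightarrow> M * C = C * M \<Longrightarrow> M * b = b * M \<and> M * c = c * M"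
      by auto
    have "koszul_exact2 (app B) (app C)"
      by (rule koszul_exact2_of_Bezout[OF co]; use cc[of B] cc[of C] co one in simp)
    then show ?thesis by (simp add: B_def C_def)
  qed
  then have "taylor_spectrum2 (app N2) (app N3) \<subseteq> bGamma"
    using taylor_spectrum2_app by (metis surj_pair subsetI)
  then show ?thesis using nor com by (simp add: Gamma_unitary_def normal_op_app commute_app)
qed

text \<open>The pair is preceded by the zero operator. If the resulting row map is not surjective,
  neither is the last Koszul map of the pair, so the point lies in the Taylor spectrum.\<close>

lemma Gamma_unitary_relations:
  fixes N2 N3 :: "'a::chilbert_space cop"
  assumes "Gamma_unitary (app N2) (app N3)"
  shows "N3\<^sup>\<dagger> * N3 = 1" "N2 = N2\<^sup>\<dagger> * N3"
proof -
  have nor: "normal N2" "normal N3" and com: "N2 * N3 = N3 * N2"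
    and sp: "taylor_spectrum2 (app N2) (app N3) \<subseteq> bGamma"
    using assms by (auto simp: Gamma_unitary_def normal_op_app commute_app)
  have n0: "normal (0 :: 'a cop)" by (simp add: normal_def)
  have H: "(z2, z3) \<in> bGamma"
    if ex: "\<exists>y. \<forall>y1 y2 y3. (0 - cs z1) \<cdot> y1 + (N2 - cs z2) \<cdot> y2 + (N3 - cs z3) \<cdot> y3 \<noteq> y" for z1 z2 z3
  proof -
    obtain y where y: "\<And>y1 y2 y3. (0 - cs z1) \<cdot> y1 + (N2 - cs z2) \<cdot> y2 + (N3 - cs z3) \<cdot> y3 \<noteq> y"
      using ex by blast
    have "\<not> koszul_exact2 (app (N2 - cs z2)) (app (N3 - cs z3))"
    proof
      assume "koszul_exact2 (app (N2 - cs z2)) (app (N3 - cs z3))"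
      then have "surj (\<lambda>(x1, x2). (N3 - cs z3) \<cdot> x1 - (N2 - cs z2) \<cdot> x2)"
        by (simp only: koszul_exact2_def Let_def)
      then obtain x1 x2 where "y = (N3 - cs z3) \<cdot> x1 - (N2 - cs z2) \<cdot> x2"
        by (auto simp only: split_beta dest!: surjD[where y = y])
      then have "(0 - cs z1) \<cdot> 0 + (N2 - cs z2) \<cdot> (- x2) + (N3 - cs z3) \<cdot> x1 = y"
        by (simp only: app_minus_right app_zero_right) simp
      then show False using y by blast
    qed
    then show ?thesis using sp taylor_spectrum2_app by blast
  qed
  show "N3\<^sup>\<dagger> * N3 = 1" "N2 = N2\<^sup>\<dagger> * N3"
    using Gamma_relations_from_spectrum[OF n0 nor _ _ com H] by simp_all
qed

lemma Penta_unitary_relations: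
  fixes N1 N2 N3 :: "'a::chilbert_space cop"
  assumes "Penta_unitary (app N1) (app N2) (app N3)"
  shows "N3\<^sup>\<dagger> * N3 = 1" "N2 = N2\<^sup>\<dagger> * N3" "N1\<^sup>\<dagger> * N1 = 1 - (1/4) *\<^sub>R (N2\<^sup>\<dagger> * N2)"
proof -
  have nor: "normal N1" "normal N2" "normal N3"
    and com: "N1 * N2 = N2 * N1" "N1 * N3 = N3 * N1" "N2 * N3 = N3 * N2"
    and sp: "taylor_spectrum3 (app N1) (app N2) (app N3) \<subseteq> bPenta"
    using assms by (auto simp: Penta_unitary_def normal_op_app commute_app)
  have H: "(z1, z2, z3) \<in> bPenta"
    if ex: "\<exists>y. \<forall>y1 y2 y3. (N1 - cs z1) \<cdot> y1 + (N2 - cs z2) \<cdot> y2 + (N3 - cs z3) \<cdot> y3 \<noteq> y" for z1 z2 z3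
  proof -
    obtain y where y: "\<And>y1 y2 y3. (N1 - cs z1) \<cdot> y1 + (N2 - cs z2) \<cdot> y2 + (N3 - cs z3) \<cdot> y3 \<noteq> y"
      using ex by blast
    have "\<not> koszul_exact3 (app (N1 - cs z1)) (app (N2 - cs z2)) (app (N3 - cs z3))"
    proof
      assume "koszul_exact3 (app (N1 - cs z1)) (app (N2 - cs z2)) (app (N3 - cs z3))"
      then have "surj (\<lambda>(y1, y2, y3). (N3 - cs z3) \<cdot> y1 - (N2 - cs z2) \<cdot> y2 + (N1 - cs z1) \<cdot> y3)"
        by (simp only: koszul_exact3_def Let_def)
      then obtain y1 y2 y3 where "y = (N3 - cs z3) \<cdot> y1 - (N2 - cs z2) \<cdot> y2 + (N1 - cs z1) \<cdot> y3"
        by (auto simp only: split_beta dest!: surjD[where y = y])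
      then have "(N1 - cs z1) \<cdot> y3 + (N2 - cs z2) \<cdot> (- y2) + (N3 - cs z3) \<cdot> y1 = y"
        by (simp only: app_minus_right) (simp add: algebra_simps)
      then show False using y by blast
    qed
    then show ?thesis using sp taylor_spectrum3_app by blast
  qed
  have H': "(z2, z3) \<in> bGamma"
    if "\<exists>y. \<forall>y1 y2 y3. (N1 - cs z1) \<cdot> y1 + (N2 - cs z2) \<cdot> y2 + (N3 - cs z3) \<cdot> y3 \<noteq> y" for z1 z2 z3
    using H[OF that] by (simp add: bPenta_def)
  show "N3\<^sup>\<dagger> * N3 = 1" "N2 = N2\<^sup>\<dagger> * N3"
    using Gamma_relations_from_spectrum[OF nor com H'] by simp_all
  show "N1\<^sup>\<dagger> * N1 = 1 - (1/4) *\<^sub>R (N2\<^sup>\<dagger> * N2)"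
    using Penta_relation_from_spectrum[OF nor com H] .
qed

section \<open>Extension of an isometry to a unitary\<close>

text \<open>In the applications \<open>a\<close> is the quadratic form of increasing projections at
  a fixed vector: it is monotone and bounded, hence Cauchy, and controls the squared
  increments.\<close>

lemma convergent_of_increments:
  fixes X :: "nat \<Rightarrow> 'a::chilbert_space" and a :: "nat \<Rightarrow> real"
  assumes inc: "\<And>m n. n \<le> m \<Longrightarrow> (norm (X m - X n))\<^sup>2 \<le> c * (a m - a n)"
    and a: "incseq a" "\<And>n. a n \<le> b" and c: "0 \<le> c"
  shows "convergent X"
proof -
  have "Cauchy a" using incseq_convergent[OF a(1), of b] a(2) by (metis convergent_def LIMSEQ_imp_Cauchy)
  have "Cauchy X"
  proof (rule CauchyI')
    fix e :: real assume e: "0 < e"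
    then have "0 < e\<^sup>2 / (c + 1)" using c by simp
    from CauchyD[OF \<open>Cauchy a\<close> this] obtain M where
      M: "\<And>m n. m \<ge> M \<Longrightarrow> n \<ge> M \<Longrightarrow> norm (a m - a n) < e\<^sup>2 / (c + 1)" by blast
    have "dist (X m) (X n) < e" if mn: "M \<le> m" "m < n" for m n
    proof -
      have "(norm (X n - X m))\<^sup>2 \<le> c * (a n - a m)" using inc mn by simp
      also have "\<dots> \<le> c * (e\<^sup>2 / (c + 1))"
        using M[of n m] mn c by (intro mult_left_mono) auto
      also have "\<dots> < e\<^sup>2"
        using e c mult_strict_right_mono[of c "c + 1" "e\<^sup>2"] by (simp add: pos_divide_less_eq mult.commute)
      finally show ?thesis using e by (simp add: dist_norm norm_minus_commute power2_less_imp_less)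
    qed
    then show "\<exists>M. \<forall>m\<ge>M. \<forall>n>m. dist (X m) (X n) < e" by blast
  qed
  then show ?thesis by (rule Cauchy_convergent)
qed

text \<open>Makes an identity for \<open>x * y\<close> usable as a rewrite rule inside a product
  associated to the right.\<close>

lemma mult_ext: "x * y = z \<Longrightarrow> x * (y * w) = z * (w :: 'a::semigroup_mult)"
  by (simp flip: mult.assoc)

lemma norm_isometry_app: "V\<^sup>\<dagger> * V = 1 \<Longrightarrow> norm (V \<cdot> x) = norm x"
  by (rule power2_eq_imp_eq) (simp_all add: norm_app_sq Re_cinner_self del: app_ops(5))

lemma norm_isometry_le: "V\<^sup>\<dagger> * V = 1 \<Longrightarrow> norm V \<le> 1"
  by (rule norm_cop_bound) (simp_all add: norm_isometry_app)

lemma star_power: "(T ^ n)\<^sup>\<dagger> = (T\<^sup>\<dagger>) ^ n"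
  by (induction n) (simp_all add: power_commutes)

lemma isometry_power: "V\<^sup>\<dagger> * V = 1 \<Longrightarrow> (V\<^sup>\<dagger>) ^ n * V ^ n = 1"
proof (induction n)
  case (Suc n)
  have "(V\<^sup>\<dagger>) ^ Suc n * V ^ Suc n = (V\<^sup>\<dagger>) ^ n * (V\<^sup>\<dagger> * V) * V ^ n"
    by (simp only: power_Suc2[of "V\<^sup>\<dagger>"] power_Suc[of V] mult.assoc)
  then show ?case using Suc by simp
qed simp

text \<open>By the Wold decomposition \<open>V\<close> is a unitary plus a unilateral shift with wandering subspace \<open>L\<close>.
  Re-indexing \<open>V\<^sup>k L\<close> as \<open>V\<^sup>2\<^sup>k L\<close> (the isometry \<open>A\<close>) leaves the odd powers free for the negative
  part of a bilateral shift, so that no larger space is needed.\<close>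
theorem isometry_extends_to_unitary:
  fixes V :: "'a::chilbert_space cop"
  assumes V: "V\<^sup>\<dagger> * V = 1"
  shows "\<exists>U A. U\<^sup>\<dagger> * U = 1 \<and> U * U\<^sup>\<dagger> = 1 \<and> A\<^sup>\<dagger> * A = 1 \<and> U * A = A * V"
proof -
  define Q where "Q = 1 - V * V\<^sup>\<dagger>"
  have Qs: "Q\<^sup>\<dagger> = Q" by (simp add: Q_def)
  have VsQ: "V\<^sup>\<dagger> * Q = 0" using V by (simp add: Q_def right_diff_distrib mult_ext[OF V])
  have QV: "Q * V = 0" using arg_cong[OF VsQ, of star] by (simp add: Qs)
  have QQ: "Q * Q = Q" using VsQ by (subst (1) Q_def) (simp add: left_diff_distrib mult.assoc)
  have VV: "V * V\<^sup>\<dagger> = 1 - Q" by (simp add: Q_def)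
  \<comment> \<open>\<open>S n\<close> is the sum of
    \<open>V ^ (2 * k) * Q * (V\<^sup>\<dagger>) ^ k\<close> over \<open>k < n\<close>, the
    re-indexing restricted to the first \<open>n\<close> levels. \<open>Q\<close> projects onto the
    wandering subspace, and \<open>P n\<close> onto these levels.\<close>
  define S where "S = rec_nat 0 (\<lambda>n T. Q + V * V * T * V\<^sup>\<dagger>)"
  have S: "S 0 = 0" "S (Suc n) = Q + V * V * S n * V\<^sup>\<dagger>" for n by (simp_all add: S_def)
  define P where "P n = 1 - V ^ n * (V\<^sup>\<dagger>) ^ n" for n
  have P_Suc: "P (Suc n) = Q + V * P n * V\<^sup>\<dagger>" for n
    by (simp add: P_def Q_def right_diff_distrib left_diff_distrib mult.assoc power_commutes)
  have SS: "(S m)\<^sup>\<dagger> * S n = P n" if "n \<le> m" for m n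
    using that
  proof (induction n arbitrary: m)
    case (Suc n)
    then obtain k where k: "m = Suc k" "n \<le> k" by (cases m) auto
    have "(S m)\<^sup>\<dagger> * S (Suc n) = Q * Q + Q * V * (V * S n * V\<^sup>\<dagger>) + V * (S k)\<^sup>\<dagger> * V\<^sup>\<dagger> * (V\<^sup>\<dagger> * Q)
        + V * (S k)\<^sup>\<dagger> * V\<^sup>\<dagger> * (V\<^sup>\<dagger> * V) * V * S n * V\<^sup>\<dagger>"
      by (simp add: k S Qs algebra_simps)
    also have "\<dots> = Q + V * ((S k)\<^sup>\<dagger> * S n) * V\<^sup>\<dagger>"
      using V by (simp add: QQ QV VsQ mult.assoc mult_ext[OF V])
    also have "\<dots> = P (Suc n)" unfolding Suc.IH[OF k(2)] P_Suc ..
    finally show ?case .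
  qed (simp add: S P_def)
  define a where "a x n = (norm x)\<^sup>2 - (norm ((V\<^sup>\<dagger>) ^ n \<cdot> x))\<^sup>2" for x n
  have P_quad: "Re (cinner x (P n \<cdot> x)) = a x n" for x n
  proof -
    have "cinner x (V ^ n \<cdot> (V\<^sup>\<dagger>) ^ n \<cdot> x) = cinner ((V\<^sup>\<dagger>) ^ n \<cdot> x) ((V\<^sup>\<dagger>) ^ n \<cdot> x)"
      by (simp only: cinner_app_right star_power)
    then show ?thesis by (simp add: P_def a_def cinner_linear Re_cinner_self)
  qed
  have nS: "(norm (S n \<cdot> x))\<^sup>2 = a x n" for n x by (simp only: norm_app_sq SS order_refl P_quad)
  have diffS: "(norm (S m \<cdot> x - S n \<cdot> x))\<^sup>2 = a x m - a x n" if "n \<le> m" for m n x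
  proof -
    have "Re (cinner (S m \<cdot> x) (S n \<cdot> x)) = a x n"
      using SS[OF that] P_quad[of x n] by (simp add: cinner_app_left flip: app_ops(5))
    then show ?thesis by (simp add: norm_diff_sq nS)
  qed
  have inca: "incseq (a x)" for x
    using diffS[of _ "Suc _" x] by (intro incseq_SucI) (metis diff_ge_0_iff_ge lessI less_imp_le zero_le_power2)
  have ale: "a x n \<le> (norm x)\<^sup>2" for x n by (simp add: a_def)
  have "convergent (\<lambda>n. S n \<cdot> x)" for x
    by (rule convergent_of_increments[of _ 1 "a x" "(norm x)\<^sup>2"]) (simp_all add: diffS inca ale)
  moreover have "norm (S n) \<le> 1" for n
  proof (rule norm_cop_bound)
    show "norm (S n \<cdot> x) \<le> 1 * norm x" for x
      using nS[of n x] ale[of x n] by (simp add: power2_le_imp_le)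
  qed simp
  ultimately obtain As where As: "\<And>x. (\<lambda>n. S n \<cdot> x) \<longlonglongrightarrow> As \<cdot> x"
    using strong_limit_exists[of S 1] by blast
  \<comment> \<open>\<open>Ps\<close> turns out to be the strong limit of the \<open>P n\<close>,
    the projection onto the shift part.\<close>
  define Ps where "Ps = As\<^sup>\<dagger> * As"
  have AsS: "As\<^sup>\<dagger> * S n = P n" for n
  proof (rule cop_eqI, rule cinner_ext)
    fix x z
    have "(\<lambda>m. cinner (S m \<cdot> z) (S n \<cdot> x)) \<longlonglongrightarrow> cinner (As \<cdot> z) (S n \<cdot> x)" by (intro tendsto_intros As)
    moreover have "eventually (\<lambda>m. cinner (S m \<cdot> z) (S n \<cdot> x) = cinner z (P n \<cdot> x)) sequentially"
      using eventually_ge_at_top[of n]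
      by eventually_elim (simp add: cinner_app_left SS[symmetric])
    ultimately have "(\<lambda>m. cinner z (P n \<cdot> x)) \<longlonglongrightarrow> cinner (As \<cdot> z) (S n \<cdot> x)"
      by (rule Lim_transform_eventually)
    then show "cinner z ((As\<^sup>\<dagger> * S n) \<cdot> x) = cinner z (P n \<cdot> x)"
      using LIMSEQ_unique[OF _ tendsto_const] by (fastforce simp: cinner_app_left)
  qed
  have P_lim: "(\<lambda>n. P n \<cdot> x) \<longlonglongrightarrow> Ps \<cdot> x" for x
    unfolding AsS[symmetric] Ps_def app_ops by (intro tendsto_intros As)
  have As_eq: "As = Q + V * V * As * V\<^sup>\<dagger>"
  proof (rule strong_limit_unique)
    show "(\<lambda>n. S (Suc n) \<cdot> x) \<longlonglongrightarrow> As \<cdot> x" for x by (rule LIMSEQ_Suc[OF As])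
    show "(\<lambda>n. S (Suc n) \<cdot> x) \<longlonglongrightarrow> (Q + V * V * As * V\<^sup>\<dagger>) \<cdot> x" for x
      unfolding S app_ops by (intro tendsto_intros As)
  qed
  have Ps_eq: "Ps = Q + V * Ps * V\<^sup>\<dagger>"
  proof (rule strong_limit_unique)
    show "(\<lambda>n. P (Suc n) \<cdot> x) \<longlonglongrightarrow> Ps \<cdot> x" for x by (rule LIMSEQ_Suc[OF P_lim])
    show "(\<lambda>n. P (Suc n) \<cdot> x) \<longlonglongrightarrow> (Q + V * Ps * V\<^sup>\<dagger>) \<cdot> x" for x
      unfolding P_Suc app_ops by (intro tendsto_intros P_lim)
  qed
  have Pss: "Ps\<^sup>\<dagger> = Ps" by (simp add: Ps_def)
  have PP: "P n * P m = P n" if "n \<le> m" for m n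
  proof -
    have "V ^ m = V ^ n * V ^ (m - n)" using that by (simp flip: power_add)
    then have "V ^ n * ((V\<^sup>\<dagger>) ^ n * V ^ m) = V ^ m" by (simp add: mult_ext[OF isometry_power[OF V]])
    then have "V ^ n * (V\<^sup>\<dagger>) ^ n * (V ^ m * (V\<^sup>\<dagger>) ^ m) = V ^ m * (V\<^sup>\<dagger>) ^ m" by (simp flip: mult.assoc)
    then show ?thesis by (simp add: P_def left_diff_distrib right_diff_distrib)
  qed
  have PPs: "P n * Ps = P n" for n
  proof (rule cop_eqI)
    fix x
    have "(\<lambda>m. P n \<cdot> P m \<cdot> x) \<longlonglongrightarrow> P n \<cdot> Ps \<cdot> x" by (intro tendsto_intros P_lim)
    moreover have "eventually (\<lambda>m. P n \<cdot> P m \<cdot> x = P n \<cdot> x) sequentially"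
      using eventually_ge_at_top[of n] by eventually_elim (simp add: PP flip: app_ops(5))
    ultimately have "(\<lambda>m. P n \<cdot> x) \<longlonglongrightarrow> P n \<cdot> Ps \<cdot> x" by (rule Lim_transform_eventually)
    then show "(P n * Ps) \<cdot> x = P n \<cdot> x" using LIMSEQ_unique[OF _ tendsto_const] by fastforce
  qed
  have PsPs: "Ps * Ps = Ps"
  proof (rule strong_limit_unique[OF _ P_lim])
    show "(\<lambda>n. P n \<cdot> x) \<longlonglongrightarrow> (Ps * Ps) \<cdot> x" for x
      using P_lim[of "Ps \<cdot> x"] by (simp add: PPs flip: app_ops(5))
  qed
  have PsV: "Ps * V = V * Ps"
    by (subst Ps_eq) (simp add: distrib_right QV mult.assoc V)
  have VsPs: "V\<^sup>\<dagger> * Ps = Ps * V\<^sup>\<dagger>" using arg_cong[OF PsV, of star] by (simp add: Pss)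
  have PsQ: "Ps * Q = Q" by (subst Ps_eq) (simp add: distrib_right QQ mult.assoc VsQ)
  have QPs: "Q * Ps = Q" using arg_cong[OF PsQ, of star] by (simp add: Pss Qs)
  have AsPs: "As * Ps = As"
  proof (rule cop_eqI)
    fix x
    define y where "y = x - Ps \<cdot> x"
    have "Ps \<cdot> y = (Ps - Ps * Ps) \<cdot> x" by (simp add: y_def app_linear)
    then have "Ps \<cdot> y = 0" by (simp only: PsPs) simp
    then have "(norm (As \<cdot> y))\<^sup>2 = 0" unfolding norm_app_sq Ps_def[symmetric] by simp
    then show "(As * Ps) \<cdot> x = As \<cdot> x" by (simp add: y_def app_linear)
  qed
  \<comment> \<open>Iteration gives \<open>norm (Z \<cdot> x) \<le> norm (Z \<cdot>
    (V\<^sup>\<dagger>) ^ n \<cdot> x)\<close>, and the powers of \<open>V\<^sup>\<dagger>\<close>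
    tend strongly to 0 on the range of \<open>Ps\<close>.\<close>
  have vanish: "Z = 0" if Z: "Z = W * Z * V\<^sup>\<dagger>" "Z * Ps = Z" and W: "norm W \<le> 1" for Z W :: "'a cop"
  proof (rule cop_eqI)
    fix x
    have step: "norm (Z \<cdot> y) \<le> norm (Z \<cdot> V\<^sup>\<dagger> \<cdot> y)" for y
    proof -
      have "norm (Z \<cdot> y) = norm (W \<cdot> Z \<cdot> V\<^sup>\<dagger> \<cdot> y)" by (subst Z(1)) simp
      also have "\<dots> \<le> 1 * norm (Z \<cdot> V\<^sup>\<dagger> \<cdot> y)"
        by (rule order_trans[OF norm_app_le mult_right_mono[OF W]]) simp
      finally show ?thesis by simp
    qed
    have steps: "norm (Z \<cdot> y) \<le> norm (Z \<cdot> (V\<^sup>\<dagger>) ^ n \<cdot> y)" for n y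
    proof (induction n arbitrary: y)
      case (Suc n)
      show ?case
        using order_trans[OF step Suc[of "V\<^sup>\<dagger> \<cdot> y"]] by (simp add: power_commutes flip: app_ops(5))
    qed simp
    have "(\<lambda>n. Re (cinner (Ps \<cdot> x) (P n \<cdot> Ps \<cdot> x))) \<longlonglongrightarrow> Re (cinner (Ps \<cdot> x) (Ps \<cdot> Ps \<cdot> x))"
      by (intro tendsto_intros P_lim)
    then have "(\<lambda>n. a (Ps \<cdot> x) n) \<longlonglongrightarrow> (norm (Ps \<cdot> x))\<^sup>2"
      unfolding P_quad by (simp add: PsPs Re_cinner_self flip: app_ops(5))
    then have "(\<lambda>n. (norm (Ps \<cdot> x))\<^sup>2 - a (Ps \<cdot> x) n) \<longlonglongrightarrow> (norm (Ps \<cdot> x))\<^sup>2 - (norm (Ps \<cdot> x))\<^sup>2"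
      by (intro tendsto_intros)
    then have "(\<lambda>n. sqrt ((norm ((V\<^sup>\<dagger>) ^ n \<cdot> Ps \<cdot> x))\<^sup>2)) \<longlonglongrightarrow> sqrt 0"
      unfolding a_def by (intro tendsto_real_sqrt) simp
    then have "(\<lambda>n. norm Z * norm ((V\<^sup>\<dagger>) ^ n \<cdot> Ps \<cdot> x)) \<longlonglongrightarrow> norm Z * 0"
      by (intro tendsto_intros) simp
    moreover have "norm (Z \<cdot> x) \<le> norm Z * norm ((V\<^sup>\<dagger>) ^ n \<cdot> Ps \<cdot> x)" for n
    proof -
      have "Z \<cdot> x = Z \<cdot> Ps \<cdot> x" using Z(2) by (metis app_ops(5))
      then show ?thesis using order_trans[OF steps norm_app_le] by simp
    qed
    ultimately have "norm (Z \<cdot> x) \<le> norm Z * 0" by (intro LIMSEQ_le_const) auto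
    then show "Z \<cdot> x = 0 \<cdot> x" by simp
  qed
  have nVV: "norm (V * V) \<le> 1"
    using norm_mult_ineq[of V V] mult_mono[OF norm_isometry_le[OF V] norm_isometry_le[OF V]] by simp
  have PsAs: "Ps * As = As"
  proof -
    have "As - Ps * As = (Q - Ps * Q) + (V * V * As * V\<^sup>\<dagger> - Ps * V * V * As * V\<^sup>\<dagger>)"
      by (subst (1 2) As_eq) (simp add: algebra_simps)
    also have "Ps * V * V * As * V\<^sup>\<dagger> = V * V * (Ps * As) * V\<^sup>\<dagger>"
      by (simp add: PsV mult.assoc mult_ext[OF PsV])
    finally have "As - Ps * As = V * V * (As - Ps * As) * V\<^sup>\<dagger>"
      by (simp add: PsQ algebra_simps)
    from vanish[OF this _ nVV] show ?thesis by (simp add: left_diff_distrib mult.assoc AsPs)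
  qed
  \<comment> \<open>The range of \<open>As\<close> consists of even levels and that of
    \<open>V * As\<close> of odd ones.\<close>
  have AsVAs: "As\<^sup>\<dagger> * V * As = 0"
  proof (rule vanish[OF _ _ norm_isometry_le[OF V]])
    have "As\<^sup>\<dagger> * V * As = (Q + V * As\<^sup>\<dagger> * V\<^sup>\<dagger> * V\<^sup>\<dagger>) * V * (Q + V * V * As * V\<^sup>\<dagger>)"
      using arg_cong[OF As_eq, of star] As_eq by (simp add: Qs mult.assoc)
    also have "\<dots> = V * (As\<^sup>\<dagger> * V * As) * V\<^sup>\<dagger>"
      by (simp add: distrib_left distrib_right mult.assoc QV mult_ext[OF QV] V mult_ext[OF V] VsQ)
    finally show "As\<^sup>\<dagger> * V * As = V * (As\<^sup>\<dagger> * V * As) * V\<^sup>\<dagger>" .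
    show "As\<^sup>\<dagger> * V * As * Ps = As\<^sup>\<dagger> * V * As" by (simp add: mult.assoc AsPs)
  qed
  \<comment> \<open>The identity on the unitary part and the re-indexing on the shift part;
    \<open>B\<close> sends the shift part to the odd levels.\<close>
  define A where "A = 1 - Ps + As"
  define B where "B = V * As"
  have PsAst: "As\<^sup>\<dagger> * Ps = As\<^sup>\<dagger>" using arg_cong[OF PsAs, of star] by (simp add: Pss)
  have Ast: "A\<^sup>\<dagger> = 1 - Ps + As\<^sup>\<dagger>" by (simp add: A_def Pss)
  have AA: "A\<^sup>\<dagger> * A = 1"
    unfolding Ast
    by (simp add: A_def left_diff_distrib right_diff_distrib distrib_left distrib_right PsPs PsAs PsAst Ps_def[symmetric])
  have AB: "A\<^sup>\<dagger> * B = 0"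
    unfolding Ast B_def
    by (simp add: left_diff_distrib distrib_right mult_ext[OF PsV] PsAs AsVAs flip: mult.assoc)
       (simp add: PsV mult.assoc PsAs)
  have BA: "B\<^sup>\<dagger> * A = 0" using arg_cong[OF AB, of star] by simp
  have BB: "B\<^sup>\<dagger> * B = Ps" by (simp add: B_def mult.assoc mult_ext[OF V] Ps_def)
  have BPs: "B * Ps = B" by (simp add: B_def mult.assoc AsPs)
  \<comment> \<open>\<open>R\<close> projects onto the orthogonal complement of the ranges of
    \<open>A\<close> and \<open>B\<close>. As \<open>U\<close> will be the identity there, this
    complement need not be identified.\<close>
  define R where "R = 1 - A * A\<^sup>\<dagger> - B * B\<^sup>\<dagger>"
  have Rs: "R\<^sup>\<dagger> = R" by (simp add: R_def)
  have RA: "R * A = 0" by (simp add: R_def left_diff_distrib mult.assoc AA BA)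
  have RB: "R * B = 0" by (simp add: R_def left_diff_distrib mult.assoc AB BB BPs)
  have AR: "A\<^sup>\<dagger> * R = 0" "B\<^sup>\<dagger> * R = 0"
    using arg_cong[OF RA, of star] arg_cong[OF RB, of star] by (simp_all add: Rs)
  have RR: "R * R = R"
    by (subst (2) R_def) (simp add: right_diff_distrib mult_ext[OF RA] mult_ext[OF RB])

  \<comment> \<open>On the copy \<open>A\<close> of the space \<open>U\<close> acts as
    \<open>V\<close>, on the copy \<open>B\<close> of the shift part as the backward shift, and
    \<open>A * Q * B\<^sup>\<dagger>\<close> carries the bottom level of \<open>B\<close> to that of
    \<open>A\<close>: a bilateral shift on the two copies of the shift part.\<close>
  define U where "U = A * V * A\<^sup>\<dagger> + A * Q * B\<^sup>\<dagger> + B * V\<^sup>\<dagger> * B\<^sup>\<dagger> + R"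
  have Ust: "U\<^sup>\<dagger> = A * V\<^sup>\<dagger> * A\<^sup>\<dagger> + B * Q * A\<^sup>\<dagger> + B * V * B\<^sup>\<dagger> + R"
    by (simp add: U_def Qs Rs mult.assoc)
  note rules = AA AB BA BB BPs RA RB AR RR V QQ VsQ QV PsV QPs PsQ
  have UU: "U\<^sup>\<dagger> * U = A * A\<^sup>\<dagger> + B * (Q + V * Ps * V\<^sup>\<dagger>) * B\<^sup>\<dagger> + R"
    unfolding Ust
    by (simp add: U_def distrib_left distrib_right mult.assoc rules(1-4,6-14) rules(1-4,6-14)[THEN mult_ext])
  have UU': "U * U\<^sup>\<dagger> = A * (V * V\<^sup>\<dagger> + Q) * A\<^sup>\<dagger> + B * (V\<^sup>\<dagger> * V * Ps) * B\<^sup>\<dagger> + R"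
    unfolding Ust
    by (simp add: U_def distrib_left distrib_right mult.assoc rules rules[THEN mult_ext])
  have "U\<^sup>\<dagger> * U = 1"
    unfolding UU Ps_eq[symmetric] by (simp add: BPs R_def)
  moreover have "U * U\<^sup>\<dagger> = 1"
    unfolding UU' VV V by (simp add: BPs R_def flip: mult.assoc)
  moreover have "U * A = A * V"
    by (simp add: U_def distrib_right mult.assoc AA BA RA)
  ultimately show ?thesis using AA by blast
qed

text \<open>\<open>N\<^sub>i\<close> is the strong limit of \<open>W\<^sub>n V\<^sub>i W\<^sub>n\<^sup>\<dagger>\<close>, where \<open>W\<^sub>n = U\<^sup>\<dagger>\<^sup>n A\<close>; it lives on the closed
  union of the ranges of the \<open>W\<^sub>n\<close>, the space of the minimal unitary extension of \<open>V\<close>.\<close>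
theorem relations_extend_along_unitary:
  fixes U A V V1 V2 :: "'a::chilbert_space cop"
  assumes U: "U\<^sup>\<dagger> * U = 1" "U * U\<^sup>\<dagger> = 1" and A: "A\<^sup>\<dagger> * A = 1" and UA: "U * A = A * V"
    and com: "V1 * V = V * V1" "V2 * V = V * V2" "V1 * V2 = V2 * V1"
    and rel: "V2 = V2\<^sup>\<dagger> * V" "V1\<^sup>\<dagger> * V1 = 1 - (1/4) *\<^sub>R (V2\<^sup>\<dagger> * V2)"
  shows "\<exists>N1 N2. N1 * A = A * V1 \<and> N2 * A = A * V2 \<and> N1 * U = U * N1 \<and> N2 * U = U * N2 \<and>
    N1 * N2 = N2 * N1 \<and> N2 = N2\<^sup>\<dagger> * U \<and> N1\<^sup>\<dagger> * N1 = 1 - (1/4) *\<^sub>R (N2\<^sup>\<dagger> * N2)"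
proof -
  define W where "W n = (U\<^sup>\<dagger>) ^ n * A" for n
  have WW: "(W n)\<^sup>\<dagger> * W n = 1" for n
    using isometry_power[of "U\<^sup>\<dagger>" n, THEN mult_ext] U A by (simp add: W_def star_power mult.assoc)
  have W_Suc: "W (Suc n) * V = W n" for n
  proof -
    have "W (Suc n) * V = (U\<^sup>\<dagger>) ^ n * (U\<^sup>\<dagger> * (U * A))"
      by (simp only: W_def UA power_Suc2 mult.assoc)
    then show ?thesis by (simp add: W_def mult_ext[OF U(1)])
  qed
  have UW_Suc: "U * W (Suc n) = W n" for n by (simp add: W_def mult.assoc mult_ext[OF U(2)])
  have UsW: "U\<^sup>\<dagger> * W n = W (Suc n)" for n by (simp add: W_def mult.assoc)
  have UW: "U * W n = W n * V" for n
    by (subst W_Suc[symmetric], simp only: UW_Suc flip: mult.assoc)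
  have W_add: "W (n + k) * V ^ k = W n" for n k
    by (induction k) (simp_all add: W_Suc flip: mult.assoc)
  define X where "X T n = W n * T * (W n)\<^sup>\<dagger>" for T n
  define P where "P = X 1"
  \<comment> \<open>From stage \<open>m\<close> on, \<open>X T n\<close> acts on the range of
    \<open>W m\<close> as \<open>T\<close> does on the original space. Commutation with
    \<open>V\<close> enters because \<open>W m = W n * V ^ (n - m)\<close>.\<close>
  have XW: "X T n * W m = W m * T" if "m \<le> n" "T * V = V * T" for T m n
  proof -
    have W: "W m = W n * V ^ (n - m)" using W_add[of m "n - m"] that(1) by simp
    have "V ^ (n - m) * T = T * V ^ (n - m)" by (rule power_commuting_commutes) (simp add: that)
    then show ?thesis by (simp add: W X_def mult.assoc mult_ext[OF WW])
  qed
  have PW: "P n * W m = W m" if "m \<le> n" for m n using XW[OF that, of 1] by (simp add: P_def)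
  have P: "P n = W n * (W n)\<^sup>\<dagger>" for n by (simp add: P_def X_def)
  have Ps: "(P n)\<^sup>\<dagger> = P n" for n by (simp add: P)
  have PP: "P n * P m = P m" if "m \<le> n" for m n
    using PW[OF that] by (simp add: P[of m] flip: mult.assoc)
  have PP': "P m * P n = P m" if "m \<le> n" for m n
    using arg_cong[OF PP[OF that], of star] by (simp add: Ps)
  have XP: "X T n * P m = X T m" if "m \<le> n" "T * V = V * T" for T m n
    using XW[OF that] by (simp add: P X_def flip: mult.assoc)
  have Xn: "norm (X T n) \<le> norm T" for T n
  proof -
    have "norm (W n) \<le> 1" by (rule norm_isometry_le[OF WW])
    then have "norm (W n * T) \<le> 1 * norm T" by (intro order_trans[OF norm_mult_ineq] mult_right_mono) auto
    then have "norm (W n * T) * norm (W n) \<le> (1 * norm T) * 1"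
      using \<open>norm (W n) \<le> 1\<close> by (intro mult_mono) auto
    then show ?thesis using norm_mult_ineq[of "W n * T" "(W n)\<^sup>\<dagger>"] by (simp add: X_def)
  qed
  define p where "p x n = Re (cinner x (P n \<cdot> x))" for x n
  have pn: "(norm (P n \<cdot> x))\<^sup>2 = p x n" for n x by (simp only: norm_app_sq Ps PP order_refl p_def)
  have diffP: "(norm (P m \<cdot> x - P n \<cdot> x))\<^sup>2 = p x m - p x n" if "n \<le> m" for m n x
  proof -
    have "Re (cinner (P m \<cdot> x) (P n \<cdot> x)) = p x n"
      using PP[OF that] by (simp add: cinner_app_left Ps p_def flip: app_ops(5))
    then show ?thesis by (simp add: norm_diff_sq pn)
  qed
  have incp: "incseq (p x)" for x
    using diffP[of _ "Suc _" x] by (intro incseq_SucI) (metis diff_ge_0_iff_ge lessI less_imp_le zero_le_power2)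
  have ple: "p x n \<le> norm (1 :: 'a cop) * (norm x)\<^sup>2" for x n
    using Re_cinner_app_le[of x "P n"] mult_right_mono[OF Xn[of 1 n], of "(norm x)\<^sup>2"]
    by (simp add: p_def P_def)
  \<comment> \<open>The premise stands inside the existential so that a single choice function
    \<open>\<Phi>\<close> is obtained for all \<open>T\<close>.\<close>
  have "\<exists>L. T * V = V * T \<longrightarrow> (\<forall>x. (\<lambda>n. X T n \<cdot> x) \<longlonglongrightarrow> L \<cdot> x)" for T
  proof (cases "T * V = V * T")
    case True
    have "convergent (\<lambda>n. X T n \<cdot> x)" for x
    proof (rule convergent_of_increments[OF _ incp ple])
      fix m n :: nat assume mn: "n \<le> m"
      have "X T m \<cdot> x - X T n \<cdot> x = (X T m * P m - X T m * P n) \<cdot> x"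
        using XP[OF mn True] XP[OF order_refl True, of m] by simp
      also have "\<dots> = X T m \<cdot> (P m \<cdot> x - P n \<cdot> x)" by (simp add: app_linear)
      finally have "norm (X T m \<cdot> x - X T n \<cdot> x) \<le> norm T * norm (P m \<cdot> x - P n \<cdot> x)"
        using norm_app_le[of "X T m" "P m \<cdot> x - P n \<cdot> x"]
          mult_right_mono[OF Xn[of T m], of "norm (P m \<cdot> x - P n \<cdot> x)"] by simp
      then have "(norm (X T m \<cdot> x - X T n \<cdot> x))\<^sup>2 \<le> (norm T * norm (P m \<cdot> x - P n \<cdot> x))\<^sup>2"
        by (rule power_mono) simp
      then show "(norm (X T m \<cdot> x - X T n \<cdot> x))\<^sup>2 \<le> (norm T)\<^sup>2 * (p x m - p x n)"
        by (simp only: power_mult_distrib diffP[OF mn])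
    qed simp
    from strong_limit_exists[OF this Xn] show ?thesis by blast
  qed blast
  then obtain \<Phi> where \<Phi>: "\<And>T x. T * V = V * T \<Longrightarrow> (\<lambda>n. X T n \<cdot> x) \<longlonglongrightarrow> \<Phi> T \<cdot> x" by metis
  define E where "E = \<Phi> 1"
  have E: "(\<lambda>n. P n \<cdot> x) \<longlonglongrightarrow> E \<cdot> x" for x unfolding P_def E_def by (rule \<Phi>) simp
  have \<Phi>W: "\<Phi> T * W m = W m * T" if T: "T * V = V * T" for T m
  proof (rule cop_eqI)
    fix x
    have "eventually (\<lambda>n. X T n \<cdot> W m \<cdot> x = W m \<cdot> T \<cdot> x) sequentially"
      using eventually_ge_at_top[of m] by eventually_elim (simp add: XW[OF _ T] flip: app_ops(5))
    from Lim_transform_eventually[OF \<Phi>[OF T] this]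
    have "(\<lambda>n. W m \<cdot> T \<cdot> x) \<longlonglongrightarrow> \<Phi> T \<cdot> W m \<cdot> x" .
    then show "(\<Phi> T * W m) \<cdot> x = (W m * T) \<cdot> x" using LIMSEQ_unique[OF _ tendsto_const] by fastforce
  qed
  have EW: "E * W m = W m" for m using \<Phi>W[of 1] by (simp add: E_def)
  have E\<Phi>: "E * \<Phi> T = \<Phi> T" if T: "T * V = V * T" for T
  proof (rule strong_limit_unique[OF _ \<Phi>[OF T]])
    fix x
    have "E \<cdot> X T n \<cdot> x = X T n \<cdot> x" for n
      using EW by (simp add: X_def flip: app_ops(5) mult.assoc)
    then show "(\<lambda>n. X T n \<cdot> x) \<longlonglongrightarrow> (E * \<Phi> T) \<cdot> x"
      using tendsto_app[OF \<Phi>[OF T], of E x] by simp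
  qed
  have \<Phi>E: "\<Phi> T * E = \<Phi> T" if T: "T * V = V * T" for T
  proof (rule strong_limit_unique[OF _ \<Phi>[OF T]])
    fix x
    have "\<Phi> T \<cdot> P n \<cdot> x = X T n \<cdot> x" for n
      using \<Phi>W[OF T, of n] by (simp add: P X_def flip: app_ops(5) mult.assoc)
    then show "(\<lambda>n. X T n \<cdot> x) \<longlonglongrightarrow> (\<Phi> T * E) \<cdot> x"
      using tendsto_app[OF E, of "\<Phi> T" x] by simp
  qed
  have EE: "E * E = E" using E\<Phi>[of 1] by (simp add: E_def)
  have Es: "E\<^sup>\<dagger> = E"
  proof (rule star_unique)
    fix x y
    have "(\<lambda>n. cinner (P n \<cdot> x) y) \<longlonglongrightarrow> cinner (E \<cdot> x) y"
      "(\<lambda>n. cinner x (P n \<cdot> y)) \<longlonglongrightarrow> cinner x (E \<cdot> y)"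
      by (intro tendsto_intros E)+
    then show "cinner (E \<cdot> x) y = cinner x (E \<cdot> y)"
      unfolding cinner_app_left Ps by (rule LIMSEQ_unique)
  qed
  have U\<Phi>: "\<Phi> T * U = U * \<Phi> T" if T: "T * V = V * T" for T
  proof (rule strong_limit_unique)
    fix x
    have "(W n)\<^sup>\<dagger> * U = (W (Suc n))\<^sup>\<dagger>" for n using arg_cong[OF UsW[of n], of star] by simp
    then have "X T n * U = U * X T (Suc n)" for n
      by (simp only: X_def mult.assoc mult_ext[OF UW_Suc])
    then show "(\<lambda>n. (X T n * U) \<cdot> x) \<longlonglongrightarrow> (U * \<Phi> T) \<cdot> x"
      using tendsto_app[OF LIMSEQ_Suc[OF \<Phi>[OF T]], of U x] by simp
    show "(\<lambda>n. (X T n * U) \<cdot> x) \<longlonglongrightarrow> (\<Phi> T * U) \<cdot> x"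
      using \<Phi>[OF T, of "U \<cdot> x"] by simp
  qed
  have eq_on_W: "Y = Z" if "\<And>m. Y * W m = Z * W m" "Y * E = Y" "Z * E = Z" for Y Z
  proof -
    have "Y * P m = Z * P m" for m using that(1)[of m] by (simp add: P flip: mult.assoc)
    then have YZ: "Y \<cdot> P m \<cdot> x = Z \<cdot> P m \<cdot> x" for m x by (metis app_ops(5))
    have "Y * E = Z * E"
    proof (rule strong_limit_unique)
      show "(\<lambda>m. (Y * P m) \<cdot> x) \<longlonglongrightarrow> (Y * E) \<cdot> x" for x by (simp, intro tendsto_intros E)
      show "(\<lambda>m. (Y * P m) \<cdot> x) \<longlonglongrightarrow> (Z * E) \<cdot> x" for x by (simp add: YZ, intro tendsto_intros E)
    qed
    then show ?thesis by (simp add: that)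
  qed
  \<comment> \<open>Relations with an adjoint on the left are tested in compressions:
    \<open>(W m)\<^sup>\<dagger> * N\<^sup>\<dagger>\<close> is known from \<open>N * W m\<close>,
    whereas \<open>N\<^sup>\<dagger> * W m\<close> is not.\<close>
  have eq_compress: "Y = Z" if YZ: "\<And>m. (W m)\<^sup>\<dagger> * Y * W m = (W m)\<^sup>\<dagger> * Z * W m"
      "Y * E = Y" "Z * E = Z" "E * Y = Y" "E * Z = Z" for Y Z
  proof -
    have "P m * Y * P m = P m * Z * P m" for m
      using arg_cong[OF YZ(1)[of m], of "\<lambda>T. W m * T * (W m)\<^sup>\<dagger>"] by (simp add: P mult.assoc)
    then have PYP: "P m \<cdot> Y \<cdot> P m \<cdot> x = P m \<cdot> Z \<cdot> P m \<cdot> x" for m x by (metis app_ops(5))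
    have "E * Y * E = E * Z * E"
    proof (rule cop_eqI, rule cinner_ext)
      fix x z
      have "(\<lambda>m. cinner (P m \<cdot> z) (T \<cdot> P m \<cdot> x)) \<longlonglongrightarrow> cinner (E \<cdot> z) (T \<cdot> E \<cdot> x)" for T
        by (intro tendsto_intros E)
      moreover have "cinner (P m \<cdot> z) (Y \<cdot> P m \<cdot> x) = cinner (P m \<cdot> z) (Z \<cdot> P m \<cdot> x)" for m
        by (simp add: cinner_app_left Ps PYP)
      ultimately have "cinner (E \<cdot> z) (Y \<cdot> E \<cdot> x) = cinner (E \<cdot> z) (Z \<cdot> E \<cdot> x)"
        by (metis (no_types, lifting) LIMSEQ_unique ext)
      then show "cinner z ((E * Y * E) \<cdot> x) = cinner z ((E * Z * E) \<cdot> x)"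
        by (simp add: cinner_app_left Es)
    qed
    then show ?thesis by (simp add: that mult.assoc)
  qed
  define N where "N = \<Phi> V1"
  define N2 where "N2 = \<Phi> V2"
  \<comment> \<open>On the complement of the range of \<open>E\<close> the operator
    \<open>N2\<close> vanishes, so the last relation asks \<open>N1\<close> to be isometric there;
    the identity is taken.\<close>
  define N1 where "N1 = N + 1 - E"
  note NW = \<Phi>W[OF com(1), folded N_def] \<Phi>W[OF com(2), folded N2_def]
  note NE = \<Phi>E[OF com(1), folded N_def] \<Phi>E[OF com(2), folded N2_def]
    E\<Phi>[OF com(1), folded N_def] E\<Phi>[OF com(2), folded N2_def]
  note NU = U\<Phi>[OF com(1), folded N_def] U\<Phi>[OF com(2), folded N2_def]
  have NsE: "N\<^sup>\<dagger> * E = N\<^sup>\<dagger>" "N2\<^sup>\<dagger> * E = N2\<^sup>\<dagger>" "E * N\<^sup>\<dagger> = N\<^sup>\<dagger>" "E * N2\<^sup>\<dagger> = N2\<^sup>\<dagger>"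
    using NE[THEN arg_cong[of _ _ star]] by (simp_all add: Es)
  have EU: "E * U = U * E" using U\<Phi>[of 1] by (simp add: E_def)
  have W0: "W 0 = A" by (simp add: W_def)
  have 1: "N * N2 = N2 * N"
  proof (rule eq_on_W)
    show "N * N2 * W m = N2 * N * W m" for m
      by (simp add: mult.assoc NW mult_ext[OF NW(1)] mult_ext[OF NW(2)] com(3))
  qed (simp_all add: mult.assoc NE)
  have 2: "N2 = N2\<^sup>\<dagger> * U"
  proof (rule eq_compress)
    fix m
    have s: "(W m)\<^sup>\<dagger> * N2\<^sup>\<dagger> = V2\<^sup>\<dagger> * (W m)\<^sup>\<dagger>" using arg_cong[OF NW(2)[of m], of star] by simp
    have "(W m)\<^sup>\<dagger> * (N2\<^sup>\<dagger> * U) * W m = V2\<^sup>\<dagger> * V"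
      by (simp add: mult.assoc UW mult_ext[OF s] mult_ext[OF WW])
    moreover have "(W m)\<^sup>\<dagger> * N2 * W m = V2" by (simp add: mult.assoc NW mult_ext[OF WW])
    ultimately show "(W m)\<^sup>\<dagger> * N2 * W m = (W m)\<^sup>\<dagger> * (N2\<^sup>\<dagger> * U) * W m" using rel(1) by simp
    show "N2\<^sup>\<dagger> * U * E = N2\<^sup>\<dagger> * U" by (simp add: mult.assoc EU[symmetric] mult_ext[OF NsE(2)])
    show "E * (N2\<^sup>\<dagger> * U) = N2\<^sup>\<dagger> * U" by (simp add: mult_ext[OF NsE(4)])
  qed (simp_all add: NE)
  have 3: "N\<^sup>\<dagger> * N = E - (1/4) *\<^sub>R (N2\<^sup>\<dagger> * N2)"
  proof (rule eq_compress)
    fix m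
    have s: "(W m)\<^sup>\<dagger> * N\<^sup>\<dagger> = V1\<^sup>\<dagger> * (W m)\<^sup>\<dagger>" "(W m)\<^sup>\<dagger> * N2\<^sup>\<dagger> = V2\<^sup>\<dagger> * (W m)\<^sup>\<dagger>"
      using arg_cong[OF NW(1)[of m], of star] arg_cong[OF NW(2)[of m], of star] by simp_all
    have "(W m)\<^sup>\<dagger> * (N\<^sup>\<dagger> * N) * W m = V1\<^sup>\<dagger> * V1" "(W m)\<^sup>\<dagger> * (N2\<^sup>\<dagger> * N2) * W m = V2\<^sup>\<dagger> * V2"
      by (simp_all add: mult.assoc NW mult_ext[OF s(1)] mult_ext[OF s(2)] mult_ext[OF WW])
    moreover have "(W m)\<^sup>\<dagger> * E * W m = 1" by (simp add: mult.assoc EW WW)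
    ultimately show "(W m)\<^sup>\<dagger> * (N\<^sup>\<dagger> * N) * W m = (W m)\<^sup>\<dagger> * (E - (1/4) *\<^sub>R (N2\<^sup>\<dagger> * N2)) * W m"
      using rel(2) by (simp add: right_diff_distrib left_diff_distrib)
  qed (simp_all add: left_diff_distrib right_diff_distrib mult.assoc NE EE mult_ext[OF NsE(3)] mult_ext[OF NsE(4)])
  show ?thesis
  proof (intro exI conjI)
    show "N1 * A = A * V1"
      using NW(1)[of 0] EW[of 0] by (simp add: N1_def W0 left_diff_distrib distrib_right)
    show "N2 * A = A * V2" using NW(2)[of 0] by (simp add: W0)
    show "N1 * U = U * N1"
      by (simp add: N1_def left_diff_distrib right_diff_distrib distrib_right distrib_left NU EU)
    show "N2 * U = U * N2" by (rule NU)
    show "N1 * N2 = N2 * N1"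
      by (simp add: N1_def left_diff_distrib right_diff_distrib distrib_right distrib_left 1 NE)
    show "N2 = N2\<^sup>\<dagger> * U" by (rule 2)
    show "N1\<^sup>\<dagger> * N1 = 1 - (1/4) *\<^sub>R (N2\<^sup>\<dagger> * N2)"
      by (simp add: N1_def left_diff_distrib right_diff_distrib distrib_right distrib_left 3 NE NsE Es EE)
  qed
qed

section \<open>Normal extension on the doubled space\<close>

lift_definition blk :: "'a::chilbert_space cop \<Rightarrow> 'a cop \<Rightarrow> 'a cop \<Rightarrow> 'a cop \<Rightarrow> ('a \<times> 'a) cop"
  is "\<lambda>a b c d p. (a (fst p) + b (snd p), c (fst p) + d (snd p))"
proof -
  fix a b c d :: "'a \<Rightarrow> 'a"
  assume "bounded_op a" "bounded_op b" "bounded_op c" "bounded_op d"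
  then obtain A B C D where abcd: "a = app A" "b = app B" "c = app C" "d = app D"
    by (metis bounded_opE)
  define K where "K = norm A + norm B + norm C + norm D"
  show "bounded_op (\<lambda>p. (a (fst p) + b (snd p), c (fst p) + d (snd p)))"
  proof (rule bounded_opI)
    fix p :: "'a \<times> 'a"
    have f: "norm (T \<cdot> fst p) \<le> norm T * norm p" for T
      using norm_app_le[of T "fst p"] mult_left_mono[OF norm_fst_le[of "fst p" "snd p"] norm_ge_zero[of T]] by simp
    have s: "norm (T \<cdot> snd p) \<le> norm T * norm p" for T
      using norm_app_le[of T "snd p"] mult_left_mono[OF norm_snd_le[of "snd p" "fst p"] norm_ge_zero[of T]] by simp
    have "norm (A \<cdot> fst p + B \<cdot> snd p, C \<cdot> fst p + D \<cdot> snd p)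
        \<le> norm (A \<cdot> fst p + B \<cdot> snd p) + norm (C \<cdot> fst p + D \<cdot> snd p)" by (rule norm_Pair_le)
    also have "\<dots> \<le> norm (A \<cdot> fst p) + norm (B \<cdot> snd p) + (norm (C \<cdot> fst p) + norm (D \<cdot> snd p))"
      by (intro add_mono norm_triangle_ineq)
    also have "\<dots> \<le> K * norm p"
      using f[of A] s[of B] f[of C] s[of D] by (simp add: K_def algebra_simps)
    finally show "norm (a (fst p) + b (snd p), c (fst p) + d (snd p)) \<le> K * norm p" by (simp add: abcd)
  qed (simp_all add: abcd app_linear cscale_prod_def cscale_add_right)
qed

lemma blk_app: "blk a b c d \<cdot> p = (a \<cdot> fst p + b \<cdot> snd p, c \<cdot> fst p + d \<cdot> snd p)"
  by transfer simp

lemma blk_mult: "blk a b c d * blk a' b' c' d' = blk (a * a' + b * c') (a * b' + b * d') (c * a' + d * c') (c * b' + d * d')"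
  by (rule cop_eqI) (simp add: blk_app app_linear)

lemma blk_star: "(blk a b c d)\<^sup>\<dagger> = blk (a\<^sup>\<dagger>) (c\<^sup>\<dagger>) (b\<^sup>\<dagger>) (d\<^sup>\<dagger>)"
  by (rule star_unique) (simp add: blk_app cinner_prod_def cinner_linear cinner_app_left)

lemma blk_one: "blk 1 0 0 1 = 1"
  by (rule cop_eqI) (simp add: blk_app)

lemma blk_diff_scaleR: "blk a b c d - r *\<^sub>R blk a' b' c' d'
    = blk (a - r *\<^sub>R a') (b - r *\<^sub>R b') (c - r *\<^sub>R c') (d - r *\<^sub>R d')"
  by (rule cop_eqI) (simp add: blk_app scaleR_prod_def algebra_simps)

text \<open>\<open>(C + e) (P + e) = e (D + e)\<close>, and the factor \<open>P + e\<close> has a positive inverse.\<close>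
lemma pos_diff_if_orthogonal:
  assumes P: "pos P" and D: "pos D" and C: "C = D - P" "C * P = 0"
  shows "pos C"
proof -
  have Cs: "C\<^sup>\<dagger> = C" using posD(1)[OF P] posD(1)[OF D] by (simp add: C)
  have PC: "P * C = 0" using arg_cong[OF C(2), of star] by (simp add: Cs posD(1)[OF P])
  have DP: "P * D = D * P" using C(2) PC by (simp add: C(1) algebra_simps)
  have ge: "0 \<le> Re (cinner x (C \<cdot> x)) + e * (norm x)\<^sup>2" if e: "e > 0" for e x
  proof -
    have Pe: "pos (P + e *\<^sub>R 1)" and De: "pos (D + e *\<^sub>R 1)"
      using e P D by (auto intro!: pos_add pos_scaleR pos_one)
    have "e * (norm x)\<^sup>2 \<le> Re (cinner x ((P + e *\<^sub>R 1) \<cdot> x))" for x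
      using posD(2)[OF P, of x] by (simp add: cinner_linear Re_cinner_self)
    from pos_bounded_below_inverse[OF Pe e this] obtain F where
      F: "(P + e *\<^sub>R 1) * F = 1" "pos F" "\<And>S. S * (P + e *\<^sub>R 1) = (P + e *\<^sub>R 1) * S \<Longrightarrow> S * F = F * S" by blast
    have "(D + e *\<^sub>R 1) * F = F * (D + e *\<^sub>R 1)"
      by (rule F(3)) (simp add: distrib_left distrib_right DP scaleR_add_right)
    then have pos: "pos (e *\<^sub>R ((D + e *\<^sub>R 1) * F))"
      using e by (intro pos_scaleR pos_mult De F(2)) auto
    have "(C + e *\<^sub>R 1) * (P + e *\<^sub>R 1) = e *\<^sub>R (D + e *\<^sub>R 1)"
      using C(2) unfolding C(1) by (simp only: distrib_left distrib_right scaleR_add_right mult_scaleR_left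
          mult_scaleR_right mult_1_left mult_1_right) (simp add: scaleR_diff_right)
    then have "e *\<^sub>R ((D + e *\<^sub>R 1) * F) = (C + e *\<^sub>R 1) * ((P + e *\<^sub>R 1) * F)"
      by (simp flip: mult.assoc)
    then have "pos (C + e *\<^sub>R 1)" using pos by (simp add: F(1))
    then show ?thesis using posD(2)[of "C + e *\<^sub>R 1" x] by (simp add: cinner_linear Re_cinner_self)
  qed
  have "0 \<le> Re (cinner x (C \<cdot> x))" for x
  proof (rule field_le_epsilon)
    fix e :: real assume e: "0 < e"
    define h where "h = e / ((norm x)\<^sup>2 + 1)"
    have h: "h > 0" using e by (simp add: h_def add_nonneg_pos)
    have "h * (norm x)\<^sup>2 \<le> e"
      using e h by (simp add: h_def pos_divide_le_eq add_nonneg_pos mult_left_mono)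
    then show "0 \<le> Re (cinner x (C \<cdot> x)) + e" using ge[OF h, of x] by linarith
  qed
  then show ?thesis using Cs by (simp add: pos_def)
qed

text \<open>\<open>T\<close> commutes with \<open>T\<^sup>\<dagger> * T\<close>, so the
  self-commutator \<open>C = T\<^sup>\<dagger> * T - T * T\<^sup>\<dagger>\<close> satisfies
  \<open>C * T = 0\<close>. It is therefore positive, and its square root \<open>R\<close> satisfies
  \<open>R * T = 0\<close>. Both products of \<open>M1\<close> with its adjoint are then diagonal
  with entries \<open>T\<^sup>\<dagger> * T\<close>, which gives normality and the last relation
  together.\<close>

lemma normal_extension_of_relations:
  fixes T N U :: "'a::chilbert_space cop"
  assumes U: "U\<^sup>\<dagger> * U = 1" "U * U\<^sup>\<dagger> = 1"
    and com: "T * U = U * T" "N * U = U * N" "T * N = N * T"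
    and rel: "N = N\<^sup>\<dagger> * U" "T\<^sup>\<dagger> * T = 1 - (1/4) *\<^sub>R (N\<^sup>\<dagger> * N)"
  shows "\<exists>R. let M1 = blk T R 0 (T\<^sup>\<dagger>); M2 = blk N 0 0 N; M3 = blk U 0 0 U in
    normal M1 \<and> normal M2 \<and> normal M3 \<and> M1 * M2 = M2 * M1 \<and> M1 * M3 = M3 * M1 \<and> M2 * M3 = M3 * M2 \<and>
    M3\<^sup>\<dagger> * M3 = 1 \<and> M2 = M2\<^sup>\<dagger> * M3 \<and> M1\<^sup>\<dagger> * M1 = 1 - (1/4) *\<^sub>R (M2\<^sup>\<dagger> * M2)"
proof -
  have Us: "M * U\<^sup>\<dagger> = U\<^sup>\<dagger> * M" if "M * U = U * M" for M
  proof -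
    have "M * U\<^sup>\<dagger> = U\<^sup>\<dagger> * (U * M) * U\<^sup>\<dagger>" by (simp add: mult_ext[OF U(1)] flip: mult.assoc) (simp add: U)
    also have "\<dots> = U\<^sup>\<dagger> * M" by (simp add: that[symmetric] mult.assoc U)
    finally show ?thesis .
  qed
  have Ns: "N\<^sup>\<dagger> = U\<^sup>\<dagger> * N" using arg_cong[OF rel(1), of star] by simp
  have NN: "N * N\<^sup>\<dagger> = N\<^sup>\<dagger> * N" unfolding Ns by (simp add: Us[OF com(2)] flip: mult.assoc)
  have TNs: "T * N\<^sup>\<dagger> = N\<^sup>\<dagger> * T"
    unfolding Ns by (rule commute_mult_right[OF Us[OF com(1)] com(3)])
  have NTs: "N * T\<^sup>\<dagger> = T\<^sup>\<dagger> * N" using arg_cong[OF TNs, of star] by simp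
  have UTs: "U * T\<^sup>\<dagger> = T\<^sup>\<dagger> * U" using arg_cong[OF Us[OF com(1)], of star] by simp
  define D where "D = T\<^sup>\<dagger> * T"
  define C where "C = D - T * T\<^sup>\<dagger>"
  have DT: "T * D = D * T"
    unfolding D_def rel(2) using commute_mult_right[OF TNs com(3)]
    by (simp add: right_diff_distrib left_diff_distrib)
  have CT: "C * T = 0" by (simp add: C_def left_diff_distrib mult.assoc D_def[symmetric] DT)
  have "pos C"
  proof (rule pos_diff_if_orthogonal)
    show "pos (T * T\<^sup>\<dagger>)" using pos_star_mult[of "T\<^sup>\<dagger>"] by simp
    show "pos D" unfolding D_def by (rule pos_star_mult)
    show "C * (T * T\<^sup>\<dagger>) = 0" by (simp add: mult_ext[OF CT])
  qed (rule C_def)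
  then obtain R where R: "R\<^sup>\<dagger> = R" "R * R = C" "\<And>S. S * C = C * S \<Longrightarrow> S * R = R * S"
    using pos_sqrt_exists by blast
  have RT: "R * T = 0"
  proof (rule cop_eqI)
    fix x
    have "(norm (R \<cdot> T \<cdot> x))\<^sup>2 = Re (cinner (T \<cdot> x) ((C * T) \<cdot> x))"
      by (simp add: norm_app_sq R(1) flip: R(2))
    then show "(R * T) \<cdot> x = 0 \<cdot> x" by (simp only: CT) simp
  qed
  have TsR: "T\<^sup>\<dagger> * R = 0" using arg_cong[OF RT, of star] by (simp add: R)
  have RM: "M * R = R * M" if "M * T = T * M" "M * T\<^sup>\<dagger> = T\<^sup>\<dagger> * M" for M
    using commute_mult_right[OF that(2,1)] commute_mult_right[OF that]
    by (intro R(3)) (simp add: C_def D_def right_diff_distrib left_diff_distrib)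
  have RN: "N * R = R * N" by (rule RM[OF com(3)[symmetric] NTs])
  have RU: "U * R = R * U" by (rule RM[OF com(1)[symmetric] UTs])
  have C': "T * T\<^sup>\<dagger> + R * R = T\<^sup>\<dagger> * T" by (simp add: R C_def D_def)
  show ?thesis
    unfolding Let_def normal_def blk_star blk_mult blk_one[symmetric] blk_diff_scaleR
    using C' RT TsR RN RU com NN U NTs UTs
    by (intro exI[of _ R]) (simp add: R(1) add.commute rel(2)[symmetric] rel(1)[symmetric])
qed

section \<open>Isometries and relations\<close>

lemma isometric_embedding_cinner:
  assumes "isometric_embedding J"
  shows "cinner (J x) (J y) = cinner x y"
proof -
  have J: "J (x + y) = J x + J y" "J (cscale c x) = cscale c (J x)" "norm (J x) = norm x" for c x y
    using assms by (auto simp: isometric_embedding_def clinear_map_def)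
  have Re: "Re (cinner (J x) (J y)) = Re (cinner x y)" for x y
    using norm_add_sq[of "J x" "J y"] norm_add_sq[of x y] by (simp add: J flip: J(1))
  show ?thesis
    using Re[of x y] Re[of x "cscale \<i> y"] by (simp add: complex_eq_iff J cinner_linear)
qed

text \<open>The adjoint of a restriction is not the restriction of the adjoint, but
  \<open>T\<^sup>\<dagger> * S\<close> is determined by the inner products of
  \<open>T \<cdot> x\<close> and \<open>S \<cdot> y\<close>, which the embedding preserves. All the
  relations have this shape.\<close>

lemma isometric_embedding_star_mult:
  assumes "isometric_embedding J" "\<And>x. N \<cdot> J x = J (T \<cdot> x)" "\<And>x. M \<cdot> J x = J (S \<cdot> x)"
  shows "cinner x ((T\<^sup>\<dagger> * S) \<cdot> y) = cinner (J x) ((N\<^sup>\<dagger> * M) \<cdot> J y)"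
  by (simp add: assms(2,3) isometric_embedding_cinner[OF assms(1)] flip: cinner_app_left)

text \<open>Both extensions come from the same triple of block matrices: its last two members extend
  the pair.\<close>

lemma Penta_isometry_of_relations:
  fixes V1 V2 V3 :: "'a::chilbert_space cop"
  assumes com: "V1 * V2 = V2 * V1" "V1 * V3 = V3 * V1" "V2 * V3 = V3 * V2"
    and rel: "V3\<^sup>\<dagger> * V3 = 1" "V2 = V2\<^sup>\<dagger> * V3" "V1\<^sup>\<dagger> * V1 = 1 - (1/4) *\<^sub>R (V2\<^sup>\<dagger> * V2)"
  shows "Penta_isometry_in TYPE('a \<times> 'a) (app V1) (app V2) (app V3)"
    and "Gamma_isometry_in TYPE('a \<times> 'a) (app V2) (app V3)"
proof -
  obtain U A where U: "U\<^sup>\<dagger> * U = 1" "U * U\<^sup>\<dagger> = 1" and A: "A\<^sup>\<dagger> * A = 1" and UA: "U * A = A * V3"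
    using isometry_extends_to_unitary[OF rel(1)] by blast
  obtain T N where TA: "T * A = A * V1" and NA: "N * A = A * V2"
    and TNU: "T * U = U * T" "N * U = U * N" "T * N = N * T"
    and TN_rel: "N = N\<^sup>\<dagger> * U" "T\<^sup>\<dagger> * T = 1 - (1/4) *\<^sub>R (N\<^sup>\<dagger> * N)"
    using relations_extend_along_unitary[OF U A UA com(2,3,1) rel(2,3)] by blast
  obtain R where R: "let M1 = blk T R 0 (T\<^sup>\<dagger>); M2 = blk N 0 0 N; M3 = blk U 0 0 U in
    normal M1 \<and> normal M2 \<and> normal M3 \<and> M1 * M2 = M2 * M1 \<and> M1 * M3 = M3 * M1 \<and> M2 * M3 = M3 * M2 \<and>
    M3\<^sup>\<dagger> * M3 = 1 \<and> M2 = M2\<^sup>\<dagger> * M3 \<and> M1\<^sup>\<dagger> * M1 = 1 - (1/4) *\<^sub>R (M2\<^sup>\<dagger> * M2)"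
    using normal_extension_of_relations[OF U TNU TN_rel] by blast
  define M1 M2 M3 where "M1 = blk T R 0 (T\<^sup>\<dagger>)" and "M2 = blk N 0 0 N" and "M3 = blk U 0 0 U"
  have M: "normal M1" "normal M2" "normal M3" "M1 * M2 = M2 * M1" "M1 * M3 = M3 * M1" "M2 * M3 = M3 * M2"
    "M3\<^sup>\<dagger> * M3 = 1" "M2 = M2\<^sup>\<dagger> * M3" "M1\<^sup>\<dagger> * M1 = 1 - (1/4) *\<^sub>R (M2\<^sup>\<dagger> * M2)"
    using R unfolding Let_def M1_def[symmetric] M2_def[symmetric] M3_def[symmetric] by blast+
  have "norm M2 \<le> 2"
  proof (rule norm_cop_bound)
    fix x
    have "(norm (M1 \<cdot> x))\<^sup>2 = (norm x)\<^sup>2 - (norm (M2 \<cdot> x))\<^sup>2 / 4"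
      unfolding norm_app_sq M(9) by (simp add: cinner_linear Re_cinner_self)
    then have "(norm (M2 \<cdot> x))\<^sup>2 \<le> (2 * norm x)\<^sup>2"
      using zero_le_power2[of "norm (M1 \<cdot> x)"] unfolding power_mult_distrib by simp
    then show "norm (M2 \<cdot> x) \<le> 2 * norm x" by (rule power2_le_imp_le) simp
  qed simp
  note P = Penta_unitaryI[OF M(1-8) this M(9)] and G = Gamma_unitaryI[OF M(2,3,6-8) this]
  \<comment> \<open>The lower left entries of the block matrices are 0, so the first coordinate
    space is invariant under all three; \<open>A\<close> embeds the given space into it.\<close>
  define J where "J x = (A \<cdot> x, 0 :: 'a)" for x
  have J: "isometric_embedding J"
    by (simp add: isometric_embedding_def clinear_map_def J_def app_linear cscale_prod_def norm_isometry_app[OF A])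
  have MJ: "M1 \<cdot> J x = J (V1 \<cdot> x)" "M2 \<cdot> J x = J (V2 \<cdot> x)" "M3 \<cdot> J x = J (V3 \<cdot> x)" for x
    using TA NA UA by (simp_all add: M1_def M2_def M3_def J_def blk_app flip: app_ops(5))
  show "Penta_isometry_in TYPE('a \<times> 'a) (app V1) (app V2) (app V3)"
    unfolding Penta_isometry_in_def using J P MJ by blast
  show "Gamma_isometry_in TYPE('a \<times> 'a) (app V2) (app V3)"
    unfolding Gamma_isometry_in_def using J G MJ by blast
qed

lemma Gamma_isometry_relations:
  fixes V2 V3 :: "'a::chilbert_space cop"
  assumes "Gamma_isometry_in TYPE('c::chilbert_space) (app V2) (app V3)"
  shows "V3\<^sup>\<dagger> * V3 = 1" "V2 = V2\<^sup>\<dagger> * V3"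
proof -
  obtain J :: "'a \<Rightarrow> 'c" and f2 f3 where J: "isometric_embedding J" and un: "Gamma_unitary f2 f3"
    and f: "\<And>x. f2 (J x) = J (V2 \<cdot> x)" "\<And>x. f3 (J x) = J (V3 \<cdot> x)"
    using assms unfolding Gamma_isometry_in_def by blast
  then obtain N2 N3 where N: "f2 = app N2" "f3 = app N3"
    by (metis Gamma_unitary_def normal_op_def bounded_opE)
  note rel = Gamma_unitary_relations[OF un[unfolded N]]
  note f = f[unfolded N]
  note cc = isometric_embedding_star_mult[OF J] and ci = isometric_embedding_cinner[OF J]
  show "V3\<^sup>\<dagger> * V3 = 1"
    by (rule cop_eqI, rule cinner_ext) (simp only: cc[OF f(2) f(2)] rel(1) app_ops(6) ci)
  show "V2 = V2\<^sup>\<dagger> * V3"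
    by (rule cop_eqI, rule cinner_ext) (simp only: cc[OF f(1) f(2)] rel(2)[symmetric] f ci)
qed

lemma Penta_isometry_relations:
  fixes V1 V2 V3 :: "'a::chilbert_space cop"
  assumes "Penta_isometry_in TYPE('b::chilbert_space) (app V1) (app V2) (app V3)"
  shows "V3\<^sup>\<dagger> * V3 = 1" "V2 = V2\<^sup>\<dagger> * V3" "V1\<^sup>\<dagger> * V1 = 1 - (1/4) *\<^sub>R (V2\<^sup>\<dagger> * V2)"
proof -
  obtain J :: "'a \<Rightarrow> 'b" and f1 f2 f3 where J: "isometric_embedding J" and un: "Penta_unitary f1 f2 f3"
    and f: "\<And>x. f1 (J x) = J (V1 \<cdot> x)" "\<And>x. f2 (J x) = J (V2 \<cdot> x)" "\<And>x. f3 (J x) = J (V3 \<cdot> x)"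
    using assms unfolding Penta_isometry_in_def by blast
  then obtain N1 N2 N3 where N: "f1 = app N1" "f2 = app N2" "f3 = app N3"
    by (metis Penta_unitary_def normal_op_def bounded_opE)
  note rel = Penta_unitary_relations[OF un[unfolded N]]
  note f = f[unfolded N]
  note cc = isometric_embedding_star_mult[OF J] and ci = isometric_embedding_cinner[OF J]
  show "V3\<^sup>\<dagger> * V3 = 1"
    by (rule cop_eqI, rule cinner_ext) (simp only: cc[OF f(3) f(3)] rel(1) app_ops(6) ci)
  show "V2 = V2\<^sup>\<dagger> * V3"
    by (rule cop_eqI, rule cinner_ext) (simp only: cc[OF f(2) f(3)] rel(2)[symmetric] f ci)
  show "V1\<^sup>\<dagger> * V1 = 1 - (1/4) *\<^sub>R (V2\<^sup>\<dagger> * V2)"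
    by (rule cop_eqI, rule cinner_ext)
       (simp only: cc[OF f(1) f(1)] rel(3) app_ops(2,6,7) cinner_diff_right cinner_scaleR_right cc[OF f(2) f(2)] ci)
qed

theorem mainTheorem12:
  fixes V1 V2 V3 :: "'a::chilbert_space \<Rightarrow> 'a"
  assumes "bounded_op V1" and "bounded_op V2" and "bounded_op V3"
    and "commute V1 V2" and "commute V1 V3" and "commute V2 V3"
  shows "(Penta_isometry_in TYPE('b::chilbert_space) V1 V2 V3 \<longrightarrow>
            Gamma_isometry_in TYPE('a \<times> 'a) V2 V3
            \<and> adj V1 \<circ> V1 = (\<lambda>x. x - cscale (1/4) (adj V2 (V2 x))))
       \<and> (Gamma_isometry_in TYPE('c::chilbert_space) V2 V3
            \<and> adj V1 \<circ> V1 = (\<lambda>x. x - cscale (1/4) (adj V2 (V2 x)))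
            \<longrightarrow> Penta_isometry_in TYPE('a \<times> 'a) V1 V2 V3)"
proof -
  obtain T1 T2 T3 where T: "V1 = app T1" "V2 = app T2" "V3 = app T3"
    using assms(1-3) by (metis bounded_opE)
  have com: "T1 * T2 = T2 * T1" "T1 * T3 = T3 * T1" "T2 * T3 = T3 * T2"
    using assms(4-6) by (simp_all add: T commute_app)
  have "adj V1 \<circ> V1 = (\<lambda>x. x - cscale (1/4) (adj V2 (V2 x))) \<longleftrightarrow>
      app (T1\<^sup>\<dagger> * T1) = app (1 - (1/4) *\<^sub>R (T2\<^sup>\<dagger> * T2))"
    by (simp add: fun_eq_iff T star.rep_eq scaleR_cscale)
  then have eq: "adj V1 \<circ> V1 = (\<lambda>x. x - cscale (1/4) (adj V2 (V2 x))) \<longleftrightarrow>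
      T1\<^sup>\<dagger> * T1 = 1 - (1/4) *\<^sub>R (T2\<^sup>\<dagger> * T2)"
    by (simp only: app_inject)
  show ?thesis
    unfolding eq unfolding T
    using Penta_isometry_relations[of T1 T2 T3] Gamma_isometry_relations[of T2 T3]
      Penta_isometry_of_relations[OF com] by blast
qed

end
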